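(* Let $A$ be a Noetherian graded ring, let $M$ be a finitely generated graded $A$-module, and let $\mathfrak p$ be a prime ideal minimal over the graded ideal $\mathrm{Ann}_A(M)$. Then a *composition series exists for the graded $A_{[\mathfrak p]}$-module $M_{[\mathfrak p]}$. Moreover, $${}^*\ell_{A_{[\mathfrak p]}}(M_{[\mathfrak p]})=\ell_{A_{\mathfrak p}}(M_{\mathfrak p}).$$
   Context: All rings are commutative; "graded" means $\mathbb Z$-graded. (Primes minimal over $\mathrm{Ann}_A(M)$ are automatically graded.) $M_{[\mathfrak p]}=T^{-1}M$, where $T$ is the set of homogeneous elements of $A-\mathfrak p$; it is a graded module over the graded ring $A_{[\mathfrak p]}=T^{-1}A$ via $\deg(m/t)=\deg m-\deg t$. $M_{\mathfrak p}$, $A_{\mathfrak p}$ are the ordinary localizations (forgetting gradings), and $\ell$ is ordinary length. A *simple module is a nonzero graded module with no nonzero proper graded submodules. A *composition series of a graded module $N$ is a finite chain $0=N^0\subset\cdots\subset N^n=N$ of graded submodules with *simple successive quotients; all *composition series of $N$ have the same length $n$, denoted ${}^*\ell(N)$ (and ${}^*\ell(N)=\infty$ if none exists). *)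

theory Defs
  imports "HOL-Algebra.Ring_Divisibility" "HOL-Algebra.Module" "HOL-Library.Extended_Nat"
begin

section \<open>Graded rings and modules\<close>

definition direct_sum_decomposition :: "('b, 'm) ring_scheme \<Rightarrow> (int \<Rightarrow> 'b set) \<Rightarrow> bool" where
  "direct_sum_decomposition G D \<longleftrightarrow>
     (\<forall>i. subgroup (D i) (add_monoid G)) \<and>
     (\<forall>x\<in>carrier G. \<exists>!c. (\<forall>i. c i \<in> D i) \<and> finite {i. c i \<noteq> \<zero>\<^bsub>G\<^esub>} \<and>
        x = (\<Oplus>\<^bsub>G\<^esub>i\<in>{i. c i \<noteq> \<zero>\<^bsub>G\<^esub>}. c i))"

locale graded_ring = cring R
  for R :: "('a, 'r) ring_scheme" (structure) and \<A> :: "int \<Rightarrow> 'a set" +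
  assumes ring_decomposition: "direct_sum_decomposition R \<A>"
    and graded_mult: "\<lbrakk>a \<in> \<A> i; b \<in> \<A> j\<rbrakk> \<Longrightarrow> a \<otimes> b \<in> \<A> (i + j)"

locale graded_module = graded_ring R \<A> + module R M
  for R :: "('a, 'r) ring_scheme" (structure) and \<A> :: "int \<Rightarrow> 'a set"
    and M :: "('a, 'b, 'm) module_scheme" (structure) and \<M> :: "int \<Rightarrow> 'b set" +
  assumes module_decomposition: "direct_sum_decomposition M \<M>"
    and graded_smult: "\<lbrakk>a \<in> \<A> i; x \<in> \<M> j\<rbrakk> \<Longrightarrow> a \<odot>\<^bsub>M\<^esub> x \<in> \<M> (i + j)"

definition graded_submodule ::
    "('a, 'r) ring_scheme \<Rightarrow> (int \<Rightarrow> 'a set) \<Rightarrow> ('a, 'b, 'm) module_scheme \<Rightarrow> (int \<Rightarrow> 'b set)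
      \<Rightarrow> 'b set \<Rightarrow> bool" where
  "graded_submodule R \<A> M \<M> N \<longleftrightarrow>
     submodule N R M \<and> graded_module R \<A> (M\<lparr>carrier := N\<rparr>) (\<lambda>i. \<M> i \<inter> N)"


section \<open>Annihilators, finite generation, minimal primes\<close>

definition annihilator :: "('a, 'r) ring_scheme \<Rightarrow> ('a, 'b, 'm) module_scheme \<Rightarrow> 'a set" where
  "annihilator R M = {a \<in> carrier R. \<forall>x\<in>carrier M. a \<odot>\<^bsub>M\<^esub> x = \<zero>\<^bsub>M\<^esub>}"

definition gen_submodule ::
    "('a, 'r) ring_scheme \<Rightarrow> ('a, 'b, 'm) module_scheme \<Rightarrow> 'b set \<Rightarrow> 'b set" where
  "gen_submodule R M S = \<Inter>{N. submodule N R M \<and> S \<subseteq> N}"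

definition finitely_generated ::
    "('a, 'r) ring_scheme \<Rightarrow> ('a, 'b, 'm) module_scheme \<Rightarrow> bool" where
  "finitely_generated R M \<longleftrightarrow> (\<exists>S \<subseteq> carrier M. finite S \<and> carrier M = gen_submodule R M S)"

definition minimal_prime_over :: "('a, 'r) ring_scheme \<Rightarrow> 'a set \<Rightarrow> 'a set \<Rightarrow> bool" where
  "minimal_prime_over R I P \<longleftrightarrow>
     primeideal P R \<and> I \<subseteq> P \<and> (\<forall>Q. primeideal Q R \<and> I \<subseteq> Q \<and> Q \<subseteq> P \<longrightarrow> Q = P)"


section \<open>Localization\<close>

text \<open>
  The fraction \<open>m/t\<close> is the class of \<open>(m, t)\<close> for the relation
  \<open>(m, t) \<sim> (n, s) \<longleftrightarrow> (\<exists>u\<in>T. u s m = u t n)\<close>. The operations on classes are unions over all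
  representatives, as for \<^const>\<open>rcoset_mult\<close>. The fields \<^const>\<open>mult\<close> and \<^const>\<open>one\<close> of
  a module record carry no meaning and are left unspecified.
\<close>

definition mfrac ::
    "'a set \<Rightarrow> ('a, 'b, 'm) module_scheme \<Rightarrow> 'b \<Rightarrow> 'a \<Rightarrow> ('b \<times> 'a) set" where
  "mfrac T M m t =
     {(n, s). n \<in> carrier M \<and> s \<in> T \<and>
        (\<exists>u\<in>T. u \<odot>\<^bsub>M\<^esub> (s \<odot>\<^bsub>M\<^esub> m) = u \<odot>\<^bsub>M\<^esub> (t \<odot>\<^bsub>M\<^esub> n))}"

definition frac_add ::
    "('a, 'r) ring_scheme \<Rightarrow> 'a set \<Rightarrow> ('a, 'b, 'm) module_scheme
      \<Rightarrow> ('b \<times> 'a) set \<Rightarrow> ('b \<times> 'a) set \<Rightarrow> ('b \<times> 'a) set" where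
  "frac_add R T M X Y =
     (\<Union>(m, s)\<in>X. \<Union>(n, t)\<in>Y. mfrac T M (t \<odot>\<^bsub>M\<^esub> m \<oplus>\<^bsub>M\<^esub> s \<odot>\<^bsub>M\<^esub> n) (s \<otimes>\<^bsub>R\<^esub> t))"

definition frac_smult ::
    "('a, 'r) ring_scheme \<Rightarrow> 'a set \<Rightarrow> ('a, 'b, 'm) module_scheme
      \<Rightarrow> ('a \<times> 'a) set \<Rightarrow> ('b \<times> 'a) set \<Rightarrow> ('b \<times> 'a) set" where
  "frac_smult R T M X Y =
     (\<Union>(a, s)\<in>X. \<Union>(n, t)\<in>Y. mfrac T M (a \<odot>\<^bsub>M\<^esub> n) (s \<otimes>\<^bsub>R\<^esub> t))"

definition loc_module ::
    "('a, 'r) ring_scheme \<Rightarrow> 'a set \<Rightarrow> ('a, 'b, 'm) module_scheme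
      \<Rightarrow> (('a \<times> 'a) set, ('b \<times> 'a) set) module" where
  "loc_module R T M =
     \<lparr>carrier = {mfrac T M m t | m t. m \<in> carrier M \<and> t \<in> T},
      mult = undefined, one = undefined,
      zero = mfrac T M \<zero>\<^bsub>M\<^esub> \<one>\<^bsub>R\<^esub>, add = frac_add R T M,
      smult = frac_smult R T M\<rparr>"

definition self_module :: "('a, 'r) ring_scheme \<Rightarrow> ('a, 'a) module" where
  "self_module R =
     \<lparr>carrier = carrier R, mult = mult R, one = \<one>\<^bsub>R\<^esub>, zero = \<zero>\<^bsub>R\<^esub>, add = add R, smult = mult R\<rparr>"

definition loc_ring :: "('a, 'r) ring_scheme \<Rightarrow> 'a set \<Rightarrow> ('a \<times> 'a) set ring" where
  "loc_ring R T =
     \<lparr>carrier = {mfrac T (self_module R) a t | a t. a \<in> carrier R \<and> t \<in> T},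
      mult = frac_smult R T (self_module R), one = mfrac T (self_module R) \<one>\<^bsub>R\<^esub> \<one>\<^bsub>R\<^esub>,
      zero = mfrac T (self_module R) \<zero>\<^bsub>R\<^esub> \<one>\<^bsub>R\<^esub>, add = frac_add R T (self_module R)\<rparr>"

text \<open>
  \<open>deg (m/t) = deg m - deg t\<close>, for a set \<open>T\<close> of homogeneous elements.
\<close>

definition loc_grading ::
    "(int \<Rightarrow> 'a set) \<Rightarrow> 'a set \<Rightarrow> ('a, 'b, 'm) module_scheme
      \<Rightarrow> (int \<Rightarrow> 'b set) \<Rightarrow> int \<Rightarrow> ('b \<times> 'a) set set" where
  "loc_grading \<A> T M \<M> i =
     {mfrac T M m t | m t j k. m \<in> \<M> j \<and> t \<in> T \<inter> \<A> k \<and> j - k = i}"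

abbreviation prime_loc_ring where
  "prime_loc_ring R P \<equiv> loc_ring R (carrier R - P)"

abbreviation prime_loc_module where
  "prime_loc_module R P M \<equiv> loc_module R (carrier R - P) M"

definition homog_compl :: "(int \<Rightarrow> 'a set) \<Rightarrow> 'a set \<Rightarrow> 'a set" where
  "homog_compl \<A> P = (\<Union>i. \<A> i) - P"

abbreviation homog_loc_ring where
  "homog_loc_ring R \<A> P \<equiv> loc_ring R (homog_compl \<A> P)"

abbreviation homog_loc_ring_grading where
  "homog_loc_ring_grading R \<A> P \<equiv> loc_grading \<A> (homog_compl \<A> P) (self_module R) \<A>"

abbreviation homog_loc_module where
  "homog_loc_module R \<A> P M \<equiv> loc_module R (homog_compl \<A> P) M"

abbreviation homog_loc_module_grading where
  "homog_loc_module_grading \<A> P M \<M> \<equiv> loc_grading \<A> (homog_compl \<A> P) M \<M>"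


section \<open>Quotients and composition series\<close>

definition quot_module ::
    "('a, 'b, 'm) module_scheme \<Rightarrow> 'b set \<Rightarrow> ('a, 'b set) module" where
  "quot_module M N =
     \<lparr>carrier = a_rcosets\<^bsub>M\<^esub> N, mult = undefined, one = undefined, zero = N, add = set_add M,
      smult = (\<lambda>a X. \<Union>x\<in>X. N +>\<^bsub>M\<^esub> (a \<odot>\<^bsub>M\<^esub> x))\<rparr>"

definition quot_grading ::
    "('a, 'b, 'm) module_scheme \<Rightarrow> (int \<Rightarrow> 'b set) \<Rightarrow> 'b set \<Rightarrow> int \<Rightarrow> 'b set set" where
  "quot_grading M \<M> N i = (\<lambda>x. N +>\<^bsub>M\<^esub> x) ` \<M> i"

definition simple_module :: "('a, 'r) ring_scheme \<Rightarrow> ('a, 'b, 'm) module_scheme \<Rightarrow> bool" where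
  "simple_module R M \<longleftrightarrow>
     module R M \<and> carrier M \<noteq> {\<zero>\<^bsub>M\<^esub>} \<and>
     (\<forall>N. submodule N R M \<longrightarrow> N = {\<zero>\<^bsub>M\<^esub>} \<or> N = carrier M)"

definition star_simple_module ::
    "('a, 'r) ring_scheme \<Rightarrow> (int \<Rightarrow> 'a set) \<Rightarrow> ('a, 'b, 'm) module_scheme \<Rightarrow> (int \<Rightarrow> 'b set)
      \<Rightarrow> bool" where
  "star_simple_module R \<A> M \<M> \<longleftrightarrow>
     graded_module R \<A> M \<M> \<and> carrier M \<noteq> {\<zero>\<^bsub>M\<^esub>} \<and>
     (\<forall>N. graded_submodule R \<A> M \<M> N \<longrightarrow> N = {\<zero>\<^bsub>M\<^esub>} \<or> N = carrier M)"

definition composition_series ::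
    "('a, 'r) ring_scheme \<Rightarrow> ('a, 'b, 'm) module_scheme \<Rightarrow> nat \<Rightarrow> (nat \<Rightarrow> 'b set) \<Rightarrow> bool" where
  "composition_series R M n F \<longleftrightarrow>
     F 0 = {\<zero>\<^bsub>M\<^esub>} \<and> F n = carrier M \<and>
     (\<forall>k\<le>n. submodule (F k) R M) \<and>
     (\<forall>k<n. F k \<subset> F (Suc k) \<and>
        simple_module R (quot_module (M\<lparr>carrier := F (Suc k)\<rparr>) (F k)))"

definition star_composition_series ::
    "('a, 'r) ring_scheme \<Rightarrow> (int \<Rightarrow> 'a set) \<Rightarrow> ('a, 'b, 'm) module_scheme \<Rightarrow> (int \<Rightarrow> 'b set)
      \<Rightarrow> nat \<Rightarrow> (nat \<Rightarrow> 'b set) \<Rightarrow> bool" where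
  "star_composition_series R \<A> M \<M> n F \<longleftrightarrow>
     F 0 = {\<zero>\<^bsub>M\<^esub>} \<and> F n = carrier M \<and>
     (\<forall>k\<le>n. graded_submodule R \<A> M \<M> (F k)) \<and>
     (\<forall>k<n. F k \<subset> F (Suc k) \<and>
        star_simple_module R \<A>
          (quot_module (M\<lparr>carrier := F (Suc k)\<rparr>) (F k))
          (quot_grading (M\<lparr>carrier := F (Suc k)\<rparr>) (\<lambda>i. \<M> i \<inter> F (Suc k)) (F k)))"

text \<open>
  All composition series of a module have the same length, so the descriptions below are proper.
\<close>

definition module_length :: "('a, 'r) ring_scheme \<Rightarrow> ('a, 'b, 'm) module_scheme \<Rightarrow> enat" where
  "module_length R M =
     (if \<exists>n F. composition_series R M n F
      then enat (THE n. \<exists>F. composition_series R M n F) else \<infinity>)"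

definition star_length ::
    "('a, 'r) ring_scheme \<Rightarrow> (int \<Rightarrow> 'a set) \<Rightarrow> ('a, 'b, 'm) module_scheme \<Rightarrow> (int \<Rightarrow> 'b set)
      \<Rightarrow> enat" where
  "star_length R \<A> M \<M> =
     (if \<exists>n F. star_composition_series R \<A> M \<M> n F
      then enat (THE n. \<exists>F. star_composition_series R \<A> M \<M> n F) else \<infinity>)"

end

theory Submission
  imports Defs
begin

text \<open>
  Let \<open>T\<close> be the set of homogeneous elements of \<open>A\<close> outside \<open>P\<close> and \<open>S = A - P\<close>. Graded submodules of
  \<open>M\<^sub>[\<^sub>P\<^sub>]\<close> correspond to \<open>T\<close>-saturated graded submodules of \<open>M\<close>. If \<open>N \<subset> N'\<close> are two such and \<open>N'/N\<close>
  has *simple localization, then for a homogeneous \<open>x \<in> N' - N\<close> the homogeneous elements of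
  \<open>(N : x)\<close> are those of \<open>P\<close>. So \<open>(N : x)\<close> is a prime that contains \<open>Ann M\<close> and lies in \<open>P\<close>, whence
  \<open>(N : x) = P\<close>. Inverting the larger set \<open>S\<close> therefore turns \<open>N'/N\<close> into the residue field of
  \<open>A\<^sub>P\<close>, and every *composition series of \<open>M\<^sub>[\<^sub>P\<^sub>]\<close> extends to a composition series of \<open>M\<^sub>P\<close> of the same
  length. The Jordan--Hoelder theorem for \<open>M\<^sub>P\<close> thus gives both lengths at once. A *composition
  series exists because, as long as \<open>N \<noteq> M\<close>, a homogeneous \<open>x \<notin> N\<close> with \<open>(N : x)\<close> maximal again has
  \<open>(N : x) = P\<close> and yields the next step; \<open>M\<close> being Noetherian, the process stops.
\<close>

section \<open>Decompositions into homogeneous components\<close>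

text \<open>A *simple module may be far from simple once the grading is forgotten:
  \<open>k[t, 1/t]\<close> has infinite length over itself. So a *composition series cannot just be
  reread as an ordinary one, and the two localizations are never compared directly. Each step is
  recorded by facts about submodules of \<open>M\<close> alone: \<open>(N : x) = P\<close>, and
  \<open>x\<close> generates \<open>N'/N\<close> up to denominators in \<open>T\<close>. Either
  localization recovers its own kind of simplicity from these facts, because both sets of
  denominators avoid \<open>P\<close> and contain \<open>T\<close>. The equality with
  \<open>P\<close> matters: if \<open>(N : x)\<close> were a strictly smaller prime,
  \<open>A/(N : x)\<close> localized at \<open>P\<close> would not be a field.

  Gradings are given only through existence and uniqueness of decompositions. They are handled
  through the projections \<open>hcomp\<close>: a submodule is graded when it is closed under them,
  and identities between additive maps are checked on homogeneous elements. Conversely, the gradings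
  of quotients and localizations are constructed from such projections.\<close>

definition hcomp :: "('b, 'm) ring_scheme \<Rightarrow> (int \<Rightarrow> 'b set) \<Rightarrow> int \<Rightarrow> 'b \<Rightarrow> 'b" where
  "hcomp G D i x =
     (THE c. (\<forall>i. c i \<in> D i) \<and> finite {i. c i \<noteq> \<zero>\<^bsub>G\<^esub>} \<and>
        x = (\<Oplus>\<^bsub>G\<^esub>i\<in>{i. c i \<noteq> \<zero>\<^bsub>G\<^esub>}. c i)) i"

text \<open>Rings, modules, submodules, quotients and localizations all carry such decompositions,
  and only the additive structure enters them. The theory of components is therefore developed once,
  for abelian groups.\<close>

locale graded_group = abelian_group G
  for G :: "('b, 'm) ring_scheme" (structure) and D :: "int \<Rightarrow> 'b set" +
  assumes decomposition: "direct_sum_decomposition G D"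
begin

lemma homogeneous_subgroup: "subgroup (D i) (add_monoid G)"
  using decomposition by (auto simp: direct_sum_decomposition_def)

lemma homogeneous_carrier: "x \<in> D i \<Longrightarrow> x \<in> carrier G"
  using subgroup.subset[OF homogeneous_subgroup] by force

lemma homogeneous_zero [simp]: "\<zero> \<in> D i"
  using subgroup.one_closed[OF homogeneous_subgroup] by simp

lemma homogeneous_add: "x \<in> D i \<Longrightarrow> y \<in> D i \<Longrightarrow> x \<oplus> y \<in> D i"
  using subgroup.m_closed[OF homogeneous_subgroup] by simp

lemma homogeneous_minus: "x \<in> D i \<Longrightarrow> \<ominus> x \<in> D i"
  using subgroup.m_inv_closed[OF homogeneous_subgroup] by (simp add: a_inv_def)

lemma hcomp_decomposes:
  assumes "x \<in> carrier G"
  shows "(\<forall>i. hcomp G D i x \<in> D i) \<and> finite {i. hcomp G D i x \<noteq> \<zero>} \<and>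
     x = (\<Oplus>i\<in>{i. hcomp G D i x \<noteq> \<zero>}. hcomp G D i x)"
proof -
  let ?Q = "\<lambda>c. (\<forall>i. c i \<in> D i) \<and> finite {i. c i \<noteq> \<zero>} \<and> x = (\<Oplus>i\<in>{i. c i \<noteq> \<zero>}. c i)"
  have "\<exists>!c. ?Q c"
    using decomposition assms by (auto simp: direct_sum_decomposition_def)
  then have "?Q (THE c. ?Q c)" by (rule theI')
  then show ?thesis unfolding hcomp_def .
qed

lemma hcomp_homogeneous [simp]: "x \<in> carrier G \<Longrightarrow> hcomp G D i x \<in> D i"
  using hcomp_decomposes by blast

lemma hcomp_closed [simp]: "x \<in> carrier G \<Longrightarrow> hcomp G D i x \<in> carrier G"
  using hcomp_homogeneous homogeneous_carrier by blast

lemma finite_hcomp: "x \<in> carrier G \<Longrightarrow> finite {i. hcomp G D i x \<noteq> \<zero>}"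
  using hcomp_decomposes by blast

text \<open>Extending \<open>c\<close> by zero outside \<open>I\<close> gives a decomposition of the
  sum, and uniqueness identifies it with the components. Additivity of \<open>hcomp\<close> and its
  values on homogeneous elements follow from this.\<close>

lemma hcomp_finsum:
  assumes I: "finite I" "\<And>i. i \<in> I \<Longrightarrow> c i \<in> D i"
  shows "hcomp G D i (\<Oplus>i\<in>I. c i) = (if i \<in> I then c i else \<zero>)"
proof -
  let ?x = "\<Oplus>i\<in>I. c i"
  let ?Q = "\<lambda>c. (\<forall>i. c i \<in> D i) \<and> finite {i. c i \<noteq> \<zero>} \<and> ?x = (\<Oplus>i\<in>{i. c i \<noteq> \<zero>}. c i)"
  let ?d = "\<lambda>i. if i \<in> I then c i else \<zero>"
  have c: "c \<in> I \<rightarrow> carrier G" using I homogeneous_carrier by blast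
  then have x: "?x \<in> carrier G" by simp
  have eq: "(\<Oplus>i\<in>{i. ?d i \<noteq> \<zero>}. ?d i) = ?x"
    by (rule add.finprod_mono_neutral_cong) (use I c in \<open>auto intro: rev_finite_subset\<close>)
  have Qd: "?Q ?d"
    using I(2) eq[symmetric] finite_subset[of "{i. ?d i \<noteq> \<zero>}" I] I(1) by auto
  have "\<exists>!c. ?Q c"
    using decomposition x by (auto simp: direct_sum_decomposition_def)
  then have "\<exists>\<^sub>\<le>\<^sub>1c. ?Q c" by (simp only: ex1_iff_ex_Uniq)
  then have "(\<lambda>i. hcomp G D i ?x) = ?d"
    using hcomp_decomposes[OF x] Qd by (rule Uniq_D[of ?Q])
  then show ?thesis by (rule fun_cong)
qed

lemma hcomp_same [simp]: "x \<in> D i \<Longrightarrow> hcomp G D i x = x"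
  using hcomp_finsum[of "{i}" "\<lambda>_. x" i] homogeneous_carrier by simp

lemma hcomp_other: "x \<in> D i \<Longrightarrow> i \<noteq> j \<Longrightarrow> hcomp G D j x = \<zero>"
  using hcomp_finsum[of "{i}" "\<lambda>_. x" j] homogeneous_carrier by simp

lemma hcomp_finsum_superset:
  assumes "x \<in> carrier G" "finite I" "{i. hcomp G D i x \<noteq> \<zero>} \<subseteq> I"
  shows "x = (\<Oplus>i\<in>I. hcomp G D i x)"
proof -
  have "(\<Oplus>i\<in>{i. hcomp G D i x \<noteq> \<zero>}. hcomp G D i x) = (\<Oplus>i\<in>I. hcomp G D i x)"
    by (rule add.finprod_mono_neutral_cong) (use assms finite_hcomp in auto)
  then show ?thesis using hcomp_decomposes[OF assms(1)] by simp
qed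

lemma hcomp_add:
  assumes "x \<in> carrier G" "y \<in> carrier G"
  shows "hcomp G D i (x \<oplus> y) = hcomp G D i x \<oplus> hcomp G D i y"
proof -
  \<comment> \<open>Including \<open>i\<close> itself settles the case distinction in
    \<open>hcomp_finsum\<close> even when both components in degree \<open>i\<close> vanish.\<close>
  let ?I = "insert i ({i. hcomp G D i x \<noteq> \<zero>} \<union> {i. hcomp G D i y \<noteq> \<zero>})"
  have fin: "finite ?I" using assms finite_hcomp by simp
  have "x = (\<Oplus>i\<in>?I. hcomp G D i x)" "y = (\<Oplus>i\<in>?I. hcomp G D i y)"
    using assms fin by (intro hcomp_finsum_superset; auto)+
  then have "x \<oplus> y = (\<Oplus>i\<in>?I. hcomp G D i x) \<oplus> (\<Oplus>i\<in>?I. hcomp G D i y)" by simp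
  also have "\<dots> = (\<Oplus>i\<in>?I. hcomp G D i x \<oplus> hcomp G D i y)"
    using assms fin by (intro finsum_addf[symmetric]) auto
  finally show ?thesis
    using hcomp_finsum[OF fin, of "\<lambda>i. hcomp G D i x \<oplus> hcomp G D i y" i] assms
    by (simp add: homogeneous_add)
qed

lemma hcomp_minus:
  assumes "x \<in> carrier G"
  shows "hcomp G D i (\<ominus> x) = \<ominus> hcomp G D i x"
proof -
  have "hcomp G D i (\<ominus> x) \<oplus> hcomp G D i x = \<zero>"
    using hcomp_add[of "\<ominus> x" x i] assms by (simp add: l_neg)
  then show ?thesis using assms by (simp add: minus_equality)
qed

lemma mem_subgroup_of_hcomp:
  assumes H: "subgroup H (add_monoid G)" and x: "x \<in> carrier G" and "\<And>i. hcomp G D i x \<in> H"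
  shows "x \<in> H"
proof -
  have fs: "finsum G f I \<in> H" if "finite I" "\<And>i. f i \<in> H" for I and f :: "int \<Rightarrow> 'b"
    using that(1)
  proof induct
    case empty
    then show ?case using subgroup.one_closed[OF H] by simp
  next
    case (insert i I)
    have "f \<in> UNIV \<rightarrow> carrier G" using that(2) subgroup.subset[OF H] by auto
    with insert that(2) show ?case
      using subgroup.m_closed[OF H] by (simp add: Pi_iff)
  qed
  have "(\<Oplus>i\<in>{i. hcomp G D i x \<noteq> \<zero>}. hcomp G D i x) \<in> H"
    by (intro fs finite_hcomp x assms)
  then show ?thesis by (subst hcomp_finsum_superset[OF x finite_hcomp[OF x] order.refl])
qed

text \<open>Serves as an induction principle: when the elements with some property form a subgroup
  \<open>H\<close>, the property need only be checked on homogeneous elements.\<close>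

lemma homogeneous_span:
  assumes "subgroup H (add_monoid G)" "\<And>i. D i \<subseteq> H" "x \<in> carrier G"
  shows "x \<in> H"
  using mem_subgroup_of_hcomp[OF assms(1,3)] hcomp_homogeneous[OF assms(3)] assms(2) by blast

text \<open>The equalizer of two additive maps is a subgroup, so \<open>homogeneous_span\<close>
  applies to it. Identities between component maps are proved this way.\<close>

lemma additive_maps_eqI:
  assumes B: "abelian_group B"
    and f: "\<And>x. x \<in> carrier G \<Longrightarrow> f x \<in> carrier B"
      "\<And>x y. x \<in> carrier G \<Longrightarrow> y \<in> carrier G \<Longrightarrow> f (x \<oplus> y) = f x \<oplus>\<^bsub>B\<^esub> f y"
    and g: "\<And>x. x \<in> carrier G \<Longrightarrow> g x \<in> carrier B"
      "\<And>x y. x \<in> carrier G \<Longrightarrow> y \<in> carrier G \<Longrightarrow> g (x \<oplus> y) = g x \<oplus>\<^bsub>B\<^esub> g y"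
    and eq: "\<And>i x. x \<in> D i \<Longrightarrow> f x = g x"
    and x: "x \<in> carrier G"
  shows "f x = g x"
proof -
  interpret B: abelian_group B by (rule B)
  interpret f: abelian_group_hom G B f
    by (intro abelian_group_homI abelian_group_axioms B group_hom.intro group_hom_axioms.intro a_group
        B.a_group) (auto simp: hom_def f)
  interpret g: abelian_group_hom G B g
    by (intro abelian_group_homI abelian_group_axioms B group_hom.intro group_hom_axioms.intro a_group
        B.a_group) (auto simp: hom_def g)
  have "subgroup {x \<in> carrier G. f x = g x} (add_monoid G)"
    by (rule add.subgroupI) (auto simp flip: a_inv_def simp: f(2) g(2) intro: zero_closed)
  from homogeneous_span[OF this _ x] show ?thesis
    using eq homogeneous_carrier by blast
qed

end

text \<open>Quotients and localizations come with evident projections rather than evident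
  decompositions. Additive projections \<open>p i\<close> onto the \<open>D i\<close> that vanish on
  the other summands give uniqueness, and existence follows once the \<open>D i\<close> generate the
  group.\<close>

lemma (in abelian_group) graded_groupI:
  assumes D: "\<And>i. subgroup (D i) (add_monoid G)"
    and p: "\<And>i x. x \<in> carrier G \<Longrightarrow> p i x \<in> D i"
    and p_add: "\<And>i x y. x \<in> carrier G \<Longrightarrow> y \<in> carrier G \<Longrightarrow> p i (x \<oplus> y) = p i x \<oplus> p i y"
    and p_same: "\<And>i x. x \<in> D i \<Longrightarrow> p i x = x"
    and p_other: "\<And>i j x. x \<in> D i \<Longrightarrow> i \<noteq> j \<Longrightarrow> p j x = \<zero>"
    and span: "\<And>H. subgroup H (add_monoid G) \<Longrightarrow> \<forall>i. D i \<subseteq> H \<Longrightarrow> carrier G \<subseteq> H"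
  shows "graded_group G D" and "x \<in> carrier G \<Longrightarrow> hcomp G D i x = p i x"
proof -
  have Dc: "x \<in> carrier G" if "x \<in> D i" for x i using subgroup.subset[OF D] that by force
  note pc = Dc[OF p]
  have hom: "abelian_group_hom G G (p i)" for i
    by (intro abelian_group_homI abelian_group_axioms group_hom.intro group_hom_axioms.intro a_group)
       (auto simp: hom_def p_add pc)
  note p0 = abelian_group_hom.hom_zero[OF hom]
  have D0: "\<zero> \<in> D i" for i using subgroup.one_closed[OF D] by simp
  \<comment> \<open>The maps \<open>p i\<close> recover the summands of any finite homogeneous sum.
    This is the uniqueness half.\<close>
  have psum: "p i (finsum G c I) = (if i \<in> I then c i else \<zero>)"
    if "finite I" "\<And>i. c i \<in> D i" for i I c
    using that(1)
  proof (induct I)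
    case (insert j I)
    have c: "c i \<in> carrier G" for i using that(2) Dc by blast
    have "p i (c j) = (if i = j then c j else \<zero>)"
      using p_same[OF that(2)] p_other[OF that(2)] by auto
    then show ?case using insert c by (auto simp: p_add)
  qed (simp add: p0)
  \<comment> \<open>The elements that are the finite sum of their own projections. They form a
    subgroup containing every \<open>D i\<close>, so \<open>span\<close> makes this the whole group,
    which is the existence half.\<close>
  let ?H = "{x \<in> carrier G. finite {i. p i x \<noteq> \<zero>} \<and> x = (\<Oplus>i\<in>{i. p i x \<noteq> \<zero>}. p i x)}"
  have super: "(\<Oplus>i\<in>{i. p i x \<noteq> \<zero>}. p i x) = (\<Oplus>i\<in>I. p i x)"
    if "x \<in> carrier G" "finite I" "{i. p i x \<noteq> \<zero>} \<subseteq> I" for x I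
    by (rule add.finprod_mono_neutral_cong) (use that pc in \<open>auto intro: rev_finite_subset\<close>)
  have "subgroup ?H (add_monoid G)"
  proof (rule add.subgroupI)
    show "?H \<noteq> {}" using p0 by (auto intro!: exI[of _ \<zero>])
  next
    fix x assume x: "x \<in> ?H"
    have neg: "p i (\<ominus> x) = \<ominus> p i x" for i
      using abelian_group_hom.hom_a_inv[OF hom] x by simp
    then have eq: "{i. p i (\<ominus> x) \<noteq> \<zero>} = {i. p i x \<noteq> \<zero>}"
      using x pc by (auto simp: add.inv_eq_1_iff)
    have "(\<Oplus>i\<in>{i. p i x \<noteq> \<zero>}. p i x) \<oplus> (\<Oplus>i\<in>{i. p i x \<noteq> \<zero>}. \<ominus> p i x)
        = (\<Oplus>i\<in>{i. p i x \<noteq> \<zero>}. p i x \<oplus> \<ominus> p i x)"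
      using x pc by (intro finsum_addf[symmetric]) auto
    also have "\<dots> = (\<Oplus>i\<in>{i. p i x \<noteq> \<zero>}. \<zero>)"
      using x pc by (intro finsum_cong') (auto simp: r_neg)
    finally have "x \<oplus> (\<Oplus>i\<in>{i. p i x \<noteq> \<zero>}. \<ominus> p i x) = \<zero>"
      using x by simp
    then have "(\<Oplus>i\<in>{i. p i x \<noteq> \<zero>}. \<ominus> p i x) \<oplus> x = \<zero>"
      using x pc by (subst a_comm) auto
    then have "(\<Oplus>i\<in>{i. p i x \<noteq> \<zero>}. \<ominus> p i x) = \<ominus> x"
      using x pc by (intro minus_equality[symmetric]) auto
    then show "\<ominus> x \<in> ?H" using x eq by (simp add: neg)
  next
    fix x y assume x: "x \<in> ?H" and y: "y \<in> ?H"
    let ?I = "{i. p i x \<noteq> \<zero>} \<union> {i. p i y \<noteq> \<zero>}"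
    have fin: "finite ?I" using x y by simp
    have sub: "{i. p i (x \<oplus> y) \<noteq> \<zero>} \<subseteq> ?I" using x y by (auto simp: p_add)
    have xy: "x = (\<Oplus>i\<in>?I. p i x)" "y = (\<Oplus>i\<in>?I. p i y)"
      using super[of x ?I] super[of y ?I] x y fin by auto
    have "(\<Oplus>i\<in>{i. p i (x \<oplus> y) \<noteq> \<zero>}. p i (x \<oplus> y)) = (\<Oplus>i\<in>?I. p i (x \<oplus> y))"
      using super[OF _ fin sub] x y by simp
    also have "\<dots> = (\<Oplus>i\<in>?I. p i x \<oplus> p i y)"
      using x y pc by (intro finsum_cong') (auto simp: p_add)
    also have "\<dots> = x \<oplus> y"
      using x y pc by (subst finsum_addf) (auto simp flip: xy)
    finally show "x \<oplus> y \<in> ?H" using x y rev_finite_subset[OF fin sub] by simp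
  qed auto
  moreover have "D i \<subseteq> ?H" for i
  proof
    fix x assume x: "x \<in> D i"
    have "{j. p j x \<noteq> \<zero>} \<subseteq> {i}" using p_other[OF x] by (metis (mono_tags, lifting) mem_Collect_eq singletonI subsetI)
    then show "x \<in> ?H"
      using x super[of x "{i}"] Dc[OF x] p_same[OF x] by (auto intro: rev_finite_subset)
  qed
  ultimately have H: "carrier G \<subseteq> ?H" by (intro span) auto
  have uniq: "c = (\<lambda>i. p i x)" if "\<forall>i. c i \<in> D i" "finite {i. c i \<noteq> \<zero>}"
    "x = (\<Oplus>i\<in>{i. c i \<noteq> \<zero>}. c i)" for c x
    using psum[of "{i. c i \<noteq> \<zero>}" c] that by auto
  have "direct_sum_decomposition G D"
    unfolding direct_sum_decomposition_def
  proof (intro conjI ballI allI D)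
    fix x assume x: "x \<in> carrier G"
    show "\<exists>!c. (\<forall>i. c i \<in> D i) \<and> finite {i. c i \<noteq> \<zero>} \<and> x = (\<Oplus>i\<in>{i. c i \<noteq> \<zero>}. c i)"
      by (rule ex1I[of _ "\<lambda>i. p i x"]) (use x H p uniq in auto)
  qed
  then show G: "graded_group G D"
    by (simp add: graded_group_def abelian_group_axioms graded_group_axioms_def)
  show "hcomp G D i x = p i x" if "x \<in> carrier G"
    using uniq[of "\<lambda>i. hcomp G D i x" x] graded_group.hcomp_decomposes[OF G that] by metis
qed

lemma abelian_group_cong:
  assumes "abelian_group G" "carrier H = carrier G" "add H = add G" "zero H = zero G"
  shows "abelian_group H"
proof -
  interpret G: abelian_group G by (rule assms)
  show ?thesis
    by (rule abelian_groupI)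
      (auto simp: assms G.a_ac G.l_neg intro: bexI[of _ "\<ominus>\<^bsub>G\<^esub> x" for x])
qed

text \<open>Carries a grading between records with the same additive structure: from a ring to its
  \<open>self_module\<close>, and from the localized \<open>self_module\<close> to
  \<open>loc_ring\<close>.\<close>

lemma graded_group_cong:
  assumes "graded_group G D" "carrier H = carrier G" "add H = add G" "zero H = zero G"
  shows "graded_group H D" and "hcomp H D = hcomp G D"
proof -
  have fs: "finsum H = finsum G"
    using assms by (intro ext) (simp add: finsum_def finprod_def)
  have "direct_sum_decomposition H D = direct_sum_decomposition G D"
    using assms by (simp add: direct_sum_decomposition_def fs subgroup_def m_inv_def)
  moreover have "abelian_group H"
    using abelian_group_cong[OF _ assms(2-4)] assms(1) by (simp add: graded_group_def)
  ultimately show "graded_group H D"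
    using assms(1) by (simp add: graded_group_def graded_group_axioms_def)
  show "hcomp H D = hcomp G D"
    using assms by (intro ext) (simp add: hcomp_def fs)
qed

section \<open>Submodules, quotients and composition series\<close>

lemma (in module) submodule_iff:
  "submodule H R M \<longleftrightarrow> H \<subseteq> carrier M \<and> \<zero>\<^bsub>M\<^esub> \<in> H \<and> (\<forall>x\<in>H. \<forall>y\<in>H. x \<oplus>\<^bsub>M\<^esub> y \<in> H) \<and>
     (\<forall>a\<in>carrier R. \<forall>x\<in>H. a \<odot>\<^bsub>M\<^esub> x \<in> H)"
proof
  assume H: "submodule H R M"
  then show "H \<subseteq> carrier M \<and> \<zero>\<^bsub>M\<^esub> \<in> H \<and> (\<forall>x\<in>H. \<forall>y\<in>H. x \<oplus>\<^bsub>M\<^esub> y \<in> H) \<and>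
     (\<forall>a\<in>carrier R. \<forall>x\<in>H. a \<odot>\<^bsub>M\<^esub> x \<in> H)"
    using submoduleE[OF H] subgroup.one_closed[OF submodule.axioms(1)[OF H]] by auto
next
  assume H: "H \<subseteq> carrier M \<and> \<zero>\<^bsub>M\<^esub> \<in> H \<and> (\<forall>x\<in>H. \<forall>y\<in>H. x \<oplus>\<^bsub>M\<^esub> y \<in> H) \<and>
     (\<forall>a\<in>carrier R. \<forall>x\<in>H. a \<odot>\<^bsub>M\<^esub> x \<in> H)"
  have "\<ominus>\<^bsub>M\<^esub> x \<in> H" if "x \<in> H" for x
  proof -
    have "(\<ominus> \<one>) \<odot>\<^bsub>M\<^esub> x = \<ominus>\<^bsub>M\<^esub> x" using H that by (subst smult_l_minus) auto
    moreover have "(\<ominus> \<one>) \<odot>\<^bsub>M\<^esub> x \<in> H" using H that by auto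
    ultimately show ?thesis by simp
  qed
  then show "submodule H R M" using H by (intro submoduleI) auto
qed

context module
begin

context
  fixes H assumes H: "submodule H R M"
begin

lemma submodule_subset: "x \<in> H \<Longrightarrow> x \<in> carrier M"
  using H submodule_iff by auto

lemma submodule_zero: "\<zero>\<^bsub>M\<^esub> \<in> H"
  using H submodule_iff by auto

lemma submodule_add: "x \<in> H \<Longrightarrow> y \<in> H \<Longrightarrow> x \<oplus>\<^bsub>M\<^esub> y \<in> H"
  using H submodule_iff by auto

lemma submodule_smult: "a \<in> carrier R \<Longrightarrow> x \<in> H \<Longrightarrow> a \<odot>\<^bsub>M\<^esub> x \<in> H"
  using H submodule_iff by auto

lemma submodule_minus: "x \<in> H \<Longrightarrow> \<ominus>\<^bsub>M\<^esub> x \<in> H"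
  using submoduleE[OF H] by auto

lemma submodule_diff: "x \<in> H \<Longrightarrow> y \<in> H \<Longrightarrow> x \<ominus>\<^bsub>M\<^esub> y \<in> H"
  unfolding a_minus_def using submodule_minus submodule_add by auto

lemma submodule_add_cancel:
  assumes "x \<oplus>\<^bsub>M\<^esub> y \<in> H" "y \<in> H" "x \<in> carrier M"
  shows "x \<in> H"
proof -
  have "(x \<oplus>\<^bsub>M\<^esub> y) \<ominus>\<^bsub>M\<^esub> y = x"
    using assms submodule_subset by (simp add: a_minus_def M.a_assoc M.r_neg)
  then show ?thesis using submodule_diff assms by metis
qed

lemma submodule_carrier_update: "module R (M\<lparr>carrier := H\<rparr>)"
  by (rule submodule.submodule_is_module[OF H]) (rule module_axioms)

lemma submodule_of_submodule_iff:
  "submodule K R (M\<lparr>carrier := H\<rparr>) \<longleftrightarrow> submodule K R M \<and> K \<subseteq> H"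
  unfolding module.submodule_iff[OF submodule_carrier_update] submodule_iff
  using submodule_subset by auto

lemma abelian_subgroup_submodule: "abelian_subgroup H M"
  by (intro abelian_subgroupI3 additive_subgroupI M.abelian_group_axioms submodule.axioms(1)[OF H])

lemma coset_eq_iff:
  assumes "x \<in> carrier M" "y \<in> carrier M"
  shows "H +>\<^bsub>M\<^esub> x = H +>\<^bsub>M\<^esub> y \<longleftrightarrow> x \<ominus>\<^bsub>M\<^esub> y \<in> H"
proof
  interpret abelian_subgroup H M by (rule abelian_subgroup_submodule)
  assume "H +>\<^bsub>M\<^esub> x = H +>\<^bsub>M\<^esub> y"
  then have "x \<in> H +>\<^bsub>M\<^esub> y" using assms a_rcos_self by blast
  then obtain h where "h \<in> H" "x = h \<oplus>\<^bsub>M\<^esub> y" by (auto simp: a_r_coset_def')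
  then show "x \<ominus>\<^bsub>M\<^esub> y \<in> H"
    using assms submodule_subset by (simp add: a_minus_def M.a_assoc M.r_neg)
next
  assume h: "x \<ominus>\<^bsub>M\<^esub> y \<in> H"
  have "x = (x \<ominus>\<^bsub>M\<^esub> y) \<oplus>\<^bsub>M\<^esub> y"
    using assms by (simp add: a_minus_def M.a_assoc M.l_neg)
  then have "x \<in> H +>\<^bsub>M\<^esub> y" using h by (auto simp: a_r_coset_def')
  then show "H +>\<^bsub>M\<^esub> x = H +>\<^bsub>M\<^esub> y"
    using M.a_repr_independence[OF _ assms(2) submodule.axioms(1)[OF H]] by simp
qed

lemma coset_zero: "H +>\<^bsub>M\<^esub> \<zero>\<^bsub>M\<^esub> = H"
  using M.a_coset_add_zero submodule_subset by blast

lemma coset_eq_self_iff: "x \<in> carrier M \<Longrightarrow> H +>\<^bsub>M\<^esub> x = H \<longleftrightarrow> x \<in> H"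
  using coset_eq_iff[of x "\<zero>\<^bsub>M\<^esub>"] coset_zero M.minus_equality[of "\<zero>\<^bsub>M\<^esub>" "\<zero>\<^bsub>M\<^esub>"]
  by (simp add: a_minus_def)

lemma quot_carrier: "carrier (quot_module M H) = (\<lambda>x. H +>\<^bsub>M\<^esub> x) ` carrier M"
  by (auto simp: quot_module_def A_RCOSETS_def' a_r_coset_def)

lemma quot_zero: "\<zero>\<^bsub>quot_module M H\<^esub> = H"
  by (simp add: quot_module_def)

lemma quot_add:
  assumes "x \<in> carrier M" "y \<in> carrier M"
  shows "(H +>\<^bsub>M\<^esub> x) \<oplus>\<^bsub>quot_module M H\<^esub> (H +>\<^bsub>M\<^esub> y) = H +>\<^bsub>M\<^esub> (x \<oplus>\<^bsub>M\<^esub> y)"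
  using abelian_subgroup.a_rcos_sum[OF abelian_subgroup_submodule] assms
  by (simp add: quot_module_def)

text \<open>The scalar action on cosets is a union over representatives. Each representative
  contributes the same coset, and there is at least one, so the union is that coset.\<close>

lemma quot_smult:
  assumes a: "a \<in> carrier R" and x: "x \<in> carrier M"
  shows "a \<odot>\<^bsub>quot_module M H\<^esub> (H +>\<^bsub>M\<^esub> x) = H +>\<^bsub>M\<^esub> (a \<odot>\<^bsub>M\<^esub> x)"
proof -
  have "H +>\<^bsub>M\<^esub> (a \<odot>\<^bsub>M\<^esub> y) = H +>\<^bsub>M\<^esub> (a \<odot>\<^bsub>M\<^esub> x)" if y: "y \<in> H +>\<^bsub>M\<^esub> x" for y
  proof -
    obtain h where h: "h \<in> H" "y = h \<oplus>\<^bsub>M\<^esub> x" using y by (auto simp: a_r_coset_def')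
    have hc: "h \<in> carrier M" "a \<odot>\<^bsub>M\<^esub> h \<in> H" using submodule_subset submodule_smult a h by auto
    have "a \<odot>\<^bsub>M\<^esub> y \<ominus>\<^bsub>M\<^esub> a \<odot>\<^bsub>M\<^esub> x = a \<odot>\<^bsub>M\<^esub> h"
      using a x h hc by (simp add: smult_r_distr a_minus_def M.a_assoc M.r_neg)
    then show ?thesis using coset_eq_iff[of "a \<odot>\<^bsub>M\<^esub> y" "a \<odot>\<^bsub>M\<^esub> x"] a x h hc by simp
  qed
  moreover have "H +>\<^bsub>M\<^esub> x \<noteq> {}"
    using abelian_subgroup.a_rcos_self[OF abelian_subgroup_submodule] x by blast
  ultimately have "(\<Union>y\<in>H +>\<^bsub>M\<^esub> x. H +>\<^bsub>M\<^esub> (a \<odot>\<^bsub>M\<^esub> y)) = H +>\<^bsub>M\<^esub> (a \<odot>\<^bsub>M\<^esub> x)"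
    by (intro SUP_eq_const)
  then show ?thesis by (simp add: quot_module_def)
qed

lemma quot_abelian_group: "abelian_group (quot_module M H)"
proof (rule abelian_groupI)
  fix X assume "X \<in> carrier (quot_module M H)"
  then obtain x where x: "x \<in> carrier M" "X = H +>\<^bsub>M\<^esub> x" by (auto simp: quot_carrier)
  then show "\<zero>\<^bsub>quot_module M H\<^esub> \<oplus>\<^bsub>quot_module M H\<^esub> X = X"
    using quot_add[of "\<zero>\<^bsub>M\<^esub>" x] by (simp add: quot_zero coset_zero)
  show "\<exists>Y\<in>carrier (quot_module M H). Y \<oplus>\<^bsub>quot_module M H\<^esub> X = \<zero>\<^bsub>quot_module M H\<^esub>"
    using x by (intro bexI[of _ "H +>\<^bsub>M\<^esub> (\<ominus>\<^bsub>M\<^esub> x)"])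
      (auto simp: quot_add quot_carrier quot_zero coset_zero M.l_neg)
next
  show "\<zero>\<^bsub>quot_module M H\<^esub> \<in> carrier (quot_module M H)"
    unfolding quot_zero quot_carrier using coset_zero M.zero_closed by blast
qed (auto simp: quot_carrier quot_add M.a_ac)

lemma quot_module_module: "module R (quot_module M H)"
  by (rule moduleI[OF R.is_cring quot_abelian_group])
     (auto simp: quot_carrier quot_smult quot_add smult_l_distr smult_r_distr smult_assoc1)

lemma quot_submodule_preimage:
  assumes "submodule K R (quot_module M H)"
  shows "submodule {x \<in> carrier M. H +>\<^bsub>M\<^esub> x \<in> K} R M" and "H \<subseteq> {x \<in> carrier M. H +>\<^bsub>M\<^esub> x \<in> K}"
    and "K = (\<lambda>x. H +>\<^bsub>M\<^esub> x) ` {x \<in> carrier M. H +>\<^bsub>M\<^esub> x \<in> K}"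
proof -
  note K = assms[unfolded module.submodule_iff[OF quot_module_module]]
  show "H \<subseteq> {x \<in> carrier M. H +>\<^bsub>M\<^esub> x \<in> K}"
    using K submodule_subset iffD2[OF coset_eq_self_iff] by (auto simp: quot_zero)
  show "submodule {x \<in> carrier M. H +>\<^bsub>M\<^esub> x \<in> K} R M"
    unfolding submodule_iff using K coset_zero by (auto simp: quot_zero simp flip: quot_add quot_smult)
  show "K = (\<lambda>x. H +>\<^bsub>M\<^esub> x) ` {x \<in> carrier M. H +>\<^bsub>M\<^esub> x \<in> K}"
    using K by (auto simp: quot_carrier)
qed

lemma quot_submodule_image:
  assumes K: "submodule K R M" "H \<subseteq> K"
  shows "submodule ((\<lambda>x. H +>\<^bsub>M\<^esub> x) ` K) R (quot_module M H)"
    and "x \<in> carrier M \<Longrightarrow> H +>\<^bsub>M\<^esub> x \<in> (\<lambda>x. H +>\<^bsub>M\<^esub> x) ` K \<longleftrightarrow> x \<in> K"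
proof -
  have Kc: "x \<in> carrier M" if "x \<in> K" for x using K submodule_iff that by auto
  show "submodule ((\<lambda>x. H +>\<^bsub>M\<^esub> x) ` K) R (quot_module M H)"
    unfolding module.submodule_iff[OF quot_module_module]
    using K(1)[unfolded submodule_iff] coset_zero
    by (auto simp: quot_zero quot_carrier quot_add quot_smult Kc image_iff)
  show "H +>\<^bsub>M\<^esub> x \<in> (\<lambda>x. H +>\<^bsub>M\<^esub> x) ` K \<longleftrightarrow> x \<in> K" if x: "x \<in> carrier M"
  proof
    assume "H +>\<^bsub>M\<^esub> x \<in> (\<lambda>x. H +>\<^bsub>M\<^esub> x) ` K"
    then obtain y where y: "y \<in> K" "H +>\<^bsub>M\<^esub> x = H +>\<^bsub>M\<^esub> y" by auto
    then have "x \<ominus>\<^bsub>M\<^esub> y \<in> K" using coset_eq_iff x Kc K(2) by auto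
    then have "(x \<ominus>\<^bsub>M\<^esub> y) \<oplus>\<^bsub>M\<^esub> y \<in> K" using K(1) y submodule_iff by auto
    then show "x \<in> K" using x y Kc by (simp add: a_minus_def M.a_assoc M.l_neg)
  qed auto
qed

text \<open>The correspondence between submodules of the quotient and submodules above
  \<open>H\<close>. It turns simplicity of a factor into a covering relation in the lattice of
  submodules, where the later arguments take place.\<close>

lemma simple_quot_iff:
  "simple_module R (quot_module M H) \<longleftrightarrow>
     H \<noteq> carrier M \<and> (\<forall>K. submodule K R M \<and> H \<subseteq> K \<longrightarrow> K = H \<or> K = carrier M)"
    (is "_ \<longleftrightarrow> ?A \<and> ?B")
proof -
  have 1: "carrier (quot_module M H) \<noteq> {\<zero>\<^bsub>quot_module M H\<^esub>} \<longleftrightarrow> ?A"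
  proof -
    have "carrier (quot_module M H) = {H} \<longleftrightarrow> (\<forall>x\<in>carrier M. H +>\<^bsub>M\<^esub> x = H)"
      using M.zero_closed by (auto simp: quot_carrier)
    also have "\<dots> \<longleftrightarrow> H = carrier M" using coset_eq_self_iff submodule_subset by auto
    finally show ?thesis by (simp add: quot_zero)
  qed
  have image_H: "(\<lambda>x. H +>\<^bsub>M\<^esub> x) ` H = {H}"
    using coset_eq_self_iff submodule_subset submodule_zero by auto
  have 2: "(\<forall>K. submodule K R (quot_module M H) \<longrightarrow>
      K = {\<zero>\<^bsub>quot_module M H\<^esub>} \<or> K = carrier (quot_module M H)) \<longleftrightarrow> ?B"
  proof (intro iffI allI impI)
    fix K assume *: "\<forall>K. submodule K R (quot_module M H) \<longrightarrow>
      K = {\<zero>\<^bsub>quot_module M H\<^esub>} \<or> K = carrier (quot_module M H)"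
      and K: "submodule K R M \<and> H \<subseteq> K"
    note im = quot_submodule_image[OF conjunct1[OF K] conjunct2[OF K]]
    from * im(1) have "(\<lambda>x. H +>\<^bsub>M\<^esub> x) ` K = {H} \<or> (\<lambda>x. H +>\<^bsub>M\<^esub> x) ` K = carrier (quot_module M H)"
      by (auto simp: quot_zero)
    then show "K = H \<or> K = carrier M"
    proof
      assume "(\<lambda>x. H +>\<^bsub>M\<^esub> x) ` K = {H}"
      then have "x \<in> H" if "x \<in> K" for x
        using that coset_eq_self_iff[of x] K[unfolded submodule_iff] by auto
      then show ?thesis using K by blast
    next
      assume eq: "(\<lambda>x. H +>\<^bsub>M\<^esub> x) ` K = carrier (quot_module M H)"
      have "x \<in> K" if "x \<in> carrier M" for x
        using im(2)[OF that, unfolded eq quot_carrier] that by blast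
      then show ?thesis using K[unfolded submodule_iff] by blast
    qed
  next
    fix K assume B: ?B and K: "submodule K R (quot_module M H)"
    note pre = quot_submodule_preimage[OF K]
    from B pre(1,2) have "{x \<in> carrier M. H +>\<^bsub>M\<^esub> x \<in> K} = H \<or>
        {x \<in> carrier M. H +>\<^bsub>M\<^esub> x \<in> K} = carrier M" by blast
    then show "K = {\<zero>\<^bsub>quot_module M H\<^esub>} \<or> K = carrier (quot_module M H)"
    proof
      assume "{x \<in> carrier M. H +>\<^bsub>M\<^esub> x \<in> K} = H"
      then show ?thesis using pre(3) image_H quot_zero by simp
    next
      assume "{x \<in> carrier M. H +>\<^bsub>M\<^esub> x \<in> K} = carrier M"
      then show ?thesis using pre(3) quot_carrier by simp
    qed
  qed
  show ?thesis unfolding simple_module_def using quot_module_module 1 2 by blast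
qed

end

section \<open>Composition series and their length\<close>

lemma submodule_sum:
  assumes "submodule H R M" "submodule K R M"
  shows "submodule {h \<oplus>\<^bsub>M\<^esub> k | h k. h \<in> H \<and> k \<in> K} R M" (is "submodule ?S R M")
    and "H \<subseteq> {h \<oplus>\<^bsub>M\<^esub> k | h k. h \<in> H \<and> k \<in> K}"
    and "K \<subseteq> {h \<oplus>\<^bsub>M\<^esub> k | h k. h \<in> H \<and> k \<in> K}"
proof -
  note HK = assms[unfolded submodule_iff]
  have c: "h \<in> carrier M" "k \<in> carrier M" if "h \<in> H" "k \<in> K" for h k using HK that by auto
  show "submodule ?S R M"
    unfolding submodule_iff
  proof (intro conjI ballI)
    show "?S \<subseteq> carrier M" using c by auto
    show "\<zero>\<^bsub>M\<^esub> \<in> ?S" by (intro CollectI exI[of _ "\<zero>\<^bsub>M\<^esub>"]) (use HK in simp)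
  next
    fix x y assume "x \<in> ?S" "y \<in> ?S"
    then obtain h k h' k' where *: "x = h \<oplus>\<^bsub>M\<^esub> k" "y = h' \<oplus>\<^bsub>M\<^esub> k'" "h \<in> H" "h' \<in> H"
      "k \<in> K" "k' \<in> K" by auto
    then have "x \<oplus>\<^bsub>M\<^esub> y = (h \<oplus>\<^bsub>M\<^esub> h') \<oplus>\<^bsub>M\<^esub> (k \<oplus>\<^bsub>M\<^esub> k')" using c by (simp add: M.a_ac)
    moreover have "h \<oplus>\<^bsub>M\<^esub> h' \<in> H" "k \<oplus>\<^bsub>M\<^esub> k' \<in> K" using * HK by auto
    ultimately show "x \<oplus>\<^bsub>M\<^esub> y \<in> ?S" by blast
  next
    fix a x assume a: "a \<in> carrier R" and "x \<in> ?S"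
    then obtain h k where *: "x = h \<oplus>\<^bsub>M\<^esub> k" "h \<in> H" "k \<in> K" by auto
    then have "a \<odot>\<^bsub>M\<^esub> x = a \<odot>\<^bsub>M\<^esub> h \<oplus>\<^bsub>M\<^esub> a \<odot>\<^bsub>M\<^esub> k" using c a by (simp add: smult_r_distr)
    moreover have "a \<odot>\<^bsub>M\<^esub> h \<in> H" "a \<odot>\<^bsub>M\<^esub> k \<in> K" using * HK a by auto
    ultimately show "a \<odot>\<^bsub>M\<^esub> x \<in> ?S" by blast
  qed
  show "H \<subseteq> ?S"
  proof
    fix h assume "h \<in> H"
    then show "h \<in> ?S" by (intro CollectI exI[of _ h] exI[of _ "\<zero>\<^bsub>M\<^esub>"]) (use HK c in auto)
  qed
  show "K \<subseteq> ?S"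
  proof
    fix h assume "h \<in> K"
    then show "h \<in> ?S" by (intro CollectI exI[of _ h] exI[of _ "\<zero>\<^bsub>M\<^esub>"]) (use HK c in auto)
  qed
qed

text \<open>The correspondence theorem, applied inside the module \<open>F (Suc k)\<close>,
  eliminates the quotients from the definition.\<close>

lemma composition_series_iff:
  "composition_series R M n F \<longleftrightarrow>
     F 0 = {\<zero>\<^bsub>M\<^esub>} \<and> F n = carrier M \<and> (\<forall>k\<le>n. submodule (F k) R M) \<and>
     (\<forall>k<n. F k \<subset> F (Suc k) \<and>
        (\<forall>H. submodule H R M \<and> F k \<subseteq> H \<and> H \<subseteq> F (Suc k) \<longrightarrow> H = F k \<or> H = F (Suc k)))"
proof -
  have "simple_module R (quot_module (M\<lparr>carrier := F (Suc k)\<rparr>) (F k)) \<longleftrightarrow>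
     (\<forall>H. submodule H R M \<and> F k \<subseteq> H \<and> H \<subseteq> F (Suc k) \<longrightarrow> H = F k \<or> H = F (Suc k))"
    if "\<forall>k\<le>n. submodule (F k) R M" "k < n" "F k \<subset> F (Suc k)" for k
  proof -
    have sub: "submodule (F k) R M" "submodule (F (Suc k)) R M" using that by auto
    interpret S: module R "M\<lparr>carrier := F (Suc k)\<rparr>" by (rule submodule_carrier_update[OF sub(2)])
    have "submodule (F k) R (M\<lparr>carrier := F (Suc k)\<rparr>)"
      using submodule_of_submodule_iff[OF sub(2)] sub(1) that(3) by blast
    from S.simple_quot_iff[OF this] show ?thesis
      using submodule_of_submodule_iff[OF sub(2)] that(3) by auto
  qed
  then have "(\<forall>k<n. F k \<subset> F (Suc k) \<and> simple_module R (quot_module (M\<lparr>carrier := F (Suc k)\<rparr>) (F k)))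
     \<longleftrightarrow> (\<forall>k<n. F k \<subset> F (Suc k) \<and>
        (\<forall>H. submodule H R M \<and> F k \<subseteq> H \<and> H \<subseteq> F (Suc k) \<longrightarrow> H = F k \<or> H = F (Suc k)))"
    if "\<forall>k\<le>n. submodule (F k) R M"
    using that by metis
  then show ?thesis unfolding composition_series_def by metis
qed

text \<open>
  To each \<open>i\<close> one assigns the least \<open>j\<close> such that \<open>G i\<close> and \<open>G (i + 1)\<close> differ inside \<open>F (j + 1)\<close>.
  The modular law and the simplicity of \<open>F (j + 1) / F j\<close> make this assignment injective.
\<close>

lemma chain_length_le_composition_length:
  assumes F: "composition_series R M n F"
    and G: "\<And>i. i \<le> m \<Longrightarrow> submodule (G i) R M" "\<And>i. i < m \<Longrightarrow> G i \<subset> G (Suc i)"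
  shows "m \<le> n"
proof -
  note F = F[unfolded composition_series_iff]
  have Fs: "submodule (F k) R M" if "k \<le> n" for k using F that by blast
  have step: "\<exists>j<n. G i \<inter> F j = G (Suc i) \<inter> F j \<and> G i \<inter> F (Suc j) \<noteq> G (Suc i) \<inter> F (Suc j)"
    if i: "i < m" for i
  proof -
    let ?P = "\<lambda>j. G i \<inter> F j \<noteq> G (Suc i) \<inter> F j"
    have "G i \<inter> F n \<noteq> G (Suc i) \<inter> F n"
      using F G i submodule_subset[OF G(1)] by (metis Int_absorb2 Suc_leI less_imp_le_nat psubset_eq subsetI)
    moreover have "\<not> ?P 0"
      using F G(1)[of i] G(1)[of "Suc i"] i submodule_zero by auto
    ultimately obtain j where j: "j < n" "\<forall>i\<le>j. \<not> ?P i" "?P (Suc j)"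
      using ex_least_nat_less[of ?P n] by blast
    then show ?thesis by blast
  qed
  then obtain f where f: "\<And>i. i < m \<Longrightarrow> f i < n"
      "\<And>i. i < m \<Longrightarrow> G i \<inter> F (f i) = G (Suc i) \<inter> F (f i)"
      "\<And>i. i < m \<Longrightarrow> G i \<inter> F (Suc (f i)) \<noteq> G (Suc i) \<inter> F (Suc (f i))"
    by metis
  have mono: "G i \<subseteq> G j" if "i \<le> j" "j \<le> m" for i j
    using that by (induct j rule: dec_induct) (use G(2) in \<open>auto simp: Suc_le_eq\<close>)
  have inj: "f i \<noteq> f i'" if ii: "i < i'" "i' < m" for i i'
  proof
    assume eq: "f i = f i'"
    let ?j = "f i'"
    have j: "?j < n" using f ii by blast
    have "\<not> G (Suc i) \<inter> F (Suc ?j) \<subseteq> F ?j"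
    proof
      assume "G (Suc i) \<inter> F (Suc ?j) \<subseteq> F ?j"
      then have "G (Suc i) \<inter> F (Suc ?j) \<subseteq> G i \<inter> F (Suc ?j)"
        using f(2)[of i] ii eq by auto
      then show False using f(3)[of i] G(2)[of i] ii eq by auto
    qed
    then have nsub: "\<not> G i' \<inter> F (Suc ?j) \<subseteq> F ?j"
      using mono[of "Suc i" i'] ii by auto
    \<comment> \<open>This submodule lies between \<open>F ?j\<close> and \<open>F (Suc ?j)\<close>.
      By \<open>nsub\<close> it is not \<open>F ?j\<close>, so simplicity of the factor makes it
      \<open>F (Suc ?j)\<close>.\<close>
    let ?H = "{h \<oplus>\<^bsub>M\<^esub> g | h g. h \<in> F ?j \<and> g \<in> G i' \<inter> F (Suc ?j)}"
    have s: "submodule (F ?j) R M" "submodule (F (Suc ?j)) R M" "submodule (G i') R M"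
      "submodule (G (Suc i')) R M" using Fs G(1) j ii by auto

    have cov: "F ?j \<subset> F (Suc ?j)"
      "submodule H R M \<Longrightarrow> F ?j \<subseteq> H \<Longrightarrow> H \<subseteq> F (Suc ?j) \<Longrightarrow> H = F ?j \<or> H = F (Suc ?j)" for H
      using F j by blast+
    have Hsub: "submodule ?H R M"
      by (rule submodule_sum(1)) (use s in \<open>auto simp: submodule_iff\<close>)
    have "F ?j \<subseteq> ?H" "G i' \<inter> F (Suc ?j) \<subseteq> ?H"
      by (rule submodule_sum(2,3); use s in \<open>auto simp: submodule_iff\<close>)+
    moreover have "?H \<subseteq> F (Suc ?j)" using submodule_add[OF s(2)] cov(1) by auto
    ultimately have H: "?H = F (Suc ?j)" using cov(2)[OF Hsub] nsub by blast
    have "G (Suc i') \<inter> F (Suc ?j) \<subseteq> G i'"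
    proof
      fix y assume y: "y \<in> G (Suc i') \<inter> F (Suc ?j)"
      then have "y \<in> ?H" using H by blast
      then obtain h g where hg: "y = h \<oplus>\<^bsub>M\<^esub> g" "h \<in> F ?j" "g \<in> G i' \<inter> F (Suc ?j)" by blast
      have "g \<in> G (Suc i')" using hg mono[of i' "Suc i'"] ii by auto
      then have "h \<in> G (Suc i')"
        using submodule_add_cancel[OF s(4)] y hg submodule_subset[OF s(1)] by blast
      then have "h \<in> G i'" using f(2)[of i'] ii hg by blast
      then show "y \<in> G i'" using hg submodule_add[OF s(3)] by blast
    qed
    then have "G i' \<inter> F (Suc ?j) = G (Suc i') \<inter> F (Suc ?j)" using mono[of i' "Suc i'"] ii by auto
    then show False using f(3) ii by blast
  qed
  then have "inj_on f {..<m}" by (intro inj_onI) (metis lessThan_iff linorder_neqE_nat)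
  moreover have "f ` {..<m} \<subseteq> {..<n}" using f(1) by auto
  ultimately show ?thesis using card_inj_on_le[of f "{..<m}" "{..<n}"] by simp
qed

text \<open>Each series is in particular a strict chain of submodules, so each length bounds the
  other.\<close>

lemma composition_length_unique:
  assumes "composition_series R M n F" "composition_series R M m G"
  shows "m = n"
  using assms chain_length_le_composition_length[OF assms(1), of m G]
    chain_length_le_composition_length[OF assms(2), of n F]
  unfolding composition_series_def by simp

lemma module_length_eq: "composition_series R M n F \<Longrightarrow> module_length R M = enat n"
  unfolding module_length_def using composition_length_unique by (auto intro!: the_equality)

end

section \<open>Graded submodules and graded quotients\<close>

sublocale graded_ring \<subseteq> GR: graded_group R \<A>
  by unfold_locales (rule ring_decomposition)

sublocale graded_module \<subseteq> GM: graded_group M \<M>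
  by unfold_locales (rule module_decomposition)

lemma graded_moduleI:
  assumes "graded_ring R \<A>" "module R M" "graded_group M \<M>"
    and "\<And>a x i j. a \<in> \<A> i \<Longrightarrow> x \<in> \<M> j \<Longrightarrow> a \<odot>\<^bsub>M\<^esub> x \<in> \<M> (i + j)"
  shows "graded_module R \<A> M \<M>"
  using assms graded_group.decomposition[OF assms(3)]
  by (simp add: graded_module_def graded_module_axioms_def)

context graded_module
begin

lemma is_graded_ring: "graded_ring R \<A>"
  by unfold_locales

text \<open>Both sides are additive in \<open>x\<close>, so homogeneous \<open>x\<close> of degree
  \<open>j\<close> suffice. For \<open>i = j\<close> both sides are \<open>a x\<close>, and
  otherwise both vanish.\<close>

lemma hcomp_smult:
  assumes "a \<in> \<A> k" "x \<in> carrier M"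
  shows "hcomp M \<M> (k + i) (a \<odot>\<^bsub>M\<^esub> x) = a \<odot>\<^bsub>M\<^esub> hcomp M \<M> i x"
proof (rule GM.additive_maps_eqI[where B = M and f = "\<lambda>x. hcomp M \<M> (k + i) (a \<odot>\<^bsub>M\<^esub> x)" and
      g = "\<lambda>x. a \<odot>\<^bsub>M\<^esub> hcomp M \<M> i x", OF M.abelian_group_axioms _ _ _ _ _ assms(2)])
  have a: "a \<in> carrier R" using assms GR.homogeneous_carrier by blast
  fix j x assume x: "x \<in> \<M> j"
  show "hcomp M \<M> (k + i) (a \<odot>\<^bsub>M\<^esub> x) = a \<odot>\<^bsub>M\<^esub> hcomp M \<M> i x"
    using graded_smult[OF assms(1) x] x a GM.hcomp_other[of _ "k + j" "k + i"] GM.hcomp_other[of _ j i]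
    by (cases "i = j") auto
qed (use assms GR.homogeneous_carrier in \<open>auto simp: smult_r_distr GM.hcomp_add\<close>)

text \<open>The counterpart with the vector homogeneous and the scalar arbitrary. It makes
  \<open>(N : x)\<close> a graded ideal for graded \<open>N\<close> and homogeneous
  \<open>x\<close>, and it allows a coefficient of \<open>x\<close> to be replaced by one of its
  components.\<close>

lemma hcomp_smult_homogeneous:
  assumes "a \<in> carrier R" "x \<in> \<M> k"
  shows "hcomp M \<M> (i + k) (a \<odot>\<^bsub>M\<^esub> x) = hcomp R \<A> i a \<odot>\<^bsub>M\<^esub> x"
proof (rule GR.additive_maps_eqI[where B = M and f = "\<lambda>a. hcomp M \<M> (i + k) (a \<odot>\<^bsub>M\<^esub> x)" and
      g = "\<lambda>a. hcomp R \<A> i a \<odot>\<^bsub>M\<^esub> x", OF M.abelian_group_axioms _ _ _ _ _ assms(1)])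
  have x: "x \<in> carrier M" using assms GM.homogeneous_carrier by blast
  fix j a assume a: "a \<in> \<A> j"
  show "hcomp M \<M> (i + k) (a \<odot>\<^bsub>M\<^esub> x) = hcomp R \<A> i a \<odot>\<^bsub>M\<^esub> x"
    using graded_smult[OF a assms(2)] x a GM.hcomp_other[of _ "j + k" "i + k"] GR.hcomp_other[of _ j i]
    by (cases "i = j") auto
qed (use assms GM.homogeneous_carrier in \<open>auto simp: smult_l_distr GM.hcomp_add GR.hcomp_add\<close>)

lemma graded_submodule_if_hcomp:
  assumes N: "submodule N R M" and h: "\<And>x i. x \<in> N \<Longrightarrow> hcomp M \<M> i x \<in> N"
  shows "graded_submodule R \<A> M \<M> N"
    and "x \<in> N \<Longrightarrow> hcomp (M\<lparr>carrier := N\<rparr>) (\<lambda>i. \<M> i \<inter> N) i x = hcomp M \<M> i x"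
proof -
  interpret N: module R "M\<lparr>carrier := N\<rparr>" by (rule submodule_carrier_update[OF N])
  \<comment> \<open>Inverses in the record with carrier \<open>N\<close> are described relative to
    \<open>N\<close>, so they must first be identified with those of \<open>M\<close>.\<close>
  have neg: "\<ominus>\<^bsub>M\<lparr>carrier := N\<rparr>\<^esub> x = \<ominus>\<^bsub>M\<^esub> x" if "x \<in> N" for x
    using that submodule_minus[OF N that] submodule_subset[OF N that]
    by (intro N.M.minus_equality) (auto simp: M.l_neg)
  have nonempty: "\<M> i \<inter> N \<noteq> {}" for i
    using GM.homogeneous_zero submodule_zero[OF N] by blast
  have "subgroup (\<M> i \<inter> N) (add_monoid (M\<lparr>carrier := N\<rparr>))" for i
    by (rule N.M.add.subgroupI)
       (use submodule_zero[OF N] submodule_add[OF N] submodule_minus[OF N] nonempty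
        in \<open>auto simp: neg GM.homogeneous_minus GM.homogeneous_add simp flip: a_inv_def\<close>)
  moreover have "N \<subseteq> H" if H: "subgroup H (add_monoid (M\<lparr>carrier := N\<rparr>))" "\<forall>i. \<M> i \<inter> N \<subseteq> H" for H
  proof
    fix x assume x: "x \<in> N"
    have HN: "H \<subseteq> N" using subgroup.subset[OF H(1)] by simp
    have "subgroup H (add_monoid M)"
    proof (rule M.add.subgroupI)
      fix y assume y: "y \<in> H"
      have "\<ominus>\<^bsub>M\<lparr>carrier := N\<rparr>\<^esub> y \<in> H"
        using subgroup.m_inv_closed[OF H(1) y] unfolding a_inv_def .
      then show "\<ominus>\<^bsub>M\<^esub> y \<in> H" using neg[of y] y HN by auto
    qed (use HN submodule_subset[OF N] subgroup.one_closed[OF H(1)] subgroup.m_closed[OF H(1)]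
      in auto)
    moreover have "hcomp M \<M> i x \<in> H" for i
      using H(2) x h GM.hcomp_homogeneous submodule_subset[OF N x] by blast
    ultimately show "x \<in> H" using GM.mem_subgroup_of_hcomp submodule_subset[OF N x] by blast
  qed
  ultimately have gr: "graded_group (M\<lparr>carrier := N\<rparr>) (\<lambda>i. \<M> i \<inter> N)"
    and hc: "x \<in> N \<Longrightarrow> hcomp (M\<lparr>carrier := N\<rparr>) (\<lambda>i. \<M> i \<inter> N) i x = hcomp M \<M> i x" for i x
    using submodule_subset[OF N] h
    by (intro N.M.graded_groupI[where p = "hcomp M \<M>"]; auto simp: GM.hcomp_add GM.hcomp_other)+
  show "x \<in> N \<Longrightarrow> hcomp (M\<lparr>carrier := N\<rparr>) (\<lambda>i. \<M> i \<inter> N) i x = hcomp M \<M> i x" by (rule hc)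
  show "graded_submodule R \<A> M \<M> N"
    unfolding graded_submodule_def
    by (intro conjI N graded_moduleI is_graded_ring N.module_axioms gr)
       (use graded_smult submodule_smult[OF N] GR.homogeneous_carrier in auto)
qed

text \<open>For the forward direction, components taken in \<open>N\<close> and in \<open>M\<close>
  are both additive maps from \<open>N\<close> to \<open>M\<close> that agree on the homogeneous
  elements of \<open>N\<close>; hence they coincide. Later arguments test gradedness by this
  criterion.\<close>

lemma graded_submodule_iff:
  "graded_submodule R \<A> M \<M> N \<longleftrightarrow> submodule N R M \<and> (\<forall>x\<in>N. \<forall>i. hcomp M \<M> i x \<in> N)"
proof
  assume g: "graded_submodule R \<A> M \<M> N"
  then have N: "submodule N R M" by (simp add: graded_submodule_def)
  interpret N: graded_module R \<A> "M\<lparr>carrier := N\<rparr>" "\<lambda>i. \<M> i \<inter> N"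
    using g by (simp add: graded_submodule_def)
  have "hcomp M \<M> i x \<in> N" if x: "x \<in> N" for x i
  proof -
    have "hcomp M \<M> i x = hcomp (M\<lparr>carrier := N\<rparr>) (\<lambda>i. \<M> i \<inter> N) i x"
    proof (rule N.GM.additive_maps_eqI[where B = M and f = "hcomp M \<M> i" and
          g = "hcomp (M\<lparr>carrier := N\<rparr>) (\<lambda>i. \<M> i \<inter> N) i"])
      fix j y assume "y \<in> \<M> j \<inter> N"
      then show "hcomp M \<M> i y = hcomp (M\<lparr>carrier := N\<rparr>) (\<lambda>i. \<M> i \<inter> N) i y"
        using GM.hcomp_other[of y j i] N.GM.hcomp_other[of y j i] N.GM.hcomp_same[of y j]
        by (cases "i = j") auto
    qed (use x submodule_subset[OF N] GM.hcomp_add N.GM.hcomp_add N.GM.hcomp_closed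
        M.abelian_group_axioms in auto)
    then show ?thesis using N.GM.hcomp_closed[of x i] x by simp
  qed
  with N show "submodule N R M \<and> (\<forall>x\<in>N. \<forall>i. hcomp M \<M> i x \<in> N)" by blast
qed (use graded_submodule_if_hcomp in auto)

text \<open>Components computed in \<open>N\<close> are those computed in \<open>M\<close>, so
  closure under components means the same in both.\<close>

lemma graded_submodule_of_graded_submodule_iff:
  assumes "graded_submodule R \<A> M \<M> N"
  shows "graded_submodule R \<A> (M\<lparr>carrier := N\<rparr>) (\<lambda>i. \<M> i \<inter> N) K \<longleftrightarrow>
    graded_submodule R \<A> M \<M> K \<and> K \<subseteq> N"
proof -
  have N: "submodule N R M" "\<And>x i. x \<in> N \<Longrightarrow> hcomp M \<M> i x \<in> N"
    using assms graded_submodule_iff by auto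
  interpret N: graded_module R \<A> "M\<lparr>carrier := N\<rparr>" "\<lambda>i. \<M> i \<inter> N"
    using assms by (simp add: graded_submodule_def)
  show ?thesis
    unfolding N.graded_submodule_iff submodule_of_submodule_iff[OF N(1)] graded_submodule_iff
    using graded_submodule_if_hcomp(2)[OF N] by (auto simp: subset_iff)
qed

context
  fixes N assumes gN: "graded_submodule R \<A> M \<M> N"
begin

lemma graded_quot:
  "graded_module R \<A> (quot_module M N) (quot_grading M \<M> N)"
  "x \<in> carrier M \<Longrightarrow>
    hcomp (quot_module M N) (quot_grading M \<M> N) i (N +>\<^bsub>M\<^esub> x) = N +>\<^bsub>M\<^esub> hcomp M \<M> i x"
proof -
  have N: "submodule N R M" and h: "\<And>x i. x \<in> N \<Longrightarrow> hcomp M \<M> i x \<in> N"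
    using gN graded_submodule_iff by auto
  interpret Q: module R "quot_module M N" by (rule quot_module_module[OF N])
  let ?D = "quot_grading M \<M> N"
  \<comment> \<open>The projection of a coset is read off a chosen representative. The choice is
    immaterial because two representatives differ by an element of \<open>N\<close>, all of whose
    components lie in \<open>N\<close>.\<close>
  define p where "p i X = N +>\<^bsub>M\<^esub> hcomp M \<M> i (SOME x. x \<in> carrier M \<and> X = N +>\<^bsub>M\<^esub> x)" for i X
  have p: "p i (N +>\<^bsub>M\<^esub> x) = N +>\<^bsub>M\<^esub> hcomp M \<M> i x" if x: "x \<in> carrier M" for i x
  proof -
    let ?y = "SOME y. y \<in> carrier M \<and> N +>\<^bsub>M\<^esub> x = N +>\<^bsub>M\<^esub> y"
    have y: "?y \<in> carrier M \<and> N +>\<^bsub>M\<^esub> x = N +>\<^bsub>M\<^esub> ?y"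
      by (rule someI[where x = x]) (use x in simp)
    then have "?y \<ominus>\<^bsub>M\<^esub> x \<in> N" using iffD1[OF coset_eq_iff[OF N]] x by blast
    then have "hcomp M \<M> i (?y \<ominus>\<^bsub>M\<^esub> x) \<in> N" by (rule h)
    then have "hcomp M \<M> i ?y \<ominus>\<^bsub>M\<^esub> hcomp M \<M> i x \<in> N"
      using x y by (simp add: a_minus_def GM.hcomp_add GM.hcomp_minus)
    then show ?thesis unfolding p_def using coset_eq_iff[OF N] x y by simp
  qed
  have c: "x \<in> carrier M" if "x \<in> \<M> i" for x i using that GM.homogeneous_carrier by blast
  have neg: "\<ominus>\<^bsub>quot_module M N\<^esub> (N +>\<^bsub>M\<^esub> x) = N +>\<^bsub>M\<^esub> (\<ominus>\<^bsub>M\<^esub> x)" if "x \<in> carrier M" for x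
    using that by (intro Q.M.minus_equality) (auto simp: quot_add[OF N] quot_carrier[OF N] M.l_neg
        coset_zero[OF N] quot_zero[OF N])
  have nonempty: "\<M> i \<noteq> {}" for i using GM.homogeneous_zero by blast
  have sub: "subgroup (?D i) (add_monoid (quot_module M N))" for i
    by (rule Q.M.add.subgroupI)
       (use nonempty in \<open>auto simp: quot_grading_def quot_carrier[OF N] quot_add[OF N] c neg
         GM.homogeneous_minus GM.homogeneous_add simp flip: a_inv_def\<close>)
  have span: "carrier (quot_module M N) \<subseteq> H"
    if H: "subgroup H (add_monoid (quot_module M N))" "\<forall>i. ?D i \<subseteq> H" for H
  proof -
    have "subgroup {x \<in> carrier M. N +>\<^bsub>M\<^esub> x \<in> H} (add_monoid M)"
    proof (rule M.add.subgroupI)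
      show "{x \<in> carrier M. N +>\<^bsub>M\<^esub> x \<in> H} \<noteq> {}"
        using subgroup.one_closed[OF H(1)] coset_zero[OF N] quot_zero[OF N] M.zero_closed by force
      fix x assume x: "x \<in> {x \<in> carrier M. N +>\<^bsub>M\<^esub> x \<in> H}"
      then show "\<ominus>\<^bsub>M\<^esub> x \<in> {x \<in> carrier M. N +>\<^bsub>M\<^esub> x \<in> H}"
        using subgroup.m_inv_closed[OF H(1), of "N +>\<^bsub>M\<^esub> x"] neg[of x] by (auto simp flip: a_inv_def)
      fix y assume "y \<in> {x \<in> carrier M. N +>\<^bsub>M\<^esub> x \<in> H}"
      then show "x \<oplus>\<^bsub>M\<^esub> y \<in> {x \<in> carrier M. N +>\<^bsub>M\<^esub> x \<in> H}"
        using subgroup.m_closed[OF H(1), of "N +>\<^bsub>M\<^esub> x" "N +>\<^bsub>M\<^esub> y"] x by (auto simp: quot_add[OF N])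
    qed auto
    moreover have "\<M> i \<subseteq> {x \<in> carrier M. N +>\<^bsub>M\<^esub> x \<in> H}" for i
      using H(2) c by (auto simp: quot_grading_def)
    ultimately have "x \<in> {x \<in> carrier M. N +>\<^bsub>M\<^esub> x \<in> H}" if "x \<in> carrier M" for x
      using GM.homogeneous_span that by blast
    then show ?thesis by (auto simp: quot_carrier[OF N])
  qed
  have pD: "p i X \<in> ?D i" if "X \<in> carrier (quot_module M N)" for i X
    using that by (auto simp: quot_carrier[OF N] p quot_grading_def)
  have padd: "p i (X \<oplus>\<^bsub>quot_module M N\<^esub> Y) = p i X \<oplus>\<^bsub>quot_module M N\<^esub> p i Y"
    if "X \<in> carrier (quot_module M N)" "Y \<in> carrier (quot_module M N)" for i X Y
    using that by (auto simp: quot_carrier[OF N] p quot_add[OF N] GM.hcomp_add)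
  have psame: "p i X = X" if "X \<in> ?D i" for i X
    using that by (auto simp: quot_grading_def p c)
  have pother: "p j X = \<zero>\<^bsub>quot_module M N\<^esub>" if "X \<in> ?D i" "i \<noteq> j" for i j X
    using that by (auto simp: quot_grading_def p c GM.hcomp_other coset_zero[OF N] quot_zero[OF N])
  have gr: "graded_group (quot_module M N) ?D"
    by (rule Q.M.graded_groupI(1)[where p = p]) (rule sub pD padd psame pother span; assumption)+
  have hc: "hcomp (quot_module M N) ?D i X = p i X" if "X \<in> carrier (quot_module M N)" for i X
    using _ _ _ _ _ _ that by (rule Q.M.graded_groupI(2)[where p = p])
      (rule sub pD padd psame pother span; assumption)+
  show "graded_module R \<A> (quot_module M N) ?D"
  proof (rule graded_moduleI[OF is_graded_ring Q.module_axioms gr])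
    fix a X i j assume a: "a \<in> \<A> i" and "X \<in> ?D j"
    then obtain x where x: "x \<in> \<M> j" "X = N +>\<^bsub>M\<^esub> x" by (auto simp: quot_grading_def)
    then have "a \<odot>\<^bsub>quot_module M N\<^esub> X = N +>\<^bsub>M\<^esub> (a \<odot>\<^bsub>M\<^esub> x)"
      using quot_smult[OF N] GR.homogeneous_carrier[OF a] c by blast
    then show "a \<odot>\<^bsub>quot_module M N\<^esub> X \<in> ?D (i + j)"
      unfolding quot_grading_def using graded_smult[OF a x(1)] by blast
  qed
  show "hcomp (quot_module M N) ?D i (N +>\<^bsub>M\<^esub> x) = N +>\<^bsub>M\<^esub> hcomp M \<M> i x" if "x \<in> carrier M"
  proof -
    have "N +>\<^bsub>M\<^esub> x \<in> carrier (quot_module M N)" using that quot_carrier[OF N] by blast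
    from trans[OF hc[OF this] p[OF that]] show ?thesis .
  qed
qed

text \<open>The correspondence of \<open>simple_quot_iff\<close> respects gradings: the quotient map
  commutes with components, so images and preimages of graded submodules are graded.\<close>

lemma star_simple_quot_iff:
  "star_simple_module R \<A> (quot_module M N) (quot_grading M \<M> N) \<longleftrightarrow>
     N \<noteq> carrier M \<and>
     (\<forall>K. graded_submodule R \<A> M \<M> K \<and> N \<subseteq> K \<longrightarrow> K = N \<or> K = carrier M)" (is "_ \<longleftrightarrow> ?A \<and> ?B")
proof -
  have N: "submodule N R M" using gN graded_submodule_iff by auto
  interpret Q: graded_module R \<A> "quot_module M N" "quot_grading M \<M> N" by (rule graded_quot)
  let ?q = "\<lambda>x. N +>\<^bsub>M\<^esub> x"
  have 1: "carrier (quot_module M N) \<noteq> {\<zero>\<^bsub>quot_module M N\<^esub>} \<longleftrightarrow> ?A"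
  proof -
    have "carrier (quot_module M N) = {N} \<longleftrightarrow> (\<forall>x\<in>carrier M. N +>\<^bsub>M\<^esub> x = N)"
      using M.zero_closed by (auto simp: quot_carrier[OF N])
    also have "\<dots> \<longleftrightarrow> N = carrier M" using coset_eq_self_iff[OF N] submodule_subset[OF N] by auto
    finally show ?thesis by (simp add: quot_zero[OF N])
  qed
  have image_N: "?q ` N = {N}"
    using coset_eq_self_iff[OF N] submodule_subset[OF N] submodule_zero[OF N] by auto
  have 2: "(\<forall>K. graded_submodule R \<A> (quot_module M N) (quot_grading M \<M> N) K \<longrightarrow>
      K = {\<zero>\<^bsub>quot_module M N\<^esub>} \<or> K = carrier (quot_module M N)) \<longleftrightarrow> ?B"
  proof (intro iffI allI impI)
    fix K assume *: "\<forall>K. graded_submodule R \<A> (quot_module M N) (quot_grading M \<M> N) K \<longrightarrow>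
      K = {\<zero>\<^bsub>quot_module M N\<^esub>} \<or> K = carrier (quot_module M N)"
      and K: "graded_submodule R \<A> M \<M> K \<and> N \<subseteq> K"
    then have K1: "submodule K R M" "N \<subseteq> K" "\<And>x i. x \<in> K \<Longrightarrow> hcomp M \<M> i x \<in> K"
      using graded_submodule_iff by auto
    note im = quot_submodule_image[OF N K1(1,2)]
    have "graded_submodule R \<A> (quot_module M N) (quot_grading M \<M> N) (?q ` K)"
      unfolding Q.graded_submodule_iff using im(1) K1(3) submodule_subset[OF K1(1)]
      by (auto simp: graded_quot(2))
    with * have "?q ` K = {N} \<or> ?q ` K = carrier (quot_module M N)"
      by (auto simp: quot_zero[OF N])
    then show "K = N \<or> K = carrier M"
    proof
      assume eq: "?q ` K = {N}"
      have "x \<in> N" if "x \<in> K" for x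
        using that eq coset_eq_self_iff[OF N, of x] submodule_subset[OF K1(1), of x] by auto
      then show ?thesis using K1 by blast
    next
      assume eq: "?q ` K = carrier (quot_module M N)"
      have "x \<in> K" if "x \<in> carrier M" for x
        using im(2)[OF that, unfolded eq quot_carrier[OF N]] that by blast
      then show ?thesis using submodule_subset[OF K1(1)] by blast
    qed
  next
    fix K assume B: ?B and K: "graded_submodule R \<A> (quot_module M N) (quot_grading M \<M> N) K"
    then have K1: "submodule K R (quot_module M N)"
      "\<And>x i. x \<in> K \<Longrightarrow> hcomp (quot_module M N) (quot_grading M \<M> N) i x \<in> K"
      using Q.graded_submodule_iff by auto
    note pre = quot_submodule_preimage[OF N K1(1)]
    have "graded_submodule R \<A> M \<M> {x \<in> carrier M. ?q x \<in> K}"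
      unfolding graded_submodule_iff using pre(1) K1(2) by (auto simp flip: graded_quot(2))
    with B pre(2) have "{x \<in> carrier M. ?q x \<in> K} = N \<or> {x \<in> carrier M. ?q x \<in> K} = carrier M" by blast
    then show "K = {\<zero>\<^bsub>quot_module M N\<^esub>} \<or> K = carrier (quot_module M N)"
    proof
      assume "{x \<in> carrier M. ?q x \<in> K} = N"
      then show ?thesis using pre(3) image_N quot_zero[OF N] by simp
    next
      assume "{x \<in> carrier M. ?q x \<in> K} = carrier M"
      then show ?thesis using pre(3) quot_carrier[OF N] by simp
    qed
  qed
  show ?thesis unfolding star_simple_module_def using graded_quot(1) 1 2 by blast
qed

end

lemma star_composition_series_iff:
  "star_composition_series R \<A> M \<M> n F \<longleftrightarrow>
     F 0 = {\<zero>\<^bsub>M\<^esub>} \<and> F n = carrier M \<and> (\<forall>k\<le>n. graded_submodule R \<A> M \<M> (F k)) \<and>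
     (\<forall>k<n. F k \<subset> F (Suc k) \<and>
        (\<forall>H. graded_submodule R \<A> M \<M> H \<and> F k \<subseteq> H \<and> H \<subseteq> F (Suc k) \<longrightarrow> H = F k \<or> H = F (Suc k)))"
proof -
  let ?simple = "\<lambda>k. star_simple_module R \<A> (quot_module (M\<lparr>carrier := F (Suc k)\<rparr>) (F k))
          (quot_grading (M\<lparr>carrier := F (Suc k)\<rparr>) (\<lambda>i. \<M> i \<inter> F (Suc k)) (F k))"
  have "?simple k \<longleftrightarrow>
     (\<forall>H. graded_submodule R \<A> M \<M> H \<and> F k \<subseteq> H \<and> H \<subseteq> F (Suc k) \<longrightarrow> H = F k \<or> H = F (Suc k))"
    if "\<forall>k\<le>n. graded_submodule R \<A> M \<M> (F k)" "k < n" "F k \<subset> F (Suc k)" for k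
  proof -
    have sub: "graded_submodule R \<A> M \<M> (F k)" "graded_submodule R \<A> M \<M> (F (Suc k))"
      using that by auto
    note iff = graded_submodule_of_graded_submodule_iff[OF sub(2)]
    interpret S: graded_module R \<A> "M\<lparr>carrier := F (Suc k)\<rparr>" "\<lambda>i. \<M> i \<inter> F (Suc k)"
      using sub(2) by (simp add: graded_submodule_def)
    have "graded_submodule R \<A> (M\<lparr>carrier := F (Suc k)\<rparr>) (\<lambda>i. \<M> i \<inter> F (Suc k)) (F k)"
      using iff sub(1) that(3) by blast
    from S.star_simple_quot_iff[OF this] show ?thesis
      using iff that(3) by auto
  qed
  then have "(\<forall>k<n. F k \<subset> F (Suc k) \<and> ?simple k)
     \<longleftrightarrow> (\<forall>k<n. F k \<subset> F (Suc k) \<and>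
        (\<forall>H. graded_submodule R \<A> M \<M> H \<and> F k \<subseteq> H \<and> H \<subseteq> F (Suc k) \<longrightarrow> H = F k \<or> H = F (Suc k)))"
    if "\<forall>k\<le>n. graded_submodule R \<A> M \<M> (F k)"
    using that by metis
  then show ?thesis unfolding star_composition_series_def by (intro conj_cong refl) auto
qed

end

section \<open>The ring as a graded module over itself\<close>

lemma self_module_simps [simp]:
  "carrier (self_module R) = carrier R" "\<zero>\<^bsub>self_module R\<^esub> = \<zero>\<^bsub>R\<^esub>"
  "x \<oplus>\<^bsub>self_module R\<^esub> y = x \<oplus>\<^bsub>R\<^esub> y" "x \<odot>\<^bsub>self_module R\<^esub> y = x \<otimes>\<^bsub>R\<^esub> y"
  by (simp_all add: self_module_def)

lemma self_module_add: "add (self_module R) = add R"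
  by (simp add: self_module_def)

lemma (in cring) self_module_module: "module R (self_module R)"
  by (rule moduleI[OF is_cring abelian_group_cong[OF is_abelian_group]])
    (auto simp: self_module_add l_distr r_distr m_assoc)

lemma (in graded_ring) self_module_graded_module:
  "graded_module R \<A> (self_module R) \<A>"
  "hcomp (self_module R) \<A> = hcomp R \<A>"
proof -
  have "graded_group (self_module R) \<A>"
    by (rule graded_group_cong[OF GR.graded_group_axioms]) (simp_all add: self_module_add)
  then show "graded_module R \<A> (self_module R) \<A>"
    by (rule graded_moduleI[OF graded_ring_axioms self_module_module])
      (simp add: self_module_simps(4) graded_mult)
  show "hcomp (self_module R) \<A> = hcomp R \<A>"
    by (rule graded_group_cong[OF GR.graded_group_axioms]) (simp_all add: self_module_add)
qed

text \<open>Multiplication by \<open>x\<close> of degree \<open>i\<close> shifts components by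
  \<open>i\<close>, so the degree 0 component of \<open>\<one>\<close> acts as an identity on
  homogeneous \<open>x\<close> and hence on everything. Applied to \<open>\<one>\<close>, this
  identifies it with \<open>\<one>\<close>.\<close>

lemma (in graded_ring) one_homogeneous: "\<one> \<in> \<A> 0"
proof -
  interpret S: graded_module R \<A> "self_module R" \<A> by (rule self_module_graded_module)
  have "\<one> = \<one> \<otimes> hcomp R \<A> 0 \<one>"
  proof (rule GR.additive_maps_eqI[where f = "\<lambda>x. x" and B = R and g = "\<lambda>x. x \<otimes> hcomp R \<A> 0 \<one>"])
    fix i x assume x: "x \<in> \<A> i"
    then have "x \<in> carrier R" using GR.homogeneous_carrier by blast
    then show "x = x \<otimes> hcomp R \<A> 0 \<one>"
      using S.hcomp_smult[OF x, of \<one> 0] x by (simp add: self_module_graded_module(2))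
  qed (auto simp: l_distr is_abelian_group)
  then show ?thesis using GR.hcomp_homogeneous[of \<one> 0] by simp
qed

section \<open>Localization\<close>

text \<open>The extension of \<open>N\<close> to the localization. It consists of fraction classes
  of the ambient \<open>M\<close>, not of \<open>N\<close>, so that the extensions of different
  submodules are subsets of one carrier.\<close>

definition frac_set :: "'a set \<Rightarrow> ('a, 'b, 'm) module_scheme \<Rightarrow> 'b set \<Rightarrow> ('b \<times> 'a) set set" where
  "frac_set T M N = {mfrac T M m t | m t. m \<in> N \<and> t \<in> T}"

lemma frac_setI: "m \<in> N \<Longrightarrow> t \<in> T \<Longrightarrow> mfrac T M m t \<in> frac_set T M N"
  by (auto simp: frac_set_def)

lemma frac_set_mono: "N \<subseteq> N' \<Longrightarrow> frac_set T M N \<subseteq> frac_set T M N'"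
  by (auto simp: frac_set_def)

text \<open>The contraction along the map that sends \<open>m\<close> to \<open>m/1\<close>.\<close>

definition numerators ::
    "('a, 'r) ring_scheme \<Rightarrow> 'a set \<Rightarrow> ('a, 'b, 'm) module_scheme \<Rightarrow> ('b \<times> 'a) set set \<Rightarrow> 'b set" where
  "numerators R T M F = {m \<in> carrier M. mfrac T M m \<one>\<^bsub>R\<^esub> \<in> F}"

locale localization = module R M
  for R :: "('a, 'r) ring_scheme" (structure) and M :: "('a, 'b, 'm) module_scheme" (structure)
    and T :: "'a set" +
  assumes denominators_subset: "T \<subseteq> carrier R"
    and denominators_one [simp]: "\<one> \<in> T"
    and denominators_mult [simp]: "s \<in> T \<Longrightarrow> t \<in> T \<Longrightarrow> s \<otimes> t \<in> T"
begin

lemma denominators_carrier [simp]: "t \<in> T \<Longrightarrow> t \<in> carrier R"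
  using denominators_subset by blast

lemma mem_mfrac_iff: "(n, s) \<in> mfrac T M m t \<longleftrightarrow>
    n \<in> carrier M \<and> s \<in> T \<and> (\<exists>u\<in>T. u \<odot>\<^bsub>M\<^esub> (s \<odot>\<^bsub>M\<^esub> m) = u \<odot>\<^bsub>M\<^esub> (t \<odot>\<^bsub>M\<^esub> n))"
  by (simp add: mfrac_def)

lemma mem_mfrac_self: "m \<in> carrier M \<Longrightarrow> t \<in> T \<Longrightarrow> (m, t) \<in> mfrac T M m t"
  by (auto simp: mem_mfrac_iff intro!: bexI[of _ \<one>])

lemma mfrac_eq_iff:
  assumes m: "m \<in> carrier M" "n \<in> carrier M" and t: "t \<in> T" "s \<in> T"
  shows "mfrac T M m t = mfrac T M n s \<longleftrightarrow>
    (\<exists>u\<in>T. u \<odot>\<^bsub>M\<^esub> (s \<odot>\<^bsub>M\<^esub> m) = u \<odot>\<^bsub>M\<^esub> (t \<odot>\<^bsub>M\<^esub> n))" (is "_ \<longleftrightarrow> ?r")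
proof
  assume "mfrac T M m t = mfrac T M n s"
  then show ?r using mem_mfrac_self[OF m(2) t(2)] mem_mfrac_iff by blast
next
  have sub: "mfrac T M m t \<subseteq> mfrac T M n s"
    if u: "u \<in> T" "u \<odot>\<^bsub>M\<^esub> (s \<odot>\<^bsub>M\<^esub> m) = u \<odot>\<^bsub>M\<^esub> (t \<odot>\<^bsub>M\<^esub> n)"
      and m: "m \<in> carrier M" "n \<in> carrier M" and t: "t \<in> T" "s \<in> T" for m n t s u
  proof (rule subrelI)
    fix k r assume "(k, r) \<in> mfrac T M m t"
    then obtain v where k: "k \<in> carrier M" "r \<in> T" "v \<in> T"
      and v: "v \<odot>\<^bsub>M\<^esub> (r \<odot>\<^bsub>M\<^esub> m) = v \<odot>\<^bsub>M\<^esub> (t \<odot>\<^bsub>M\<^esub> k)" by (auto simp: mem_mfrac_iff)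
    \<comment> \<open>Transitivity through the middle fraction \<open>m/t\<close>: its denominator
      \<open>t\<close> joins the multiplier because it may act non-injectively on
      \<open>M\<close>.\<close>
    have "(u \<otimes> v \<otimes> t) \<odot>\<^bsub>M\<^esub> (r \<odot>\<^bsub>M\<^esub> n) = (v \<otimes> r) \<odot>\<^bsub>M\<^esub> (u \<odot>\<^bsub>M\<^esub> (t \<odot>\<^bsub>M\<^esub> n))"
      using u(1) m t k by (simp add: m_ac flip: smult_assoc1)
    also have "\<dots> = (v \<otimes> r) \<odot>\<^bsub>M\<^esub> (u \<odot>\<^bsub>M\<^esub> (s \<odot>\<^bsub>M\<^esub> m))" using u(2) by simp
    also have "\<dots> = (u \<otimes> s) \<odot>\<^bsub>M\<^esub> (v \<odot>\<^bsub>M\<^esub> (r \<odot>\<^bsub>M\<^esub> m))"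
      using u(1) m t k by (simp add: m_ac flip: smult_assoc1)
    also have "\<dots> = (u \<otimes> s) \<odot>\<^bsub>M\<^esub> (v \<odot>\<^bsub>M\<^esub> (t \<odot>\<^bsub>M\<^esub> k))" using v by simp
    also have "\<dots> = (u \<otimes> v \<otimes> t) \<odot>\<^bsub>M\<^esub> (s \<odot>\<^bsub>M\<^esub> k)"
      using u(1) m t k by (simp add: m_ac flip: smult_assoc1)
    finally show "(k, r) \<in> mfrac T M n s"
      using u(1) t k by (auto simp: mem_mfrac_iff intro!: bexI[of _ "u \<otimes> v \<otimes> t"])
  qed
  assume ?r
  then obtain u where u: "u \<in> T" "u \<odot>\<^bsub>M\<^esub> (s \<odot>\<^bsub>M\<^esub> m) = u \<odot>\<^bsub>M\<^esub> (t \<odot>\<^bsub>M\<^esub> n)" by blast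
  show "mfrac T M m t = mfrac T M n s"
    using sub[OF u m t] sub[OF u(1) u(2)[symmetric] m(2,1) t(2,1)] by blast
qed

lemma mfrac_eqI:
  assumes "m \<in> carrier M" "n \<in> carrier M" "t \<in> T" "s \<in> T" "s \<odot>\<^bsub>M\<^esub> m = t \<odot>\<^bsub>M\<^esub> n"
  shows "mfrac T M m t = mfrac T M n s"
  using assms by (subst mfrac_eq_iff) (auto intro!: bexI[of _ \<one>])

lemma mfrac_cancel:
  assumes "m \<in> carrier M" "s \<in> T" "t \<in> T"
  shows "mfrac T M (s \<odot>\<^bsub>M\<^esub> m) (s \<otimes> t) = mfrac T M m t"
  using assms by (intro mfrac_eqI) (simp_all add: m_ac flip: smult_assoc1)

text \<open>The sum of classes is a union over all pairs of representatives. By \<open>eq\<close>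
  every pair yields the same class, and the given representatives show that the union is not
  empty.\<close>

lemma frac_add_mfrac:
  assumes "m \<in> carrier M" "n \<in> carrier M" "s \<in> T" "t \<in> T"
  shows "frac_add R T M (mfrac T M m s) (mfrac T M n t) =
    mfrac T M (t \<odot>\<^bsub>M\<^esub> m \<oplus>\<^bsub>M\<^esub> s \<odot>\<^bsub>M\<^esub> n) (s \<otimes> t)"
proof -
  let ?f = "mfrac T M (t \<odot>\<^bsub>M\<^esub> m \<oplus>\<^bsub>M\<^esub> s \<odot>\<^bsub>M\<^esub> n) (s \<otimes> t)"
  have eq: "mfrac T M (t' \<odot>\<^bsub>M\<^esub> m' \<oplus>\<^bsub>M\<^esub> s' \<odot>\<^bsub>M\<^esub> n') (s' \<otimes> t') = ?f"
    if ms: "(m', s') \<in> mfrac T M m s" and nt: "(n', t') \<in> mfrac T M n t" for m' s' n' t'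
  proof -
    obtain u v where u: "u \<in> T" "u \<odot>\<^bsub>M\<^esub> (s' \<odot>\<^bsub>M\<^esub> m) = u \<odot>\<^bsub>M\<^esub> (s \<odot>\<^bsub>M\<^esub> m')"
      and v: "v \<in> T" "v \<odot>\<^bsub>M\<^esub> (t' \<odot>\<^bsub>M\<^esub> n) = v \<odot>\<^bsub>M\<^esub> (t \<odot>\<^bsub>M\<^esub> n')"
      and c: "m' \<in> carrier M" "n' \<in> carrier M" "s' \<in> T" "t' \<in> T"
      using ms nt by (auto simp: mem_mfrac_iff)
    have "(u \<otimes> v) \<odot>\<^bsub>M\<^esub> ((s \<otimes> t) \<odot>\<^bsub>M\<^esub> (t' \<odot>\<^bsub>M\<^esub> m' \<oplus>\<^bsub>M\<^esub> s' \<odot>\<^bsub>M\<^esub> n')) =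
        (v \<otimes> t \<otimes> t') \<odot>\<^bsub>M\<^esub> (u \<odot>\<^bsub>M\<^esub> (s \<odot>\<^bsub>M\<^esub> m')) \<oplus>\<^bsub>M\<^esub> (u \<otimes> s \<otimes> s') \<odot>\<^bsub>M\<^esub> (v \<odot>\<^bsub>M\<^esub> (t \<odot>\<^bsub>M\<^esub> n'))"
      using u(1) v(1) c assms by (simp add: smult_r_distr m_ac flip: smult_assoc1)
    also have "\<dots> = (v \<otimes> t \<otimes> t') \<odot>\<^bsub>M\<^esub> (u \<odot>\<^bsub>M\<^esub> (s' \<odot>\<^bsub>M\<^esub> m)) \<oplus>\<^bsub>M\<^esub>
        (u \<otimes> s \<otimes> s') \<odot>\<^bsub>M\<^esub> (v \<odot>\<^bsub>M\<^esub> (t' \<odot>\<^bsub>M\<^esub> n))"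
      using u(2) v(2) by simp
    also have "\<dots> = (u \<otimes> v) \<odot>\<^bsub>M\<^esub> ((s' \<otimes> t') \<odot>\<^bsub>M\<^esub> (t \<odot>\<^bsub>M\<^esub> m \<oplus>\<^bsub>M\<^esub> s \<odot>\<^bsub>M\<^esub> n))"
      using u(1) v(1) c assms by (simp add: smult_r_distr m_ac flip: smult_assoc1)
    finally show ?thesis
      using u(1) v(1) c assms by (subst mfrac_eq_iff) (auto intro!: bexI[of _ "u \<otimes> v"])
  qed
  show ?thesis
    unfolding frac_add_def
  proof (rule antisym)
    show "(\<Union>(m, s)\<in>mfrac T M m s. \<Union>(n, t)\<in>mfrac T M n t.
        mfrac T M (t \<odot>\<^bsub>M\<^esub> m \<oplus>\<^bsub>M\<^esub> s \<odot>\<^bsub>M\<^esub> n) (s \<otimes> t)) \<subseteq> ?f"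
      using eq by fastforce
    show "?f \<subseteq> (\<Union>(m, s)\<in>mfrac T M m s. \<Union>(n, t)\<in>mfrac T M n t.
        mfrac T M (t \<odot>\<^bsub>M\<^esub> m \<oplus>\<^bsub>M\<^esub> s \<odot>\<^bsub>M\<^esub> n) (s \<otimes> t))"
      using mem_mfrac_self[OF assms(1,3)] mem_mfrac_self[OF assms(2,4)] by fastforce
  qed
qed

lemma frac_smult_mfrac:
  assumes "a \<in> carrier R" "n \<in> carrier M" "s \<in> T" "t \<in> T"
  shows "frac_smult R T M (mfrac T (self_module R) a s) (mfrac T M n t) = mfrac T M (a \<odot>\<^bsub>M\<^esub> n) (s \<otimes> t)"
proof -
  let ?f = "mfrac T M (a \<odot>\<^bsub>M\<^esub> n) (s \<otimes> t)"
  have eq: "mfrac T M (a' \<odot>\<^bsub>M\<^esub> n') (s' \<otimes> t') = ?f"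
    if as: "(a', s') \<in> mfrac T (self_module R) a s" and nt: "(n', t') \<in> mfrac T M n t" for a' s' n' t'
  proof -
    obtain u v where u: "u \<in> T" "u \<otimes> (s' \<otimes> a) = u \<otimes> (s \<otimes> a')"
      and v: "v \<in> T" "v \<odot>\<^bsub>M\<^esub> (t' \<odot>\<^bsub>M\<^esub> n) = v \<odot>\<^bsub>M\<^esub> (t \<odot>\<^bsub>M\<^esub> n')"
      and c: "a' \<in> carrier R" "n' \<in> carrier M" "s' \<in> T" "t' \<in> T"
      using as nt by (auto simp: mfrac_def)
    have "(u \<otimes> v) \<odot>\<^bsub>M\<^esub> ((s \<otimes> t) \<odot>\<^bsub>M\<^esub> (a' \<odot>\<^bsub>M\<^esub> n')) = (u \<otimes> (s \<otimes> a')) \<odot>\<^bsub>M\<^esub> (v \<odot>\<^bsub>M\<^esub> (t \<odot>\<^bsub>M\<^esub> n'))"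
      using u(1) v(1) c assms by (simp add: m_ac flip: smult_assoc1)
    also have "\<dots> = (u \<otimes> (s' \<otimes> a)) \<odot>\<^bsub>M\<^esub> (v \<odot>\<^bsub>M\<^esub> (t' \<odot>\<^bsub>M\<^esub> n))"
      using u(2) v(2) by simp
    also have "\<dots> = (u \<otimes> v) \<odot>\<^bsub>M\<^esub> ((s' \<otimes> t') \<odot>\<^bsub>M\<^esub> (a \<odot>\<^bsub>M\<^esub> n))"
      using u(1) v(1) c assms by (simp add: m_ac flip: smult_assoc1)
    finally show ?thesis
      using u(1) v(1) c assms by (subst mfrac_eq_iff) (auto intro!: bexI[of _ "u \<otimes> v"])
  qed
  have self: "(a, s) \<in> mfrac T (self_module R) a s"
    using assms by (auto simp: mfrac_def intro!: bexI[of _ \<one>])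
  show ?thesis
    unfolding frac_smult_def
  proof (rule antisym)
    show "(\<Union>(a, s)\<in>mfrac T (self_module R) a s. \<Union>(n, t)\<in>mfrac T M n t.
        mfrac T M (a \<odot>\<^bsub>M\<^esub> n) (s \<otimes> t)) \<subseteq> ?f"
      using eq by fastforce
    show "?f \<subseteq> (\<Union>(a, s)\<in>mfrac T (self_module R) a s. \<Union>(n, t)\<in>mfrac T M n t.
        mfrac T M (a \<odot>\<^bsub>M\<^esub> n) (s \<otimes> t))"
      using self mem_mfrac_self[OF assms(2,4)] by fastforce
  qed
qed

lemma loc_module_sel:
  "carrier (loc_module R T M) = {mfrac T M m t | m t. m \<in> carrier M \<and> t \<in> T}"
  "\<zero>\<^bsub>loc_module R T M\<^esub> = mfrac T M \<zero>\<^bsub>M\<^esub> \<one>"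
  "X \<oplus>\<^bsub>loc_module R T M\<^esub> Y = frac_add R T M X Y"
  "X' \<odot>\<^bsub>loc_module R T M\<^esub> Y = frac_smult R T M X' Y"
  by (simp_all add: loc_module_def)

lemma loc_add:
  assumes "m \<in> carrier M" "n \<in> carrier M" "s \<in> T" "t \<in> T"
  shows "mfrac T M m s \<oplus>\<^bsub>loc_module R T M\<^esub> mfrac T M n t =
    mfrac T M (t \<odot>\<^bsub>M\<^esub> m \<oplus>\<^bsub>M\<^esub> s \<odot>\<^bsub>M\<^esub> n) (s \<otimes> t)"
  using frac_add_mfrac[OF assms] by (simp add: loc_module_sel)

lemma loc_add_same:
  assumes "m \<in> carrier M" "n \<in> carrier M" "t \<in> T"
  shows "mfrac T M m t \<oplus>\<^bsub>loc_module R T M\<^esub> mfrac T M n t = mfrac T M (m \<oplus>\<^bsub>M\<^esub> n) t"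
  using assms mfrac_cancel[of "m \<oplus>\<^bsub>M\<^esub> n" t t] by (simp add: loc_add smult_r_distr)

lemma loc_smult:
  assumes "a \<in> carrier R" "n \<in> carrier M" "s \<in> T" "t \<in> T"
  shows "mfrac T (self_module R) a s \<odot>\<^bsub>loc_module R T M\<^esub> mfrac T M n t =
    mfrac T M (a \<odot>\<^bsub>M\<^esub> n) (s \<otimes> t)"
  using frac_smult_mfrac[OF assms] by (simp add: loc_module_sel)

lemma mfrac_carrier [simp]:
  "m \<in> carrier M \<Longrightarrow> t \<in> T \<Longrightarrow> mfrac T M m t \<in> carrier (loc_module R T M)"
  by (auto simp: loc_module_sel)

lemma loc_carrierE:
  assumes "X \<in> carrier (loc_module R T M)"
  obtains m t where "m \<in> carrier M" "t \<in> T" "X = mfrac T M m t"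
  using assms by (auto simp: loc_module_sel)

lemma mfrac_zero [simp]: "t \<in> T \<Longrightarrow> mfrac T M \<zero>\<^bsub>M\<^esub> t = \<zero>\<^bsub>loc_module R T M\<^esub>"
  unfolding loc_module_sel by (intro mfrac_eqI) auto

lemma mfrac_eq_zero_iff:
  assumes "m \<in> carrier M" "t \<in> T"
  shows "mfrac T M m t = \<zero>\<^bsub>loc_module R T M\<^esub> \<longleftrightarrow> (\<exists>u\<in>T. u \<odot>\<^bsub>M\<^esub> m = \<zero>\<^bsub>M\<^esub>)"
  unfolding loc_module_sel using assms by (subst mfrac_eq_iff) auto

lemma loc_abelian_group: "abelian_group (loc_module R T M)"
proof (rule abelian_groupI)
  fix X Y Z assume "X \<in> carrier (loc_module R T M)" "Y \<in> carrier (loc_module R T M)"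
  then obtain m s n t where X: "m \<in> carrier M" "s \<in> T" "X = mfrac T M m s"
    and Y: "n \<in> carrier M" "t \<in> T" "Y = mfrac T M n t" by (metis loc_carrierE)
  show "X \<oplus>\<^bsub>loc_module R T M\<^esub> Y \<in> carrier (loc_module R T M)"
    using X Y by (auto simp: loc_add)
  show "X \<oplus>\<^bsub>loc_module R T M\<^esub> Y = Y \<oplus>\<^bsub>loc_module R T M\<^esub> X"
    using X Y by (simp add: loc_add m_comm M.a_comm)
  assume "Z \<in> carrier (loc_module R T M)"
  then obtain k r where Z: "k \<in> carrier M" "r \<in> T" "Z = mfrac T M k r" by (metis loc_carrierE)
  show "X \<oplus>\<^bsub>loc_module R T M\<^esub> Y \<oplus>\<^bsub>loc_module R T M\<^esub> Z =
      X \<oplus>\<^bsub>loc_module R T M\<^esub> (Y \<oplus>\<^bsub>loc_module R T M\<^esub> Z)"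
    using X Y Z by (simp add: loc_add smult_r_distr m_ac M.a_ac flip: smult_assoc1)
next
  fix X assume "X \<in> carrier (loc_module R T M)"
  then obtain m s where X: "m \<in> carrier M" "s \<in> T" "X = mfrac T M m s" by (metis loc_carrierE)
  show "\<zero>\<^bsub>loc_module R T M\<^esub> \<oplus>\<^bsub>loc_module R T M\<^esub> X = X"
    using X loc_add[of "\<zero>\<^bsub>M\<^esub>" m \<one> s] by simp
  show "\<exists>Y\<in>carrier (loc_module R T M). Y \<oplus>\<^bsub>loc_module R T M\<^esub> X = \<zero>\<^bsub>loc_module R T M\<^esub>"
    using X by (intro bexI[of _ "mfrac T M (\<ominus>\<^bsub>M\<^esub> m) s"]) (simp_all add: loc_add_same M.l_neg)
next
  show "\<zero>\<^bsub>loc_module R T M\<^esub> \<in> carrier (loc_module R T M)"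
    using mfrac_carrier[of "\<zero>\<^bsub>M\<^esub>" \<one>] by simp
qed

lemma loc_minus:
  assumes "m \<in> carrier M" "t \<in> T"
  shows "\<ominus>\<^bsub>loc_module R T M\<^esub> mfrac T M m t = mfrac T M (\<ominus>\<^bsub>M\<^esub> m) t"
  using assms by (intro abelian_group.minus_equality[OF loc_abelian_group])
    (simp_all add: loc_add_same M.l_neg)

lemma self_localization: "localization R (self_module R) T"
  by (intro localization.intro self_module_module localization_axioms.intro denominators_subset)
    simp_all

text \<open>The localized ring is the localized \<open>self_module\<close> with scalar action as
  multiplication, so facts about fractions in modules specialize to it.\<close>

lemma loc_ring_sel:
  "carrier (loc_ring R T) = carrier (loc_module R T (self_module R))"
  "zero (loc_ring R T) = zero (loc_module R T (self_module R))"
  "add (loc_ring R T) = add (loc_module R T (self_module R))"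
  "mult (loc_ring R T) = smult (loc_module R T (self_module R))"
  "\<one>\<^bsub>loc_ring R T\<^esub> = mfrac T (self_module R) \<one> \<one>"
  by (simp_all add: loc_ring_def loc_module_def)

lemma loc_ring_carrierE:
  assumes "X \<in> carrier (loc_ring R T)"
  obtains a t where "a \<in> carrier R" "t \<in> T" "X = mfrac T (self_module R) a t"
  using assms by (auto simp: loc_ring_def)

lemma loc_ring_cring: "cring (loc_ring R T)"
proof -
  interpret S: localization R "self_module R" T by (rule self_localization)
  note mult = S.loc_smult[simplified] and add = S.loc_add[simplified] and car = S.mfrac_carrier[simplified]
  show ?thesis
  proof (rule cringI)
    show "abelian_group (loc_ring R T)"
      by (rule abelian_group_cong[OF S.loc_abelian_group]) (simp_all add: loc_ring_sel)
    show "comm_monoid (loc_ring R T)"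
    proof (rule comm_monoidI)
      show "\<one>\<^bsub>loc_ring R T\<^esub> \<in> carrier (loc_ring R T)" by (simp add: loc_ring_sel)
      fix X Y Z assume "X \<in> carrier (loc_ring R T)"
      then obtain a s where X: "a \<in> carrier R" "s \<in> T" "X = mfrac T (self_module R) a s"
        by (rule loc_ring_carrierE)
      show "\<one>\<^bsub>loc_ring R T\<^esub> \<otimes>\<^bsub>loc_ring R T\<^esub> X = X" using X by (simp add: loc_ring_sel mult)
      assume "Y \<in> carrier (loc_ring R T)"
      then obtain b t where Y: "b \<in> carrier R" "t \<in> T" "Y = mfrac T (self_module R) b t"
        by (rule loc_ring_carrierE)
      show "X \<otimes>\<^bsub>loc_ring R T\<^esub> Y \<in> carrier (loc_ring R T)"
        using X Y by (simp add: loc_ring_sel mult)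
      show "X \<otimes>\<^bsub>loc_ring R T\<^esub> Y = Y \<otimes>\<^bsub>loc_ring R T\<^esub> X"
        using X Y by (simp add: loc_ring_sel mult m_comm)
      assume "Z \<in> carrier (loc_ring R T)"
      then obtain c r where Z: "c \<in> carrier R" "r \<in> T" "Z = mfrac T (self_module R) c r"
        by (rule loc_ring_carrierE)
      show "X \<otimes>\<^bsub>loc_ring R T\<^esub> Y \<otimes>\<^bsub>loc_ring R T\<^esub> Z = X \<otimes>\<^bsub>loc_ring R T\<^esub> (Y \<otimes>\<^bsub>loc_ring R T\<^esub> Z)"
        using X Y Z by (simp add: loc_ring_sel mult m_assoc)
    qed
    fix X Y Z assume "X \<in> carrier (loc_ring R T)" "Y \<in> carrier (loc_ring R T)" "Z \<in> carrier (loc_ring R T)"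
    then obtain a s b t c r where *: "a \<in> carrier R" "s \<in> T" "X = mfrac T (self_module R) a s"
      "b \<in> carrier R" "t \<in> T" "Y = mfrac T (self_module R) b t"
      "c \<in> carrier R" "r \<in> T" "Z = mfrac T (self_module R) c r"
      by (metis loc_ring_carrierE)
    have "mfrac T (self_module R) (r \<otimes> (c \<otimes> (t \<otimes> a \<oplus> s \<otimes> b))) (r \<otimes> (s \<otimes> t \<otimes> r)) =
        mfrac T (self_module R) (c \<otimes> (t \<otimes> a \<oplus> s \<otimes> b)) (s \<otimes> t \<otimes> r)"
      using * S.mfrac_cancel[of "c \<otimes> (t \<otimes> a \<oplus> s \<otimes> b)" r "s \<otimes> t \<otimes> r"] by simp
    then show "(X \<oplus>\<^bsub>loc_ring R T\<^esub> Y) \<otimes>\<^bsub>loc_ring R T\<^esub> Z =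
        X \<otimes>\<^bsub>loc_ring R T\<^esub> Z \<oplus>\<^bsub>loc_ring R T\<^esub> Y \<otimes>\<^bsub>loc_ring R T\<^esub> Z"
      using * by (simp add: loc_ring_sel mult add l_distr r_distr m_ac)
  qed
qed

lemma loc_module_module: "module (loc_ring R T) (loc_module R T M)"
proof -
  interpret S: localization R "self_module R" T by (rule self_localization)
  note mult = S.loc_smult[simplified] and add = S.loc_add[simplified]
  show ?thesis
  proof (rule moduleI[OF loc_ring_cring loc_abelian_group])
    fix X assume "X \<in> carrier (loc_module R T M)"
    then obtain m s where X: "m \<in> carrier M" "s \<in> T" "X = mfrac T M m s" by (rule loc_carrierE)
    show "\<one>\<^bsub>loc_ring R T\<^esub> \<odot>\<^bsub>loc_module R T M\<^esub> X = X" using X by (simp add: loc_ring_sel loc_smult)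
    fix U assume "U \<in> carrier (loc_ring R T)"
    then obtain a t where U: "a \<in> carrier R" "t \<in> T" "U = mfrac T (self_module R) a t"
      by (rule loc_ring_carrierE)
    show "U \<odot>\<^bsub>loc_module R T M\<^esub> X \<in> carrier (loc_module R T M)" using U X by (simp add: loc_smult)
    { fix V assume "V \<in> carrier (loc_ring R T)"
      then obtain b r where V: "b \<in> carrier R" "r \<in> T" "V = mfrac T (self_module R) b r"
        by (rule loc_ring_carrierE)
      show "(U \<otimes>\<^bsub>loc_ring R T\<^esub> V) \<odot>\<^bsub>loc_module R T M\<^esub> X =
          U \<odot>\<^bsub>loc_module R T M\<^esub> (V \<odot>\<^bsub>loc_module R T M\<^esub> X)"
        using U V X by (simp add: loc_ring_sel mult loc_smult smult_assoc1 m_assoc)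
      have "mfrac T M (s \<odot>\<^bsub>M\<^esub> ((r \<otimes> a \<oplus> t \<otimes> b) \<odot>\<^bsub>M\<^esub> m)) (s \<otimes> (t \<otimes> r \<otimes> s)) =
          mfrac T M ((r \<otimes> a \<oplus> t \<otimes> b) \<odot>\<^bsub>M\<^esub> m) (t \<otimes> r \<otimes> s)"
        using U V X by (intro mfrac_cancel) auto
      then show "(U \<oplus>\<^bsub>loc_ring R T\<^esub> V) \<odot>\<^bsub>loc_module R T M\<^esub> X =
          U \<odot>\<^bsub>loc_module R T M\<^esub> X \<oplus>\<^bsub>loc_module R T M\<^esub> V \<odot>\<^bsub>loc_module R T M\<^esub> X"
        using U V X by (simp add: loc_ring_sel add loc_smult loc_add smult_l_distr smult_r_distr m_ac
            flip: smult_assoc1) }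
    { fix Y assume "Y \<in> carrier (loc_module R T M)"
      then obtain n r where Y: "n \<in> carrier M" "r \<in> T" "Y = mfrac T M n r" by (rule loc_carrierE)
      have "mfrac T M (t \<odot>\<^bsub>M\<^esub> (a \<odot>\<^bsub>M\<^esub> (r \<odot>\<^bsub>M\<^esub> m \<oplus>\<^bsub>M\<^esub> s \<odot>\<^bsub>M\<^esub> n))) (t \<otimes> (t \<otimes> (s \<otimes> r))) =
          mfrac T M (a \<odot>\<^bsub>M\<^esub> (r \<odot>\<^bsub>M\<^esub> m \<oplus>\<^bsub>M\<^esub> s \<odot>\<^bsub>M\<^esub> n)) (t \<otimes> (s \<otimes> r))"
        using U X Y by (intro mfrac_cancel) auto
      then show "U \<odot>\<^bsub>loc_module R T M\<^esub> (X \<oplus>\<^bsub>loc_module R T M\<^esub> Y) =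
          U \<odot>\<^bsub>loc_module R T M\<^esub> X \<oplus>\<^bsub>loc_module R T M\<^esub> U \<odot>\<^bsub>loc_module R T M\<^esub> Y"
        using U X Y by (simp add: loc_smult loc_add smult_r_distr m_ac flip: smult_assoc1) }
  qed
qed

text \<open>A fraction may lie in the extension of \<open>N\<close> although its displayed numerator
  is outside \<open>N\<close>. If \<open>m/t = n/s\<close> by a multiplier \<open>u\<close>, then
  \<open>u s\<close> takes \<open>m\<close> into \<open>N\<close>; conversely \<open>m/t\<close>
  equals \<open>(u m)/(u t)\<close>. Thus contracting the extension gives the
  \<open>T\<close>-saturation of \<open>N\<close>.\<close>

lemma mem_frac_set_iff:
  assumes N: "submodule N R M" and m: "m \<in> carrier M" "t \<in> T"
  shows "mfrac T M m t \<in> frac_set T M N \<longleftrightarrow> (\<exists>u\<in>T. u \<odot>\<^bsub>M\<^esub> m \<in> N)"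
proof
  assume "mfrac T M m t \<in> frac_set T M N"
  then obtain n s where n: "n \<in> N" "s \<in> T" "mfrac T M m t = mfrac T M n s" by (auto simp: frac_set_def)
  then obtain u where u: "u \<in> T" "u \<odot>\<^bsub>M\<^esub> (s \<odot>\<^bsub>M\<^esub> m) = u \<odot>\<^bsub>M\<^esub> (t \<odot>\<^bsub>M\<^esub> n)"
    using mfrac_eq_iff m submodule_subset[OF N] by blast
  have "(u \<otimes> s) \<odot>\<^bsub>M\<^esub> m = u \<odot>\<^bsub>M\<^esub> (t \<odot>\<^bsub>M\<^esub> n)" using u n m by (simp add: smult_assoc1)
  also have "\<dots> \<in> N" using u n m submodule_smult[OF N] by simp
  finally show "\<exists>u\<in>T. u \<odot>\<^bsub>M\<^esub> m \<in> N" using u n by (intro bexI[of _ "u \<otimes> s"]) auto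
next
  assume "\<exists>u\<in>T. u \<odot>\<^bsub>M\<^esub> m \<in> N"
  then obtain u where u: "u \<in> T" "u \<odot>\<^bsub>M\<^esub> m \<in> N" by blast
  have "mfrac T M (u \<odot>\<^bsub>M\<^esub> m) (u \<otimes> t) \<in> frac_set T M N" using u m by (intro frac_setI) auto
  then show "mfrac T M m t \<in> frac_set T M N" using mfrac_cancel u m by simp
qed

lemma frac_set_submodule:
  assumes N: "submodule N R M"
  shows "submodule (frac_set T M N) (loc_ring R T) (loc_module R T M)"
  unfolding module.submodule_iff[OF loc_module_module]
proof (intro conjI ballI)
  show "frac_set T M N \<subseteq> carrier (loc_module R T M)"
    using submodule_subset[OF N] by (auto simp: frac_set_def)
  show "\<zero>\<^bsub>loc_module R T M\<^esub> \<in> frac_set T M N"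
    using frac_setI[where M = M, OF submodule_zero[OF N] denominators_one] mfrac_zero by simp
next
  fix X Y assume "X \<in> frac_set T M N" "Y \<in> frac_set T M N"
  then obtain m s n t where *: "m \<in> N" "s \<in> T" "n \<in> N" "t \<in> T" "X = mfrac T M m s" "Y = mfrac T M n t"
    by (auto simp: frac_set_def)
  then have "t \<odot>\<^bsub>M\<^esub> m \<oplus>\<^bsub>M\<^esub> s \<odot>\<^bsub>M\<^esub> n \<in> N" using submodule_add[OF N] submodule_smult[OF N] by simp
  then show "X \<oplus>\<^bsub>loc_module R T M\<^esub> Y \<in> frac_set T M N"
    using * submodule_subset[OF N] by (auto simp: loc_add intro: frac_setI)
next
  fix U X assume "U \<in> carrier (loc_ring R T)" "X \<in> frac_set T M N"
  then obtain a s n t where *: "a \<in> carrier R" "s \<in> T" "n \<in> N" "t \<in> T"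
    "U = mfrac T (self_module R) a s" "X = mfrac T M n t"
    unfolding frac_set_def by (blast elim: loc_ring_carrierE)
  then show "U \<odot>\<^bsub>loc_module R T M\<^esub> X \<in> frac_set T M N"
    using submodule_smult[OF N] submodule_subset[OF N] by (auto simp: loc_smult intro!: frac_setI)
qed

lemma frac_set_carrier: "frac_set T M (carrier M) = carrier (loc_module R T M)"
  by (simp add: frac_set_def loc_module_sel)

context
  fixes F assumes F: "submodule F (loc_ring R T) (loc_module R T M)"
begin

text \<open>The ring fractions \<open>t/1\<close> and \<open>1/t\<close> carry \<open>m/t\<close> to
  \<open>m/1\<close> and back without leaving \<open>F\<close>.\<close>

lemma mfrac_mem_submodule_iff:
  assumes "m \<in> carrier M" "t \<in> T"
  shows "mfrac T M m t \<in> F \<longleftrightarrow> m \<in> numerators R T M F"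
proof -
  interpret S: localization R "self_module R" T by (rule self_localization)
  note F = F[unfolded module.submodule_iff[OF loc_module_module]]
  have c: "a \<in> carrier R \<Longrightarrow> s \<in> T \<Longrightarrow> mfrac T (self_module R) a s \<in> carrier (loc_ring R T)" for a s
    by (simp add: loc_ring_sel)
  have "mfrac T (self_module R) t \<one> \<odot>\<^bsub>loc_module R T M\<^esub> mfrac T M m t = mfrac T M m \<one>"
    using assms mfrac_cancel[of m t \<one>] by (simp add: loc_smult)
  moreover have "mfrac T (self_module R) \<one> t \<odot>\<^bsub>loc_module R T M\<^esub> mfrac T M m \<one> = mfrac T M m t"
    using assms by (simp add: loc_smult)
  ultimately show ?thesis
    unfolding numerators_def
    using F c[of t \<one>] c[of \<one> t] assms by (metis (no_types, lifting) R.one_closed denominators_carrier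
        denominators_one mem_Collect_eq)
qed

lemma numerators_submodule: "submodule (numerators R T M F) R M"
  unfolding submodule_iff
proof (intro conjI ballI)
  interpret S: localization R "self_module R" T by (rule self_localization)
  note F = F[unfolded module.submodule_iff[OF loc_module_module]]
  show "numerators R T M F \<subseteq> carrier M" by (auto simp: numerators_def)
  show "\<zero>\<^bsub>M\<^esub> \<in> numerators R T M F" using F by (simp add: numerators_def)
  fix x assume x: "x \<in> numerators R T M F"
  { fix y assume "y \<in> numerators R T M F"
    with x F show "x \<oplus>\<^bsub>M\<^esub> y \<in> numerators R T M F"
      by (auto simp: numerators_def simp flip: loc_add_same) }
  fix a assume a: "a \<in> carrier R"
  then have "mfrac T (self_module R) a \<one> \<in> carrier (loc_ring R T)" by (simp add: loc_ring_sel)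
  then have "mfrac T (self_module R) a \<one> \<odot>\<^bsub>loc_module R T M\<^esub> mfrac T M x \<one> \<in> F"
    using x F by (auto simp: numerators_def)
  then show "a \<odot>\<^bsub>M\<^esub> x \<in> numerators R T M F"
    using a x by (simp add: numerators_def loc_smult)
qed

text \<open>Extension undoes contraction, so distinct submodules of the localization have distinct
  contractions and can be told apart inside \<open>M\<close>.\<close>

lemma frac_set_numerators: "frac_set T M (numerators R T M F) = F"
proof
  show "frac_set T M (numerators R T M F) \<subseteq> F"
    using mfrac_mem_submodule_iff by (auto simp: frac_set_def numerators_def)
  show "F \<subseteq> frac_set T M (numerators R T M F)"
  proof
    fix X assume X: "X \<in> F"
    then have "X \<in> carrier (loc_module R T M)"
      using F[unfolded module.submodule_iff[OF loc_module_module]] by blast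
    then obtain m t where "m \<in> carrier M" "t \<in> T" "X = mfrac T M m t" by (rule loc_carrierE)
    then show "X \<in> frac_set T M (numerators R T M F)"
      using X mfrac_mem_submodule_iff unfolding frac_set_def by blast
  qed
qed

lemma numerators_saturated:
  assumes "t \<in> T" "m \<in> carrier M" "t \<odot>\<^bsub>M\<^esub> m \<in> numerators R T M F"
  shows "m \<in> numerators R T M F"
  using assms mfrac_mem_submodule_iff[of "t \<odot>\<^bsub>M\<^esub> m" t] mfrac_mem_submodule_iff[of m \<one>]
    mfrac_cancel[of m t \<one>] by simp

end

end

section \<open>Localization at homogeneous elements\<close>

locale graded_localization = graded_module R \<A> M \<M> + localization R M T
  for R :: "('a, 'r) ring_scheme" (structure) and \<A> :: "int \<Rightarrow> 'a set"
    and M :: "('a, 'b, 'm) module_scheme" (structure) and \<M> :: "int \<Rightarrow> 'b set"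
    and T :: "'a set" +
  assumes denominators_homogeneous: "T \<subseteq> (\<Union>i. \<A> i)"
begin

abbreviation "grading \<equiv> loc_grading \<A> T M \<M>"

lemma gradingI: "m \<in> \<M> (i + k) \<Longrightarrow> t \<in> T \<Longrightarrow> t \<in> \<A> k \<Longrightarrow> mfrac T M m t \<in> grading i"
  unfolding loc_grading_def by force

lemma gradingE:
  assumes "X \<in> grading i"
  obtains m t k where "m \<in> \<M> (i + k)" "t \<in> T" "t \<in> \<A> k" "X = mfrac T M m t"
proof -
  from assms obtain m t j k where *: "X = mfrac T M m t" "m \<in> \<M> j" "t \<in> T" "t \<in> \<A> k" "j - k = i"
    unfolding loc_grading_def by blast
  then have "m \<in> \<M> (i + k)" by auto
  then show thesis using *(3,4,1) by (rule that)
qed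

lemma loc_carrier_homogeneousE:
  assumes "X \<in> carrier (loc_module R T M)"
  obtains m t k where "m \<in> carrier M" "t \<in> T" "t \<in> \<A> k" "X = mfrac T M m t"
  using assms denominators_homogeneous by (blast elim: loc_carrierE)

lemma grading_smult_closed: "t \<in> \<A> k \<Longrightarrow> m \<in> \<M> j \<Longrightarrow> k + j = i \<Longrightarrow> t \<odot>\<^bsub>M\<^esub> m \<in> \<M> i"
  using graded_smult by blast

text \<open>Makes the degree \<open>i\<close> component of \<open>m/t\<close> well defined. Since
  \<open>u\<close>, \<open>s\<close> and \<open>t\<close> are homogeneous, the equation
  \<open>u s m = u t n\<close> may be compared in the single degree
  \<open>r + i + k + l\<close>.\<close>

lemma mfrac_hcomp_cong:
  assumes m: "m \<in> carrier M" "n \<in> carrier M" and t: "t \<in> T" "t \<in> \<A> k" "s \<in> T" "s \<in> \<A> l"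
    and eq: "mfrac T M m t = mfrac T M n s"
  shows "mfrac T M (hcomp M \<M> (i + k) m) t = mfrac T M (hcomp M \<M> (i + l) n) s"
proof -
  obtain u where u: "u \<in> T" "u \<odot>\<^bsub>M\<^esub> (s \<odot>\<^bsub>M\<^esub> m) = u \<odot>\<^bsub>M\<^esub> (t \<odot>\<^bsub>M\<^esub> n)"
    using mfrac_eq_iff[OF m t(1,3)] eq by blast
  obtain r where r: "u \<in> \<A> r" using u(1) denominators_homogeneous by blast
  have "u \<odot>\<^bsub>M\<^esub> (s \<odot>\<^bsub>M\<^esub> hcomp M \<M> (i + k) m) = hcomp M \<M> (r + (l + (i + k))) (u \<odot>\<^bsub>M\<^esub> (s \<odot>\<^bsub>M\<^esub> m))"
    using hcomp_smult[OF r] hcomp_smult[OF t(4)] m t by simp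
  also have "\<dots> = hcomp M \<M> (r + (k + (i + l))) (u \<odot>\<^bsub>M\<^esub> (t \<odot>\<^bsub>M\<^esub> n))"
    by (simp add: u(2) ac_simps)
  also have "\<dots> = u \<odot>\<^bsub>M\<^esub> (t \<odot>\<^bsub>M\<^esub> hcomp M \<M> (i + l) n)"
    using hcomp_smult[OF r] hcomp_smult[OF t(2)] m t by simp
  finally show ?thesis
    using m t u(1) by (subst mfrac_eq_iff) auto
qed

lemma loc_graded_group: "graded_group (loc_module R T M) grading" (is ?thesis1)
  and hcomp_mfrac: "m \<in> carrier M \<Longrightarrow> t \<in> T \<Longrightarrow> t \<in> \<A> k \<Longrightarrow>
    hcomp (loc_module R T M) grading i (mfrac T M m t) = mfrac T M (hcomp M \<M> (i + k) m) t"
proof -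
  interpret L: abelian_group "loc_module R T M" by (rule loc_abelian_group)
  \<comment> \<open>Numerator, denominator and degree of the denominator are chosen together. By
    \<open>mfrac_hcomp_cong\<close> the resulting component does not depend on the triple.\<close>
  let ?Q = "\<lambda>X (m, t, k). m \<in> carrier M \<and> t \<in> T \<and> t \<in> \<A> k \<and> X = mfrac T M m t"
  define p where "p i X = (case (SOME x. ?Q X x) of (m, t, k) \<Rightarrow> mfrac T M (hcomp M \<M> (i + k) m) t)" for i X
  have p: "p i (mfrac T M m t) = mfrac T M (hcomp M \<M> (i + k) m) t"
    if m: "m \<in> carrier M" "t \<in> T" "t \<in> \<A> k" for i m t k
  proof -
    obtain n s l where nsl: "(SOME x. ?Q (mfrac T M m t) x) = (n, s, l)"
      by (cases "SOME x. ?Q (mfrac T M m t) x" rule: prod_cases3)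
    have "?Q (mfrac T M m t) (n, s, l)"
      unfolding nsl[symmetric] by (rule someI[where x = "(m, t, k)"]) (use m in simp)
    then have n: "n \<in> carrier M" "s \<in> T" "s \<in> \<A> l" "mfrac T M m t = mfrac T M n s" by auto
    have "p i (mfrac T M m t) = mfrac T M (hcomp M \<M> (i + l) n) s" by (simp only: p_def nsl prod.case)
    also have "\<dots> = mfrac T M (hcomp M \<M> (i + k) m) t"
      by (rule mfrac_hcomp_cong[OF m(1) n(1) m(2,3) n(2,3,4), symmetric])
    finally show ?thesis .
  qed
  have c: "x \<in> carrier M" if "x \<in> \<M> i" for x i using that GM.homogeneous_carrier by blast
  have sub: "subgroup (grading i) (add_monoid (loc_module R T M))" for i
  proof (rule L.add.subgroupI)
    show "grading i \<subseteq> carrier (loc_module R T M)" by (auto elim!: gradingE simp: c)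
    have "mfrac T M \<zero>\<^bsub>M\<^esub> \<one> \<in> grading i" using one_homogeneous by (intro gradingI) auto
    then show "grading i \<noteq> {}" by blast
  next
    fix X assume "X \<in> grading i"
    then obtain m t k where *: "m \<in> \<M> (i + k)" "t \<in> T" "t \<in> \<A> k" "X = mfrac T M m t" by (rule gradingE)
    then show "\<ominus>\<^bsub>loc_module R T M\<^esub> X \<in> grading i"
      using GM.homogeneous_minus by (auto simp: loc_minus c intro: gradingI)
    fix Y assume "Y \<in> grading i"
    then obtain n s l where **: "n \<in> \<M> (i + l)" "s \<in> T" "s \<in> \<A> l" "Y = mfrac T M n s" by (rule gradingE)
    have "s \<odot>\<^bsub>M\<^esub> m \<oplus>\<^bsub>M\<^esub> t \<odot>\<^bsub>M\<^esub> n \<in> \<M> (i + (k + l))"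
      using * ** by (intro GM.homogeneous_add) (auto intro: grading_smult_closed)
    then show "X \<oplus>\<^bsub>loc_module R T M\<^esub> Y \<in> grading i"
      using * ** graded_mult by (auto simp: loc_add c intro!: gradingI)
  qed
  have pD: "p i X \<in> grading i" if "X \<in> carrier (loc_module R T M)" for i X
    using that by (elim loc_carrier_homogeneousE) (auto simp: p intro!: gradingI)
  have padd: "p i (X \<oplus>\<^bsub>loc_module R T M\<^esub> Y) = p i X \<oplus>\<^bsub>loc_module R T M\<^esub> p i Y"
    if X: "X \<in> carrier (loc_module R T M)" and Y: "Y \<in> carrier (loc_module R T M)" for i X Y
  proof -
    obtain m t k where *: "m \<in> carrier M" "t \<in> T" "t \<in> \<A> k" "X = mfrac T M m t"
      using X by (rule loc_carrier_homogeneousE)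
    obtain n s l where **: "n \<in> carrier M" "s \<in> T" "s \<in> \<A> l" "Y = mfrac T M n s"
      using Y by (rule loc_carrier_homogeneousE)
    have "p i (X \<oplus>\<^bsub>loc_module R T M\<^esub> Y) =
        mfrac T M (hcomp M \<M> (i + (k + l)) (s \<odot>\<^bsub>M\<^esub> m \<oplus>\<^bsub>M\<^esub> t \<odot>\<^bsub>M\<^esub> n)) (t \<otimes> s)"
      using * ** p[of "s \<odot>\<^bsub>M\<^esub> m \<oplus>\<^bsub>M\<^esub> t \<odot>\<^bsub>M\<^esub> n" "t \<otimes> s" "k + l" i] graded_mult by (simp add: loc_add)
    also have "hcomp M \<M> (i + (k + l)) (s \<odot>\<^bsub>M\<^esub> m \<oplus>\<^bsub>M\<^esub> t \<odot>\<^bsub>M\<^esub> n) =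
        s \<odot>\<^bsub>M\<^esub> hcomp M \<M> (i + k) m \<oplus>\<^bsub>M\<^esub> t \<odot>\<^bsub>M\<^esub> hcomp M \<M> (i + l) n"
      using hcomp_smult[OF **(3) *(1), of "i + k"] hcomp_smult[OF *(3) **(1), of "i + l"] * **
      by (simp add: GM.hcomp_add ac_simps)
    finally show ?thesis using * ** by (simp add: p loc_add)
  qed
  have psame: "p i X = X" if "X \<in> grading i" for i X
    using that by (elim gradingE) (auto simp: p c)
  have pother: "p j X = \<zero>\<^bsub>loc_module R T M\<^esub>" if "X \<in> grading i" "i \<noteq> j" for i j X
    using that by (elim gradingE) (auto simp: p c GM.hcomp_other)
  have span: "carrier (loc_module R T M) \<subseteq> H"
    if H: "subgroup H (add_monoid (loc_module R T M))" "\<forall>i. grading i \<subseteq> H" for H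
  proof
    fix X assume "X \<in> carrier (loc_module R T M)"
    then obtain m t k where *: "m \<in> carrier M" "t \<in> T" "t \<in> \<A> k" "X = mfrac T M m t"
      by (rule loc_carrier_homogeneousE)
    \<comment> \<open>With the denominator \<open>t\<close> fixed, the admissible numerators form a
      subgroup of \<open>M\<close>. It contains each homogeneous \<open>m\<close>, since
      \<open>m/t\<close> is again homogeneous, of degree lower by \<open>k\<close>.\<close>
    let ?H = "{m \<in> carrier M. mfrac T M m t \<in> H}"
    have "subgroup ?H (add_monoid M)"
    proof (rule M.add.subgroupI)
      show "?H \<noteq> {}" using subgroup.one_closed[OF H(1)] *(2) by force
      fix x assume x: "x \<in> ?H"
      have "\<ominus>\<^bsub>loc_module R T M\<^esub> mfrac T M x t \<in> H"
        using subgroup.m_inv_closed[OF H(1), folded a_inv_def] x by blast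
      then show "\<ominus>\<^bsub>M\<^esub> x \<in> ?H" using x *(2) by (simp add: loc_minus)
      fix y assume y: "y \<in> ?H"
      have "mfrac T M x t \<oplus>\<^bsub>loc_module R T M\<^esub> mfrac T M y t \<in> H"
        using subgroup.m_closed[OF H(1), of "mfrac T M x t" "mfrac T M y t"] x y by simp
      then show "x \<oplus>\<^bsub>M\<^esub> y \<in> ?H" using x y *(2) by (simp add: loc_add_same)
    qed auto
    moreover have "\<M> i \<subseteq> ?H" for i
      using gradingI[of _ "i - k" k t] H(2) *(2,3) c by auto
    ultimately have "m \<in> ?H" using GM.homogeneous_span *(1) by blast
    then show "X \<in> H" using * by simp
  qed
  show ?thesis1
    by (rule L.graded_groupI(1)[where p = p]) (rule sub pD padd psame pother span; assumption)+
  have hc: "hcomp (loc_module R T M) grading i X = p i X" if "X \<in> carrier (loc_module R T M)" for i X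
    using _ _ _ _ _ _ that by (rule L.graded_groupI(2)[where p = p])
      (rule sub pD padd psame pother span; assumption)+
  show "hcomp (loc_module R T M) grading i (mfrac T M m t) = mfrac T M (hcomp M \<M> (i + k) m) t"
    if m: "m \<in> carrier M" "t \<in> T" "t \<in> \<A> k"
    using trans[OF hc[OF mfrac_carrier[OF m(1,2)]] p[OF m]] .
qed

lemma self_graded_localization: "graded_localization R \<A> (self_module R) \<A> T"
  by (intro graded_localization.intro self_module_graded_module self_localization
      graded_localization_axioms.intro denominators_homogeneous)

lemma loc_graded_ring: "graded_ring (loc_ring R T) (loc_grading \<A> T (self_module R) \<A>)"
proof -
  interpret S: graded_localization R \<A> "self_module R" \<A> T by (rule self_graded_localization)
  have "graded_group (loc_ring R T) S.grading"
    by (rule graded_group_cong[OF S.loc_graded_group]) (simp_all add: loc_ring_sel)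
  then have "direct_sum_decomposition (loc_ring R T) S.grading"
    by (rule graded_group.decomposition)
  moreover have "X \<otimes>\<^bsub>loc_ring R T\<^esub> Y \<in> S.grading (i + j)"
    if X: "X \<in> S.grading i" and Y: "Y \<in> S.grading j" for X Y i j
  proof -
    obtain a s k where *: "a \<in> \<A> (i + k)" "s \<in> T" "s \<in> \<A> k" "X = mfrac T (self_module R) a s"
      using X by (rule S.gradingE)
    obtain b t l where **: "b \<in> \<A> (j + l)" "t \<in> T" "t \<in> \<A> l" "Y = mfrac T (self_module R) b t"
      using Y by (rule S.gradingE)
    have "a \<otimes> b \<in> \<A> (i + j + (k + l))" using graded_mult[OF *(1) **(1)] by (simp add: ac_simps)
    then show ?thesis
      using * ** graded_mult GR.homogeneous_carrier S.loc_smult[of a b s t]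
      by (auto simp: loc_ring_sel intro!: S.gradingI)
  qed
  ultimately show ?thesis
    by (intro graded_ring.intro graded_ring_axioms.intro loc_ring_cring)
qed

lemma loc_graded_module:
  "graded_module (loc_ring R T) (loc_grading \<A> T (self_module R) \<A>) (loc_module R T M) grading"
proof (rule graded_moduleI[OF loc_graded_ring loc_module_module loc_graded_group])
  interpret S: graded_localization R \<A> "self_module R" \<A> T by (rule self_graded_localization)
  fix X Y i j assume X: "X \<in> S.grading i" and Y: "Y \<in> grading j"
  obtain a s k where *: "a \<in> \<A> (i + k)" "s \<in> T" "s \<in> \<A> k" "X = mfrac T (self_module R) a s"
    using X by (rule S.gradingE)
  obtain b t l where **: "b \<in> \<M> (j + l)" "t \<in> T" "t \<in> \<A> l" "Y = mfrac T M b t"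
    using Y by (rule gradingE)
  have "a \<odot>\<^bsub>M\<^esub> b \<in> \<M> (i + j + (k + l))" using graded_smult[OF *(1) **(1)] by (simp add: ac_simps)
  then show "X \<odot>\<^bsub>loc_module R T M\<^esub> Y \<in> grading (i + j)"
    using * ** graded_mult GR.homogeneous_carrier GM.homogeneous_carrier
    by (auto simp: loc_smult intro!: gradingI)
qed

section \<open>Extension and contraction of graded submodules\<close>

abbreviation "loc_graded_submodule \<equiv>
  graded_submodule (loc_ring R T) (loc_grading \<A> T (self_module R) \<A>) (loc_module R T M) grading"

lemmas loc_graded_submodule_iff = graded_module.graded_submodule_iff[OF loc_graded_module]

text \<open>Denominators are homogeneous, so the components of \<open>m/t\<close> are the components
  of \<open>m\<close> over the same \<open>t\<close>.\<close>

lemma frac_set_graded_submodule: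
  assumes "graded_submodule R \<A> M \<M> N"
  shows "loc_graded_submodule (frac_set T M N)"
  unfolding loc_graded_submodule_iff
proof (intro conjI ballI allI)
  have N: "submodule N R M" "\<And>x i. x \<in> N \<Longrightarrow> hcomp M \<M> i x \<in> N"
    using assms graded_submodule_iff by auto
  show "submodule (frac_set T M N) (loc_ring R T) (loc_module R T M)" by (rule frac_set_submodule[OF N(1)])
  fix X i assume "X \<in> frac_set T M N"
  then obtain m t k where "m \<in> N" "t \<in> T" "t \<in> \<A> k" "X = mfrac T M m t"
    using denominators_homogeneous unfolding frac_set_def by blast
  then show "hcomp (loc_module R T M) grading i X \<in> frac_set T M N"
    using hcomp_mfrac submodule_subset[OF N(1)] N(2) by (auto intro!: frac_setI)
qed

lemma numerators_graded_submodule: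
  assumes "loc_graded_submodule F"
  shows "graded_submodule R \<A> M \<M> (numerators R T M F)"
  unfolding graded_submodule_iff
proof (intro conjI ballI allI)
  have F: "submodule F (loc_ring R T) (loc_module R T M)"
    "\<And>X i. X \<in> F \<Longrightarrow> hcomp (loc_module R T M) grading i X \<in> F"
    using assms loc_graded_submodule_iff by auto
  show "submodule (numerators R T M F) R M" by (rule numerators_submodule[OF F(1)])
  fix x i assume "x \<in> numerators R T M F"
  then have x: "x \<in> carrier M" "mfrac T M x \<one> \<in> F" by (auto simp: numerators_def)
  then show "hcomp M \<M> i x \<in> numerators R T M F"
    using F(2)[OF x(2), of i] hcomp_mfrac[OF x(1) denominators_one one_homogeneous, of i]
    by (simp add: numerators_def)
qed

end

section \<open>Ideals and Noetherian modules\<close>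

text \<open>
  If neither \<open>a\<close> nor \<open>b\<close> is in \<open>I\<close>, take their components of largest degree outside \<open>I\<close>: modulo \<open>I\<close>,
  the product of these is the component of \<open>a b\<close> in the sum of the two degrees.
\<close>

lemma (in graded_ring) graded_primeidealI:
  assumes I: "ideal I R" and graded: "\<And>x i. x \<in> I \<Longrightarrow> hcomp R \<A> i x \<in> I" and one: "\<one> \<notin> I"
    and prime: "\<And>i j a b. a \<in> \<A> i \<Longrightarrow> b \<in> \<A> j \<Longrightarrow> a \<otimes> b \<in> I \<Longrightarrow> a \<in> I \<or> b \<in> I"
  shows "primeideal I R"
proof (rule primeidealI[OF I is_cring])
  interpret I: ideal I R by (rule I)
  interpret S: graded_module R \<A> "self_module R" \<A> by (rule self_module_graded_module)
  have hmult: "hcomp R \<A> (k + i) (a \<otimes> b) = a \<otimes> hcomp R \<A> i b" if "a \<in> \<A> k" "b \<in> carrier R" for a b k i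
    using S.hcomp_smult[of a k b i] that by (simp add: self_module_graded_module(2))
  have sub: "subgroup I (add_monoid R)" by (rule I.a_subgroup)
  show "carrier R \<noteq> I" using one by blast
  have top: "\<exists>i. hcomp R \<A> i a \<notin> I \<and> (\<forall>j>i. hcomp R \<A> j a \<in> I)" if a: "a \<in> carrier R" "a \<notin> I" for a
  proof -
    let ?D = "{i. hcomp R \<A> i a \<notin> I}"
    have "?D \<subseteq> {i. hcomp R \<A> i a \<noteq> \<zero>}" using I.zero_closed by auto
    then have fin: "finite ?D" using GR.finite_hcomp[OF a(1)] rev_finite_subset by blast
    have ne: "?D \<noteq> {}" using GR.mem_subgroup_of_hcomp[OF sub a(1)] a(2) by blast
    show ?thesis using Max_in[OF fin ne] Max_ge[OF fin] by (intro exI[of _ "Max ?D"]) force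
  qed
  fix a b assume ab: "a \<in> carrier R" "b \<in> carrier R" "a \<otimes> b \<in> I"
  show "a \<in> I \<or> b \<in> I"
  proof (rule ccontr)
    assume "\<not> (a \<in> I \<or> b \<in> I)"
    then obtain i0 j0 where i0: "hcomp R \<A> i0 a \<notin> I" "\<And>j. j > i0 \<Longrightarrow> hcomp R \<A> j a \<in> I"
      and j0: "hcomp R \<A> j0 b \<notin> I" "\<And>j. j > j0 \<Longrightarrow> hcomp R \<A> j b \<in> I"
      using top ab by metis
    define a0 where "a0 = hcomp R \<A> i0 a"
    have a0: "a0 \<in> \<A> i0" "a0 \<in> carrier R" using ab by (auto simp: a0_def)
    \<comment> \<open>\<open>r\<close> is \<open>a\<close> without its leading component modulo
      \<open>I\<close>, so all components of \<open>r\<close> in degrees at least \<open>i0\<close>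
      lie in \<open>I\<close>.\<close>
    define r where "r = a \<oplus> \<ominus> a0"
    have r: "r \<in> carrier R" using ab a0 by (simp add: r_def)
    have rI: "hcomp R \<A> j r \<in> I" if "j \<ge> i0" for j
    proof (cases "j = i0")
      case True
      then show ?thesis
        using ab a0 by (simp add: r_def GR.hcomp_add GR.hcomp_minus) (simp add: a0_def r_neg ab)
    next
      case False
      then have "hcomp R \<A> j a0 = \<zero>" using GR.hcomp_other[OF a0(1), of j] by auto
      then show ?thesis using False that i0(2)[of j] ab a0
        by (simp add: r_def GR.hcomp_add GR.hcomp_minus)
    qed
    \<comment> \<open>The aim is that \<open>r\<close> contributes nothing modulo \<open>I\<close>
      to the product in degree \<open>i0 + j0\<close>. For a component of \<open>r\<close> of degree
      \<open>j \<ge> i0\<close> that component is in \<open>I\<close>; for \<open>j < i0\<close> it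
      meets the component of \<open>b\<close> of degree \<open>i0 + j0 - j > j0\<close>, which is in
      \<open>I\<close>.\<close>
    let ?H = "{c \<in> carrier R. hcomp R \<A> (i0 + j0) (c \<otimes> b) \<in> I}"
    have "subgroup ?H (add_monoid R)"
    proof (rule add.subgroupI)
      show "?H \<noteq> {}" using ab by (auto intro!: exI[of _ \<zero>])
    qed (use ab in \<open>auto simp: l_distr l_minus GR.hcomp_add GR.hcomp_minus simp flip: a_inv_def\<close>)
    moreover have "hcomp R \<A> j r \<in> ?H" for j
    proof -
      have eq: "hcomp R \<A> (i0 + j0) (hcomp R \<A> j r \<otimes> b) = hcomp R \<A> j r \<otimes> hcomp R \<A> (i0 + j0 - j) b"
        using hmult[of "hcomp R \<A> j r" j b "i0 + j0 - j"] r ab by simp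
      have "hcomp R \<A> j r \<otimes> hcomp R \<A> (i0 + j0 - j) b \<in> I"
      proof (cases "j \<ge> i0")
        case True
        then show ?thesis using rI[of j] ab by (simp add: I.I_r_closed)
      next
        case False
        then show ?thesis using j0(2)[of "i0 + j0 - j"] r by (simp add: I.I_l_closed)
      qed
      then show ?thesis using r eq by simp
    qed
    ultimately have "r \<in> ?H" using GR.mem_subgroup_of_hcomp r by blast
    moreover have "hcomp R \<A> (i0 + j0) (a \<otimes> b) \<in> I" using graded ab by blast
    moreover have "a = a0 \<oplus> r" using ab a0 by (simp add: r_def a_lcomm[of a0] r_neg)
    ultimately have sum: "hcomp R \<A> (i0 + j0) (a0 \<otimes> b) \<oplus> hcomp R \<A> (i0 + j0) (r \<otimes> b) \<in> I"
      and rH: "hcomp R \<A> (i0 + j0) (r \<otimes> b) \<in> I"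
      using ab a0 r by (auto simp: l_distr GR.hcomp_add)
    have "hcomp R \<A> (i0 + j0) (a0 \<otimes> b) \<in> I"
      using I.a_closed[OF sum I.a_inv_closed[OF rH]] ab a0 r by (simp add: a_assoc r_neg)
    then have "a0 \<otimes> hcomp R \<A> j0 b \<in> I" using hmult a0 ab by simp
    then show False using prime[OF a0(1) GR.hcomp_homogeneous[OF ab(2)]] i0(1) j0(1) by (auto simp: a0_def)
  qed
qed

text \<open>A non-empty chain of ideals contains its union, so Zorn's lemma applies to any non-empty
  family.\<close>

lemma (in noetherian_ring) maximal_ideal_of_family:
  assumes "\<C> \<noteq> {}" "\<And>I. I \<in> \<C> \<Longrightarrow> ideal I R"
  shows "\<exists>I\<in>\<C>. \<forall>J\<in>\<C>. I \<subseteq> J \<longrightarrow> J = I"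
proof (rule subset_Zorn_nonempty[OF assms(1)])
  fix C assume C: "C \<noteq> {}" "subset.chain \<C> C"
  from C(2) have sub: "C \<subseteq> \<C>" and lin: "\<And>I J. I \<in> C \<Longrightarrow> J \<in> C \<Longrightarrow> I \<subseteq> J \<or> J \<subseteq> I"
    by (auto simp: subset_chain_def)
  have "subset.chain {I. ideal I R} C"
    unfolding subset_chain_def using sub lin assms(2) by blast
  from ideal_chain_is_trivial[OF C(1) this] show "\<Union>C \<in> \<C>" using sub by blast
qed

section \<open>Colon ideals and the Noetherian property of finitely generated modules\<close>

context module
begin

text \<open>The annihilator of the class of \<open>x\<close> in \<open>M / N\<close>, written
  \<open>(N : x)\<close> in the overview.\<close>

definition colon :: "'c set \<Rightarrow> 'c \<Rightarrow> 'a set" where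
  "colon N x = {a \<in> carrier R. a \<odot>\<^bsub>M\<^esub> x \<in> N}"

lemma colon_ideal:
  assumes N: "submodule N R M" and x: "x \<in> carrier M"
  shows "ideal (colon N x) R"
proof (rule idealI[OF R.ring_axioms])
  show "subgroup (colon N x) (add_monoid R)"
  proof (rule R.add.subgroupI)
    have "\<zero> \<in> colon N x" using submodule_zero[OF N] x by (simp add: colon_def)
    then show "colon N x \<noteq> {}" by blast
  qed (use x submodule_add[OF N] submodule_minus[OF N] in
      \<open>auto simp: colon_def smult_l_distr smult_l_minus simp flip: a_inv_def\<close>)
  fix a b assume "a \<in> colon N x" "b \<in> carrier R"
  then show "b \<otimes> a \<in> colon N x" using x submodule_smult[OF N] by (simp add: colon_def smult_assoc1)
  then show "a \<otimes> b \<in> colon N x" using \<open>a \<in> colon N x\<close> \<open>b \<in> carrier R\<close> by (simp add: colon_def R.m_comm)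
qed

lemma cyclic_submodule:
  assumes "x \<in> carrier M"
  shows "submodule {a \<odot>\<^bsub>M\<^esub> x | a. a \<in> carrier R} R M" and "x \<in> {a \<odot>\<^bsub>M\<^esub> x | a. a \<in> carrier R}"
proof -
  show "x \<in> {a \<odot>\<^bsub>M\<^esub> x | a. a \<in> carrier R}"
    by (intro CollectI exI[of _ \<one>]) (use assms in simp)
  show "submodule {a \<odot>\<^bsub>M\<^esub> x | a. a \<in> carrier R} R M"
    unfolding submodule_iff
  proof (intro conjI ballI)
    show "\<zero>\<^bsub>M\<^esub> \<in> {a \<odot>\<^bsub>M\<^esub> x | a. a \<in> carrier R}"
      by (intro CollectI exI[of _ \<zero>]) (use assms in simp)
  next
    fix y z assume "y \<in> {a \<odot>\<^bsub>M\<^esub> x | a. a \<in> carrier R}" "z \<in> {a \<odot>\<^bsub>M\<^esub> x | a. a \<in> carrier R}"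
    then obtain a b where "y = a \<odot>\<^bsub>M\<^esub> x" "z = b \<odot>\<^bsub>M\<^esub> x" "a \<in> carrier R" "b \<in> carrier R" by blast
    then show "y \<oplus>\<^bsub>M\<^esub> z \<in> {a \<odot>\<^bsub>M\<^esub> x | a. a \<in> carrier R}"
      using assms by (auto intro!: exI[of _ "a \<oplus> b"] simp: smult_l_distr)
  next
    fix c y assume c: "c \<in> carrier R" and "y \<in> {a \<odot>\<^bsub>M\<^esub> x | a. a \<in> carrier R}"
    then obtain a where "y = a \<odot>\<^bsub>M\<^esub> x" "a \<in> carrier R" by blast
    then show "c \<odot>\<^bsub>M\<^esub> y \<in> {a \<odot>\<^bsub>M\<^esub> x | a. a \<in> carrier R}"
      using c assms by (auto intro!: exI[of _ "c \<otimes> a"] simp: smult_assoc1)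
  qed (use assms in auto)
qed

lemma gen_submodule_submodule:
  assumes "S \<subseteq> carrier M"
  shows "submodule (gen_submodule R M S) R M"
  unfolding submodule_iff
proof (intro conjI ballI)
  show "gen_submodule R M S \<subseteq> carrier M"
    using carrier_is_submodule assms unfolding gen_submodule_def by blast
qed (auto simp: gen_submodule_def submodule_iff)

lemma gen_submodule_minimal: "submodule N R M \<Longrightarrow> S \<subseteq> N \<Longrightarrow> gen_submodule R M S \<subseteq> N"
  by (auto simp: gen_submodule_def)

lemma gen_submodule_superset: "S \<subseteq> gen_submodule R M S"
  by (auto simp: gen_submodule_def)

text \<open>Induction on the generators. Within the span of \<open>x\<close> and \<open>S\<close>, a
  member \<open>N\<close> of the chain is controlled by its part in the span of \<open>S\<close> and
  by the ideal of coefficients at \<open>x\<close>. The former is bounded by induction, the latter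
  because the ring is Noetherian, and the larger of the two bounding members serves for
  both.\<close>

lemma submodule_chain_stationary_on:
  assumes R: "noetherian_ring R" and C: "C \<noteq> {}" "subset.chain {N. submodule N R M} C"
    and S: "finite S" "S \<subseteq> carrier M"
  shows "\<exists>N0\<in>C. \<forall>N\<in>C. N \<inter> gen_submodule R M S \<subseteq> N0"
  using S
proof (induct S)
  case empty
  have "submodule {\<zero>\<^bsub>M\<^esub>} R M" by (auto simp: submodule_iff)
  then have "gen_submodule R M {} \<subseteq> {\<zero>\<^bsub>M\<^esub>}" by (intro gen_submodule_minimal) auto
  moreover obtain N0 where N0: "N0 \<in> C" using C by blast
  moreover have "\<zero>\<^bsub>M\<^esub> \<in> N0"
    using C(2) N0 by (intro submodule_zero) (auto simp: subset_chain_def)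
  ultimately show ?case by blast
next
  case (insert x S)
  have Cs: "submodule N R M" if "N \<in> C" for N using C(2) that by (auto simp: subset_chain_def)
  have Ct: "N \<subseteq> N' \<or> N' \<subseteq> N" if "N \<in> C" "N' \<in> C" for N N'
    using C(2) that by (auto simp: subset_chain_def)
  obtain N0 where N0: "N0 \<in> C" "\<And>N. N \<in> C \<Longrightarrow> N \<inter> gen_submodule R M S \<subseteq> N0"
    using insert by auto
  have x: "x \<in> carrier M" using insert by simp
  have G: "submodule (gen_submodule R M S) R M" using insert by (intro gen_submodule_submodule) auto
  \<comment> \<open>The coefficients at \<open>x\<close> of elements of \<open>N\<close>, modulo the
    span of \<open>S\<close>. This is the colon ideal of \<open>x\<close> with respect to the sum of
    \<open>N\<close> and that span, hence an ideal.\<close>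
  define lead where "lead N = {a \<in> carrier R. \<exists>m\<in>gen_submodule R M S. a \<odot>\<^bsub>M\<^esub> x \<oplus>\<^bsub>M\<^esub> m \<in> N}" for N
  have lead_ideal: "ideal (lead N) R" if N: "submodule N R M" for N
  proof -
    let ?NG = "{h \<oplus>\<^bsub>M\<^esub> k | h k. h \<in> N \<and> k \<in> gen_submodule R M S}"
    have "lead N = colon ?NG x"
    proof (rule equalityI; rule subsetI)
      fix a assume "a \<in> lead N"
      then obtain m where a: "a \<in> carrier R" "m \<in> gen_submodule R M S" "a \<odot>\<^bsub>M\<^esub> x \<oplus>\<^bsub>M\<^esub> m \<in> N"
        by (auto simp: lead_def)
      then have "a \<odot>\<^bsub>M\<^esub> x = (a \<odot>\<^bsub>M\<^esub> x \<oplus>\<^bsub>M\<^esub> m) \<oplus>\<^bsub>M\<^esub> \<ominus>\<^bsub>M\<^esub> m"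
        using x submodule_subset[OF G] by (simp add: M.a_assoc M.r_neg)
      then show "a \<in> colon ?NG x" using a submodule_minus[OF G] unfolding colon_def by blast
    next
      fix a assume "a \<in> colon ?NG x"
      then obtain h k where a: "a \<in> carrier R" "a \<odot>\<^bsub>M\<^esub> x = h \<oplus>\<^bsub>M\<^esub> k" "h \<in> N" "k \<in> gen_submodule R M S"
        by (auto simp: colon_def)
      then have "a \<odot>\<^bsub>M\<^esub> x \<oplus>\<^bsub>M\<^esub> \<ominus>\<^bsub>M\<^esub> k = h"
        using submodule_subset[OF G] submodule_subset[OF N] by (simp add: M.a_assoc M.r_neg)
      then show "a \<in> lead N" using a submodule_minus[OF G] unfolding lead_def by blast
    qed
    then show ?thesis using colon_ideal submodule_sum(1)[OF N G] x by simp
  qed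
  have lead_mono: "N \<subseteq> N' \<Longrightarrow> lead N \<subseteq> lead N'" for N N' by (auto simp: lead_def)
  obtain N1 where N1: "N1 \<in> C" "\<And>N. N \<in> C \<Longrightarrow> lead N \<subseteq> lead N1"
  proof -
    have "\<exists>I\<in>lead ` C. \<forall>J\<in>lead ` C. I \<subseteq> J \<longrightarrow> J = I"
      by (rule noetherian_ring.maximal_ideal_of_family[OF R]) (use C(1) lead_ideal Cs in auto)
    then obtain N1 where "N1 \<in> C" "\<And>N. N \<in> C \<Longrightarrow> lead N1 \<subseteq> lead N \<Longrightarrow> lead N = lead N1" by blast
    then show ?thesis using Ct lead_mono that by (metis order_refl)
  qed
  obtain N2 where N2: "N2 \<in> C" "N0 \<subseteq> N2" "N1 \<subseteq> N2" using Ct[OF N0(1) N1(1)] N0(1) N1(1) by blast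
  have "N \<inter> gen_submodule R M (insert x S) \<subseteq> N2" if N: "N \<in> C" for N
  proof (cases "N \<subseteq> N2")
    case False
    then have N2N: "N2 \<subseteq> N" using Ct N N2(1) by blast
    let ?X = "{a \<odot>\<^bsub>M\<^esub> x | a. a \<in> carrier R}"
    let ?XG = "{h \<oplus>\<^bsub>M\<^esub> k | h k. h \<in> ?X \<and> k \<in> gen_submodule R M S}"
    note XG = submodule_sum[OF cyclic_submodule(1)[OF x] G]
    have "gen_submodule R M (insert x S) \<subseteq> ?XG"
      using XG cyclic_submodule(2)[OF x] gen_submodule_superset[of S]
      by (intro gen_submodule_minimal) blast+
    moreover have "y \<in> N2" if y: "y \<in> N" "y \<in> ?XG" for y
    proof -
      obtain a k where a: "a \<in> carrier R" "k \<in> gen_submodule R M S" "y = a \<odot>\<^bsub>M\<^esub> x \<oplus>\<^bsub>M\<^esub> k"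
        using y(2) by blast
      then have "a \<in> lead N" using y by (auto simp: lead_def)
      then have "a \<in> lead N2" using N1(2)[OF N] lead_mono[OF N2(3)] by blast
      then obtain m where m: "m \<in> gen_submodule R M S" "a \<odot>\<^bsub>M\<^esub> x \<oplus>\<^bsub>M\<^esub> m \<in> N2"
        by (auto simp: lead_def)
      have c: "k \<in> carrier M" "m \<in> carrier M" using submodule_subset[OF G] a m by auto
      \<comment> \<open>Subtracting from \<open>y\<close> an element of \<open>N2\<close> with the
        same coefficient at \<open>x\<close> leaves an element of \<open>N\<close> in the span of
        \<open>S\<close>, where \<open>N0\<close> is already a bound.\<close>
      have eq: "k \<ominus>\<^bsub>M\<^esub> m = y \<ominus>\<^bsub>M\<^esub> (a \<odot>\<^bsub>M\<^esub> x \<oplus>\<^bsub>M\<^esub> m)"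
        using a(1,3) c x by (simp add: a_minus_def M.minus_add M.a_ac M.r_neg M.r_neg1 M.r_neg2)
      have "k \<ominus>\<^bsub>M\<^esub> m \<in> N"
        unfolding eq using submodule_diff[OF Cs[OF N]] y(1) m(2) N2N by blast
      then have "k \<ominus>\<^bsub>M\<^esub> m \<in> N2" using N0(2)[OF N] submodule_diff[OF G a(2) m(1)] N2(2) by blast
      then have "(k \<ominus>\<^bsub>M\<^esub> m) \<oplus>\<^bsub>M\<^esub> (a \<odot>\<^bsub>M\<^esub> x \<oplus>\<^bsub>M\<^esub> m) \<in> N2"
        using submodule_add[OF Cs[OF N2(1)]] m(2) by blast
      moreover have "(k \<ominus>\<^bsub>M\<^esub> m) \<oplus>\<^bsub>M\<^esub> (a \<odot>\<^bsub>M\<^esub> x \<oplus>\<^bsub>M\<^esub> m) = y"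
        using a(1,3) c x by (simp add: a_minus_def M.a_ac M.r_neg M.r_neg1 M.r_neg2)
      ultimately show ?thesis by simp
    qed
    ultimately show ?thesis by blast
  qed auto
  then show ?case using N2(1) by blast
qed

lemma maximal_submodule_of_family:
  assumes R: "noetherian_ring R" and fg: "finitely_generated R M"
    and ne: "\<C> \<noteq> {}" and sub: "\<And>N. N \<in> \<C> \<Longrightarrow> submodule N R M"
  shows "\<exists>N\<in>\<C>. \<forall>K\<in>\<C>. N \<subseteq> K \<longrightarrow> K = N"
proof (rule subset_Zorn_nonempty[OF ne])
  fix C assume C: "C \<noteq> {}" "subset.chain \<C> C"
  obtain S where S: "S \<subseteq> carrier M" "finite S" "carrier M = gen_submodule R M S"
    using fg by (auto simp: finitely_generated_def)
  have "subset.chain {N. submodule N R M} C" using C sub by (auto simp: subset_chain_def)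
  from submodule_chain_stationary_on[OF R C(1) this S(2,1)]
  obtain N0 where N0: "N0 \<in> C" "\<And>N. N \<in> C \<Longrightarrow> N \<inter> carrier M \<subseteq> N0" unfolding S(3)[symmetric] by blast
  have "N \<subseteq> N0" if "N \<in> C" for N
  proof -
    have "submodule N R M" using C that sub by (auto simp: subset_chain_def)
    then show ?thesis using N0(2)[OF that] submodule_subset by blast
  qed
  then have "\<Union>C = N0" using N0(1) by blast
  then show "\<Union>C \<in> \<C>" using N0(1) C(2) by (auto simp: subset_chain_def)
qed

end

section \<open>Minimal primes over the annihilator\<close>

locale minimal_prime_of_graded_module = graded_module R \<A> M \<M>
  for R :: "('a, 'r) ring_scheme" (structure) and \<A> :: "int \<Rightarrow> 'a set"
    and M :: "('a, 'b, 'm) module_scheme" (structure) and \<M> :: "int \<Rightarrow> 'b set" +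
  fixes P :: "'a set"
  assumes noetherian: "noetherian_ring R" and fg: "finitely_generated R M"
    and minimal_prime: "minimal_prime_over R (annihilator R M) P"
begin

abbreviation "T \<equiv> homog_compl \<A> P"

lemma prime: "primeideal P R"
  using minimal_prime by (simp add: minimal_prime_over_def)

sublocale P: primeideal P R by (rule prime)

lemma one_notin_prime: "\<one> \<notin> P"
  using P.I_notcarr P.one_imp_carrier by blast

lemma mem_homog_compl_iff: "t \<in> T \<longleftrightarrow> (\<exists>i. t \<in> \<A> i) \<and> t \<notin> P"
  by (auto simp: homog_compl_def)

lemma homog_compl_subset: "T \<subseteq> carrier R - P"
  using GR.homogeneous_carrier by (auto simp: homog_compl_def)

sublocale T: graded_localization R \<A> M \<M> T
proof unfold_locales
  show "T \<subseteq> carrier R" using homog_compl_subset by blast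
  show "\<one> \<in> T" using one_homogeneous one_notin_prime by (auto simp: mem_homog_compl_iff)
  show "s \<otimes> t \<in> T" if "s \<in> T" "t \<in> T" for s t
    using that graded_mult P.I_prime GR.homogeneous_carrier unfolding mem_homog_compl_iff by blast
qed (auto simp: homog_compl_def)

sublocale S: localization R M "carrier R - P"
  by unfold_locales (use one_notin_prime P.I_prime in auto)

text \<open>For submodules this says that \<open>M / N\<close> has no \<open>T\<close>-torsion.
  Contractions from the localization at \<open>T\<close> have this property.\<close>

definition saturated :: "'b set \<Rightarrow> bool" where
  "saturated N \<longleftrightarrow> (\<forall>t\<in>T. \<forall>m\<in>carrier M. t \<odot>\<^bsub>M\<^esub> m \<in> N \<longrightarrow> m \<in> N)"

lemma saturatedD: "saturated N \<Longrightarrow> t \<in> T \<Longrightarrow> m \<in> carrier M \<Longrightarrow> t \<odot>\<^bsub>M\<^esub> m \<in> N \<Longrightarrow> m \<in> N"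
  by (auto simp: saturated_def)

text \<open>\<open>N' / N\<close> becomes a shifted copy of \<open>A / P\<close> after inverting \<open>T\<close>, with generator the class of \<open>x\<close>.\<close>

definition prime_step :: "'b set \<Rightarrow> 'b set \<Rightarrow> bool" where
  "prime_step N N' \<longleftrightarrow>
     graded_submodule R \<A> M \<M> N \<and> graded_submodule R \<A> M \<M> N' \<and> saturated N \<and> saturated N' \<and> N \<subseteq> N' \<and>
     (\<exists>d. \<exists>x\<in>\<M> d \<inter> N'. colon N x = P \<and>
        (\<forall>y\<in>N'. \<exists>t\<in>T. \<exists>a\<in>carrier R. t \<odot>\<^bsub>M\<^esub> y \<ominus>\<^bsub>M\<^esub> a \<odot>\<^bsub>M\<^esub> x \<in> N))"

text \<open>Minimality of \<open>P\<close> enters only here.\<close>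

lemma graded_ideal_eq_prime:
  assumes I: "ideal I R" and graded: "\<And>x i. x \<in> I \<Longrightarrow> hcomp R \<A> i x \<in> I"
    and ann: "annihilator R M \<subseteq> I" and disj: "T \<inter> I = {}"
    and pr: "\<And>i j a b. a \<in> \<A> i \<Longrightarrow> b \<in> \<A> j \<Longrightarrow> a \<otimes> b \<in> I \<Longrightarrow> a \<in> I \<or> b \<in> I"
  shows "I = P"
proof -
  have "primeideal I R"
  proof (rule graded_primeidealI[OF I])
    show "\<one> \<notin> I" using disj T.denominators_one by blast
  qed (rule graded pr; assumption)+
  moreover have "I \<subseteq> P"
  proof
    fix a assume a: "a \<in> I"
    then have ac: "a \<in> carrier R" using ideal.Icarr[OF I] by blast
    have "hcomp R \<A> i a \<in> P" for i
      using graded[OF a, of i] disj GR.hcomp_homogeneous[OF ac, of i]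
      unfolding mem_homog_compl_iff[symmetric] by (auto simp: homog_compl_def)
    then show "a \<in> P" using GR.mem_subgroup_of_hcomp[OF P.a_subgroup ac] by blast
  qed
  ultimately show ?thesis using minimal_prime ann by (auto simp: minimal_prime_over_def)
qed

text \<open>The ideal is graded because \<open>x\<close> is homogeneous, contains the annihilator of
  \<open>M\<close>, and misses \<open>T\<close> because \<open>N\<close> is saturated and
  \<open>x \<notin> N\<close>. Only primality on homogeneous elements is left to the two
  applications, which obtain it from *simplicity and from maximality.\<close>

lemma colon_eq_prime:
  assumes gN: "graded_submodule R \<A> M \<M> N" and sat: "saturated N" and x: "x \<in> \<M> d" "x \<notin> N"
    and pr: "\<And>i j a b. a \<in> \<A> i \<Longrightarrow> b \<in> \<A> j \<Longrightarrow> a \<otimes> b \<in> colon N x \<Longrightarrow> a \<in> colon N x \<or> b \<in> colon N x"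
  shows "colon N x = P"
proof (rule graded_ideal_eq_prime)
  have N: "submodule N R M" "\<And>x i. x \<in> N \<Longrightarrow> hcomp M \<M> i x \<in> N"
    using gN graded_submodule_iff by auto
  have xc: "x \<in> carrier M" using x GM.homogeneous_carrier by blast
  show "ideal (colon N x) R" by (rule colon_ideal[OF N(1) xc])
  show "hcomp R \<A> i a \<in> colon N x" if "a \<in> colon N x" for a i
    using N(2)[of "a \<odot>\<^bsub>M\<^esub> x" "i + d"] hcomp_smult_homogeneous[OF _ x(1), of a i] that
    by (auto simp: colon_def)
  show "annihilator R M \<subseteq> colon N x"
    using submodule_zero[OF N(1)] xc by (auto simp: annihilator_def colon_def)
  show "T \<inter> colon N x = {}"
    using saturatedD[OF sat _ xc] x(2) by (auto simp: colon_def)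
qed (rule pr)

section \<open>Localizing a prime step\<close>

context
  fixes N N' assumes step: "prime_step N N'"
begin

lemma prime_step_submodules:
  "submodule N R M" "submodule N' R M" "N \<subseteq> N'" "saturated N" "saturated N'"
  using step graded_submodule_iff by (auto simp: prime_step_def)

text \<open>The witness is \<open>x/1\<close>: it lies in the extension of \<open>N\<close> only if
  some \<open>u \<in> U\<close> lies in \<open>(N : x) = P\<close>. The set \<open>U\<close> is left
  general so that both localizations are covered.\<close>

lemma frac_set_strict:
  assumes U: "localization R M U" "U \<inter> P = {}"
  shows "frac_set U M N \<subset> frac_set U M N'"
proof -
  interpret U: localization R M U by (rule U(1))
  obtain d x where x: "x \<in> \<M> d" "x \<in> N'" "colon N x = P" using step by (auto simp: prime_step_def)
  have xc: "x \<in> carrier M" using submodule_subset[OF prime_step_submodules(2) x(2)] .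
  have "u \<odot>\<^bsub>M\<^esub> x \<notin> N" if "u \<in> U" for u
  proof
    assume "u \<odot>\<^bsub>M\<^esub> x \<in> N"
    then have "u \<in> colon N x" using U.denominators_carrier[OF that] by (simp add: colon_def)
    then show False using x(3) that U(2) by blast
  qed
  then have "\<not> (\<exists>u\<in>U. u \<odot>\<^bsub>M\<^esub> x \<in> N)" by blast
  then have "mfrac U M x \<one> \<notin> frac_set U M N"
    using U.mem_frac_set_iff[OF prime_step_submodules(1) xc U.denominators_one] by blast
  moreover have "mfrac U M x \<one> \<in> frac_set U M N'" using x(2) U.denominators_one by (rule frac_setI)
  ultimately show ?thesis using frac_set_mono[OF prime_step_submodules(3), of U M] by blast
qed

text \<open>Modulo \<open>N\<close>, the element \<open>y\<close> of the contraction of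
  \<open>K\<close> satisfies \<open>t y = a x\<close>, and \<open>a\<close> becomes a unit. Hence
  \<open>x\<close> lies in the contraction as well, and \<open>x\<close> generates \<open>N'\<close>
  modulo \<open>N\<close> up to denominators. This is shared by the two simplicity proofs, with
  \<open>U\<close> either set of denominators.\<close>

lemma frac_set_subset_of_generator:
  assumes U: "localization R M U" "T \<subseteq> U"
    and K: "submodule K (loc_ring R U) (loc_module R U M)" "frac_set U M N \<subseteq> K"
    and y: "y \<in> numerators R U M K" and x: "x \<in> carrier M"
      "\<And>z. z \<in> N' \<Longrightarrow> \<exists>t\<in>T. \<exists>a\<in>carrier R. t \<odot>\<^bsub>M\<^esub> z \<ominus>\<^bsub>M\<^esub> a \<odot>\<^bsub>M\<^esub> x \<in> N"
    and a: "t \<in> T" "a \<in> U" "t \<odot>\<^bsub>M\<^esub> y \<ominus>\<^bsub>M\<^esub> a \<odot>\<^bsub>M\<^esub> x \<in> N"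
  shows "frac_set U M N' \<subseteq> K"
proof -
  interpret U: localization R M U by (rule U(1))
  let ?K = "numerators R U M K"
  have K': "submodule ?K R M" by (rule U.numerators_submodule[OF K(1)])
  have N: "n \<in> ?K" if "n \<in> N" for n
    using frac_setI[OF that U.denominators_one] K(2) submodule_subset[OF prime_step_submodules(1) that]
    by (auto simp: numerators_def)
  have yc: "y \<in> carrier M" using submodule_subset[OF K' y] .
  have tc: "t \<in> carrier R" if "t \<in> T" for t using that by simp
  have "t \<odot>\<^bsub>M\<^esub> y \<ominus>\<^bsub>M\<^esub> (t \<odot>\<^bsub>M\<^esub> y \<ominus>\<^bsub>M\<^esub> a \<odot>\<^bsub>M\<^esub> x) \<in> ?K"
    using N[OF a(3)] submodule_smult[OF K' tc[OF a(1)] y] submodule_diff[OF K'] by blast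
  moreover have "t \<odot>\<^bsub>M\<^esub> y \<ominus>\<^bsub>M\<^esub> (t \<odot>\<^bsub>M\<^esub> y \<ominus>\<^bsub>M\<^esub> a \<odot>\<^bsub>M\<^esub> x) = a \<odot>\<^bsub>M\<^esub> x"
    using yc tc[OF a(1)] a(2) x(1) by (simp add: a_minus_def M.minus_add M.r_neg2)
  ultimately have "a \<odot>\<^bsub>M\<^esub> x \<in> ?K" by simp
  then have xK: "x \<in> ?K" using U.numerators_saturated[OF K(1) a(2) x(1)] by blast
  have "N' \<subseteq> ?K"
  proof
    fix z assume z: "z \<in> N'"
    then obtain t a where t: "t \<in> T" "a \<in> carrier R" "t \<odot>\<^bsub>M\<^esub> z \<ominus>\<^bsub>M\<^esub> a \<odot>\<^bsub>M\<^esub> x \<in> N" using x(2) by blast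
    have zc: "z \<in> carrier M" using submodule_subset[OF prime_step_submodules(2) z] .
    have "(t \<odot>\<^bsub>M\<^esub> z \<ominus>\<^bsub>M\<^esub> a \<odot>\<^bsub>M\<^esub> x) \<oplus>\<^bsub>M\<^esub> a \<odot>\<^bsub>M\<^esub> x \<in> ?K"
      using N[OF t(3)] submodule_smult[OF K' t(2) xK] submodule_add[OF K'] by blast
    moreover have "(t \<odot>\<^bsub>M\<^esub> z \<ominus>\<^bsub>M\<^esub> a \<odot>\<^bsub>M\<^esub> x) \<oplus>\<^bsub>M\<^esub> a \<odot>\<^bsub>M\<^esub> x = t \<odot>\<^bsub>M\<^esub> z"
      using zc tc[OF t(1)] t(2) x(1) by (simp add: a_minus_def M.a_assoc M.l_neg)
    ultimately show "z \<in> ?K" using U.numerators_saturated[OF K(1) _ zc] t(1) U(2) by auto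
  qed
  then have "frac_set U M N' \<subseteq> frac_set U M ?K" by (rule frac_set_mono)
  then show ?thesis using U.frac_set_numerators[OF K(1)] by simp
qed

text \<open>If some \<open>y\<close> in the contraction of \<open>K\<close> had a coefficient at
  \<open>x\<close> outside \<open>P\<close>, that coefficient would be a unit and \<open>K\<close>
  would be everything. So all these coefficients lie in \<open>P = (N : x)\<close>, and then
  \<open>t y \<in> N\<close>.\<close>

lemma prime_step_localized_simple:
  assumes K: "submodule K (prime_loc_ring R P) (prime_loc_module R P M)"
    "frac_set (carrier R - P) M N \<subseteq> K" "K \<subseteq> frac_set (carrier R - P) M N'"
  shows "K = frac_set (carrier R - P) M N \<or> K = frac_set (carrier R - P) M N'"
proof (rule disjCI)
  assume ne: "K \<noteq> frac_set (carrier R - P) M N'"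
  obtain d x where x: "x \<in> \<M> d" "x \<in> N'" "colon N x = P"
    "\<And>y. y \<in> N' \<Longrightarrow> \<exists>t\<in>T. \<exists>a\<in>carrier R. t \<odot>\<^bsub>M\<^esub> y \<ominus>\<^bsub>M\<^esub> a \<odot>\<^bsub>M\<^esub> x \<in> N"
    using step unfolding prime_step_def by blast
  note N = prime_step_submodules
  have xc: "x \<in> carrier M" using submodule_subset[OF N(2) x(2)] .
  have "X \<in> frac_set (carrier R - P) M N" if X: "X \<in> K" for X
  proof -
    obtain y s where y: "y \<in> N'" "s \<in> carrier R - P" "X = mfrac (carrier R - P) M y s"
      using X K(3) unfolding frac_set_def by blast
    have yc: "y \<in> carrier M" using submodule_subset[OF N(2) y(1)] .
    have yK: "y \<in> numerators R (carrier R - P) M K"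
      using X y S.mfrac_mem_submodule_iff[OF K(1) yc y(2)] by blast
    obtain t a where t: "t \<in> T" "a \<in> carrier R" "t \<odot>\<^bsub>M\<^esub> y \<ominus>\<^bsub>M\<^esub> a \<odot>\<^bsub>M\<^esub> x \<in> N"
      using x(4)[OF y(1)] by blast
    have "\<not> a \<in> carrier R - P"
      using frac_set_subset_of_generator[OF S.localization_axioms homog_compl_subset K(1,2) yK xc x(4) t(1) _ t(3)]
        ne K(3) by blast
    then have "a \<odot>\<^bsub>M\<^esub> x \<in> N" using t(2) x(3) by (auto simp: colon_def)
    then have "(t \<odot>\<^bsub>M\<^esub> y \<ominus>\<^bsub>M\<^esub> a \<odot>\<^bsub>M\<^esub> x) \<oplus>\<^bsub>M\<^esub> a \<odot>\<^bsub>M\<^esub> x \<in> N" using t(3) submodule_add[OF N(1)] by blast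
    moreover have "(t \<odot>\<^bsub>M\<^esub> y \<ominus>\<^bsub>M\<^esub> a \<odot>\<^bsub>M\<^esub> x) \<oplus>\<^bsub>M\<^esub> a \<odot>\<^bsub>M\<^esub> x = t \<odot>\<^bsub>M\<^esub> y"
      using yc t xc T.denominators_carrier by (simp add: a_minus_def M.a_assoc M.l_neg)
    ultimately have "t \<odot>\<^bsub>M\<^esub> y \<in> N" by simp
    then show ?thesis using S.mem_frac_set_iff[OF N(1) yc y(2)] y(3) t(1) homog_compl_subset by blast
  qed
  then show "K = frac_set (carrier R - P) M N" using K(2) by blast
qed

text \<open>Here only the homogeneous elements outside \<open>P\<close> become units, so the
  coefficient has to be homogeneous. This is why a homogeneous \<open>y\<close> outside
  \<open>N\<close> is picked from the contraction of \<open>K\<close> and its relation to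
  \<open>x\<close> is cut down to one degree.\<close>

lemma prime_step_star_simple:
  assumes K: "T.loc_graded_submodule K" "frac_set T M N \<subseteq> K" "K \<subseteq> frac_set T M N'"
  shows "K = frac_set T M N \<or> K = frac_set T M N'"
proof (rule disj_imp[THEN iffD2], rule impI)
  assume ne: "K \<noteq> frac_set T M N"
  obtain d x where x: "x \<in> \<M> d" "x \<in> N'" "colon N x = P"
    "\<And>y. y \<in> N' \<Longrightarrow> \<exists>t\<in>T. \<exists>a\<in>carrier R. t \<odot>\<^bsub>M\<^esub> y \<ominus>\<^bsub>M\<^esub> a \<odot>\<^bsub>M\<^esub> x \<in> N"
    using step unfolding prime_step_def by blast
  note N = prime_step_submodules
  have gN: "\<And>x i. x \<in> N \<Longrightarrow> hcomp M \<M> i x \<in> N"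
    using step graded_submodule_iff by (auto simp: prime_step_def)
  have xc: "x \<in> carrier M" using submodule_subset[OF N(2) x(2)] .
  have Ks: "submodule K (loc_ring R T) (loc_module R T M)" using K(1) T.loc_graded_submodule_iff by blast
  let ?K = "numerators R T M K"
  have gK: "submodule ?K R M" "\<And>x i. x \<in> ?K \<Longrightarrow> hcomp M \<M> i x \<in> ?K"
    using T.numerators_graded_submodule[OF K(1)] graded_submodule_iff by auto
  have "\<not> ?K \<subseteq> N"
    using frac_set_mono[of ?K N T M] T.frac_set_numerators[OF Ks] ne K(2) by auto
  then obtain y0 where y0: "y0 \<in> ?K" "y0 \<notin> N" by blast
  have y0c: "y0 \<in> carrier M" using submodule_subset[OF gK(1) y0(1)] .
  obtain e where e: "hcomp M \<M> e y0 \<notin> N"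
    using GM.mem_subgroup_of_hcomp[OF submodule.axioms(1)[OF N(1)] y0c] y0(2) by blast
  define y where "y = hcomp M \<M> e y0"
  have y: "y \<in> \<M> e" "y \<notin> N" "y \<in> ?K" "y \<in> carrier M" using e y0 y0c gK by (auto simp: y_def)
  have "mfrac T M y \<one> \<in> frac_set T M N'" using y(3) K(3) by (auto simp: numerators_def)
  then obtain u where u: "u \<in> T" "u \<odot>\<^bsub>M\<^esub> y \<in> N'" using T.mem_frac_set_iff[OF N(2) y(4)] by auto
  then have yN': "y \<in> N'" using saturatedD[OF N(5)] y(4) by blast
  obtain t a where t: "t \<in> T" "a \<in> carrier R" "t \<odot>\<^bsub>M\<^esub> y \<ominus>\<^bsub>M\<^esub> a \<odot>\<^bsub>M\<^esub> x \<in> N" using x(4)[OF yN'] by blast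
  obtain k where k: "t \<in> \<A> k" using t(1) by (auto simp: mem_homog_compl_iff)
  \<comment> \<open>\<open>t y\<close> has degree \<open>k + e\<close> and \<open>x\<close> has
    degree \<open>d\<close>, so in that degree only the component of \<open>a\<close> of degree
    \<open>k + e - d\<close> survives.\<close>
  define b where "b = hcomp R \<A> (k + e - d) a"
  have b: "b \<in> \<A> (k + e - d)" "b \<in> carrier R" using t(2) by (auto simp: b_def)
  have "hcomp M \<M> (k + e) (t \<odot>\<^bsub>M\<^esub> y \<ominus>\<^bsub>M\<^esub> a \<odot>\<^bsub>M\<^esub> x) \<in> N" by (rule gN[OF t(3)])
  moreover have "hcomp M \<M> (k + e) (t \<odot>\<^bsub>M\<^esub> y \<ominus>\<^bsub>M\<^esub> a \<odot>\<^bsub>M\<^esub> x) = t \<odot>\<^bsub>M\<^esub> y \<ominus>\<^bsub>M\<^esub> b \<odot>\<^bsub>M\<^esub> x"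
    using hcomp_smult_homogeneous[OF t(2) x(1), of "k + e - d"] graded_smult[OF k y(1)] t(1,2) xc y(4)
    by (simp add: a_minus_def GM.hcomp_add GM.hcomp_minus b_def)
  ultimately have tb: "t \<odot>\<^bsub>M\<^esub> y \<ominus>\<^bsub>M\<^esub> b \<odot>\<^bsub>M\<^esub> x \<in> N" by simp
  have "b \<notin> P"
  proof
    assume "b \<in> P"
    then have "b \<odot>\<^bsub>M\<^esub> x \<in> N" using x(3) by (auto simp: colon_def)
    then have "(t \<odot>\<^bsub>M\<^esub> y \<ominus>\<^bsub>M\<^esub> b \<odot>\<^bsub>M\<^esub> x) \<oplus>\<^bsub>M\<^esub> b \<odot>\<^bsub>M\<^esub> x \<in> N" using tb submodule_add[OF N(1)] by blast
    moreover have "(t \<odot>\<^bsub>M\<^esub> y \<ominus>\<^bsub>M\<^esub> b \<odot>\<^bsub>M\<^esub> x) \<oplus>\<^bsub>M\<^esub> b \<odot>\<^bsub>M\<^esub> x = t \<odot>\<^bsub>M\<^esub> y"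
      using y(4) t b xc by (simp add: a_minus_def M.a_assoc M.l_neg)
    ultimately show False using saturatedD[OF N(4) t(1) y(4)] y(2) by simp
  qed
  then have "b \<in> T" using b by (auto simp: mem_homog_compl_iff)
  from frac_set_subset_of_generator[OF T.localization_axioms order.refl Ks K(2) y(3) xc x(4) t(1) this tb]
  show "K = frac_set T M N'" using K(3) by blast
qed

end

text \<open>By *simplicity every homogeneous element of \<open>N'\<close> outside \<open>N\<close>
  generates \<open>N'\<close> modulo \<open>N\<close> up to denominators in \<open>T\<close>.
  Applied to multiples \<open>a x\<close>, this determines the homogeneous elements of
  \<open>(N : x)\<close>, which turn out to be those of \<open>P\<close>.\<close>

lemma prime_step_of_star_simple:
  assumes F: "T.loc_graded_submodule F" "T.loc_graded_submodule F'" "F \<subset> F'"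
    and simple: "\<And>K. T.loc_graded_submodule K \<Longrightarrow> F \<subseteq> K \<Longrightarrow> K \<subseteq> F' \<Longrightarrow> K = F \<or> K = F'"
  shows "prime_step (numerators R T M F) (numerators R T M F')"
proof -
  let ?N = "numerators R T M F" and ?N' = "numerators R T M F'"
  have Fs: "submodule F (loc_ring R T) (loc_module R T M)" "submodule F' (loc_ring R T) (loc_module R T M)"
    using F T.loc_graded_submodule_iff by auto
  have g: "graded_submodule R \<A> M \<M> ?N" "graded_submodule R \<A> M \<M> ?N'"
    using F T.numerators_graded_submodule by auto
  then have N: "submodule ?N R M" "\<And>x i. x \<in> ?N \<Longrightarrow> hcomp M \<M> i x \<in> ?N"
    "submodule ?N' R M" "\<And>x i. x \<in> ?N' \<Longrightarrow> hcomp M \<M> i x \<in> ?N'"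
    using graded_submodule_iff by auto
  have sub: "?N \<subseteq> ?N'" using F(3) by (auto simp: numerators_def)
  have sat: "saturated ?N" "saturated ?N'"
    using T.numerators_saturated[OF Fs(1)] T.numerators_saturated[OF Fs(2)] by (auto simp: saturated_def)
  have gen: "\<exists>t\<in>T. \<exists>a\<in>carrier R. t \<odot>\<^bsub>M\<^esub> y \<ominus>\<^bsub>M\<^esub> a \<odot>\<^bsub>M\<^esub> z \<in> ?N"
    if z: "z \<in> \<M> e" "z \<in> ?N'" "z \<notin> ?N" and y: "y \<in> ?N'" for z e y
  proof -
    have zc: "z \<in> carrier M" using submodule_subset[OF N(3) z(2)] .
    have yc: "y \<in> carrier M" using submodule_subset[OF N(3) y] .
    let ?Z = "{a \<odot>\<^bsub>M\<^esub> z | a. a \<in> carrier R}"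
    \<comment> \<open>The sum of \<open>N\<close> and the span of \<open>z\<close>. Its extension
      lies between \<open>F\<close> and \<open>F'\<close> and differs from \<open>F\<close> because
      it contains \<open>z/1\<close>, so it is \<open>F'\<close>.\<close>
    let ?H = "{h \<oplus>\<^bsub>M\<^esub> k | h k. h \<in> ?N \<and> k \<in> ?Z}"
    note H = submodule_sum[OF N(1) cyclic_submodule(1)[OF zc]]
    have "graded_submodule R \<A> M \<M> ?H"
      unfolding graded_submodule_iff
    proof (intro conjI ballI allI H(1))
      fix w i assume "w \<in> ?H"
      then obtain h a where w: "w = h \<oplus>\<^bsub>M\<^esub> a \<odot>\<^bsub>M\<^esub> z" "h \<in> ?N" "a \<in> carrier R" by blast
      have "hcomp M \<M> i w = hcomp M \<M> i h \<oplus>\<^bsub>M\<^esub> hcomp R \<A> (i - e) a \<odot>\<^bsub>M\<^esub> z"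
        using w submodule_subset[OF N(1)] zc hcomp_smult_homogeneous[OF w(3) z(1), of "i - e"]
        by (simp add: GM.hcomp_add)
      moreover have "hcomp R \<A> (i - e) a \<in> carrier R" using w(3) by simp
      ultimately show "hcomp M \<M> i w \<in> ?H" using N(2)[OF w(2)] by blast
    qed
    then have gK: "T.loc_graded_submodule (frac_set T M ?H)" by (rule T.frac_set_graded_submodule)
    have "F \<subseteq> frac_set T M ?H" using frac_set_mono[OF H(2), of T M] T.frac_set_numerators[OF Fs(1)] by simp
    moreover have "?H \<subseteq> ?N'" using sub z(2) submodule_add[OF N(3)] submodule_smult[OF N(3)] by blast
    then have "frac_set T M ?H \<subseteq> F'"
      using frac_set_mono[of ?H ?N' T M] T.frac_set_numerators[OF Fs(2)] by simp
    moreover have "frac_set T M ?H \<noteq> F"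
    proof
      assume eq: "frac_set T M ?H = F"
      have "z \<in> ?H" using H(3) cyclic_submodule(2)[OF zc] by blast
      then have "mfrac T M z \<one> \<in> F" using frac_setI[OF _ T.denominators_one, of z ?H M] eq by simp
      then show False using z(3) zc by (simp add: numerators_def)
    qed
    ultimately have "frac_set T M ?H = F'" using simple[OF gK] by blast
    then have "mfrac T M y \<one> \<in> frac_set T M ?H" using y by (simp add: numerators_def)
    then obtain u where u: "u \<in> T" "u \<odot>\<^bsub>M\<^esub> y \<in> ?H"
      using T.mem_frac_set_iff[OF H(1) yc T.denominators_one] by blast
    then obtain h a where h: "u \<odot>\<^bsub>M\<^esub> y = h \<oplus>\<^bsub>M\<^esub> a \<odot>\<^bsub>M\<^esub> z" "h \<in> ?N" "a \<in> carrier R" by blast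
    then have "u \<odot>\<^bsub>M\<^esub> y \<ominus>\<^bsub>M\<^esub> a \<odot>\<^bsub>M\<^esub> z = h"
      using zc submodule_subset[OF N(1)] by (simp add: a_minus_def M.a_assoc M.r_neg)
    then show ?thesis using u(1) h by blast
  qed
  have "\<not> ?N' \<subseteq> ?N"
    using sub F(3) T.frac_set_numerators[OF Fs(1)] T.frac_set_numerators[OF Fs(2)] by (metis order.antisym psubset_eq)
  then obtain x0 where x0: "x0 \<in> ?N'" "x0 \<notin> ?N" by blast
  have x0c: "x0 \<in> carrier M" using submodule_subset[OF N(3) x0(1)] .
  obtain d where d: "hcomp M \<M> d x0 \<notin> ?N"
    using GM.mem_subgroup_of_hcomp[OF submodule.axioms(1)[OF N(1)] x0c] x0(2) by blast
  define x where "x = hcomp M \<M> d x0"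
  have x: "x \<in> \<M> d" "x \<notin> ?N" "x \<in> ?N'" "x \<in> carrier M" using d x0 x0c N(4) by (auto simp: x_def)
  \<comment> \<open>If \<open>a \<in> P\<close> and \<open>a x \<notin> N\<close>, then
    \<open>a x\<close> is itself a generator, so \<open>t x = c a x\<close> modulo \<open>N\<close>
    for some \<open>t \<in> T\<close> and homogeneous \<open>c\<close>. The homogeneous element
    \<open>t - c a\<close> takes \<open>x\<close> into \<open>N\<close>, so saturation puts it in
    \<open>P\<close>, and with it \<open>t\<close>, a contradiction.\<close>
  have hom: "a \<in> colon ?N x \<longleftrightarrow> a \<in> P" if a: "a \<in> \<A> i" for a i
  proof
    have ac: "a \<in> carrier R" using a GR.homogeneous_carrier by blast
    show "a \<in> P" if "a \<in> colon ?N x"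
      using that saturatedD[OF sat(1) _ x(4)] x(2) a by (auto simp: colon_def mem_homog_compl_iff)
    assume aP: "a \<in> P"
    show "a \<in> colon ?N x"
    proof (rule ccontr)
      assume "a \<notin> colon ?N x"
      then have z: "a \<odot>\<^bsub>M\<^esub> x \<in> \<M> (i + d)" "a \<odot>\<^bsub>M\<^esub> x \<in> ?N'" "a \<odot>\<^bsub>M\<^esub> x \<notin> ?N"
        using graded_smult[OF a x(1)] submodule_smult[OF N(3) ac x(3)] ac by (auto simp: colon_def)
      obtain t b where t: "t \<in> T" "b \<in> carrier R" "t \<odot>\<^bsub>M\<^esub> x \<ominus>\<^bsub>M\<^esub> b \<odot>\<^bsub>M\<^esub> (a \<odot>\<^bsub>M\<^esub> x) \<in> ?N"
        using gen[OF z x(3)] by blast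
      obtain k where k: "t \<in> \<A> k" using t(1) by (auto simp: mem_homog_compl_iff)
      \<comment> \<open>\<open>t x\<close> has degree \<open>k + d\<close> and \<open>a x\<close>
        has degree \<open>i + d\<close>, so the matching component of the coefficient has degree
        \<open>k - i\<close>.\<close>
      define c where "c = hcomp R \<A> (k - i) b"
      have c: "c \<in> \<A> (k - i)" "c \<in> carrier R" using t(2) by (auto simp: c_def)
      have tc: "t \<in> carrier R" using t(1) by simp
      have "hcomp M \<M> (k + d) (t \<odot>\<^bsub>M\<^esub> x \<ominus>\<^bsub>M\<^esub> b \<odot>\<^bsub>M\<^esub> (a \<odot>\<^bsub>M\<^esub> x)) \<in> ?N" by (rule N(2)[OF t(3)])
      moreover have "hcomp M \<M> (k + d) (t \<odot>\<^bsub>M\<^esub> x \<ominus>\<^bsub>M\<^esub> b \<odot>\<^bsub>M\<^esub> (a \<odot>\<^bsub>M\<^esub> x)) =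
          t \<odot>\<^bsub>M\<^esub> x \<ominus>\<^bsub>M\<^esub> c \<odot>\<^bsub>M\<^esub> (a \<odot>\<^bsub>M\<^esub> x)"
        using hcomp_smult_homogeneous[OF t(2) z(1), of "k - i"] graded_smult[OF k x(1)] t(2) tc x(4) ac
        by (simp add: a_minus_def GM.hcomp_add GM.hcomp_minus c_def)
      moreover have "t \<odot>\<^bsub>M\<^esub> x \<ominus>\<^bsub>M\<^esub> c \<odot>\<^bsub>M\<^esub> (a \<odot>\<^bsub>M\<^esub> x) = (t \<oplus> \<ominus> (c \<otimes> a)) \<odot>\<^bsub>M\<^esub> x"
        using tc c ac x(4) by (simp add: a_minus_def smult_l_distr smult_l_minus smult_assoc1)
      ultimately have "(t \<oplus> \<ominus> (c \<otimes> a)) \<odot>\<^bsub>M\<^esub> x \<in> ?N" by simp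
      moreover have th: "t \<oplus> \<ominus> (c \<otimes> a) \<in> \<A> k"
        using graded_mult[OF c(1) a] k by (auto intro!: GR.homogeneous_add GR.homogeneous_minus)
      ultimately have tP: "t \<oplus> \<ominus> (c \<otimes> a) \<in> P"
        using saturatedD[OF sat(1) _ x(4)] x(2) by (auto simp: mem_homog_compl_iff)
      have "c \<otimes> a \<in> P" using aP c by (simp add: P.I_l_closed)
      then have "(t \<oplus> \<ominus> (c \<otimes> a)) \<oplus> c \<otimes> a \<in> P" using tP P.a_closed by blast
      then have "t \<in> P" using tc c ac         by (simp add: abelian_monoid.a_assoc[OF abelian_group.axioms(1)[OF is_abelian_group]]
            abelian_group.l_neg[OF is_abelian_group])
      then show False using t(1) by (simp add: mem_homog_compl_iff)
    qed
  qed
  have "colon ?N x = P"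
  proof (rule colon_eq_prime[OF g(1) sat(1) x(1,2)])
    fix i j a b assume a: "a \<in> \<A> i" and b: "b \<in> \<A> j" and ab: "a \<otimes> b \<in> colon ?N x"
    have "a \<otimes> b \<in> P" using hom[OF graded_mult[OF a b]] ab by blast
    then show "a \<in> colon ?N x \<or> b \<in> colon ?N x"
      using P.I_prime[of a b] hom[OF a] hom[OF b] GR.homogeneous_carrier[OF a] GR.homogeneous_carrier[OF b]
      by blast
  qed
  then show ?thesis
    unfolding prime_step_def
    by (intro conjI exI bexI[of _ x] ballI g sat sub gen[OF x(1,3,2)]) (use x in auto)
qed

text \<open>The graded form of the existence of an associated prime of \<open>M / N\<close>. For
  homogeneous \<open>b \<notin> (N : x)\<close> the element \<open>b x\<close> competes with
  \<open>x\<close>, and \<open>(N : b x)\<close> contains \<open>(N : x)\<close>; maximality makes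
  them equal, so \<open>a b \<in> (N : x)\<close> forces \<open>a \<in> (N : x)\<close>.\<close>

lemma exists_prime_step:
  assumes gN: "graded_submodule R \<A> M \<M> N" and sat: "saturated N" and ne: "N \<noteq> carrier M"
  shows "\<exists>N'. prime_step N N' \<and> N \<subset> N'"
proof -
  have N: "submodule N R M" "\<And>x i. x \<in> N \<Longrightarrow> hcomp M \<M> i x \<in> N"
    using gN graded_submodule_iff by auto
  let ?X = "{x. (\<exists>d. x \<in> \<M> d) \<and> x \<notin> N}"
  have "?X \<noteq> {}"
  proof -
    obtain m where m: "m \<in> carrier M" "m \<notin> N" using ne submodule_subset[OF N(1)] by blast
    then obtain i where "hcomp M \<M> i m \<notin> N"
      using GM.mem_subgroup_of_hcomp[OF submodule.axioms(1)[OF N(1)]] by blast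
    then show ?thesis using GM.hcomp_homogeneous[OF m(1)] by blast
  qed
  then have "\<exists>I\<in>colon N ` ?X. \<forall>J\<in>colon N ` ?X. I \<subseteq> J \<longrightarrow> J = I"
    using colon_ideal[OF N(1)] GM.homogeneous_carrier
    by (intro noetherian_ring.maximal_ideal_of_family[OF noetherian]) auto
  then obtain x where x: "x \<in> ?X" and "\<forall>J\<in>colon N ` ?X. colon N x \<subseteq> J \<longrightarrow> J = colon N x"
    by (elim bexE imageE) simp
  then have max: "colon N y = colon N x" if "y \<in> \<M> e" "y \<notin> N" "colon N x \<subseteq> colon N y" for y e
    using that by blast
  from x obtain d where x: "x \<in> \<M> d" "x \<notin> N" by blast
  have xc: "x \<in> carrier M" using x GM.homogeneous_carrier by blast
  have colon: "colon N x = P"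
  proof (rule colon_eq_prime[OF gN sat x])
    fix i j a b assume a: "a \<in> \<A> i" and b: "b \<in> \<A> j" and ab: "a \<otimes> b \<in> colon N x"
    show "a \<in> colon N x \<or> b \<in> colon N x"
    proof (rule disjCI)
      assume nb: "b \<notin> colon N x"
      have c: "a \<in> carrier R" "b \<in> carrier R" using a b GR.homogeneous_carrier by auto
      have "colon N x \<subseteq> colon N (b \<odot>\<^bsub>M\<^esub> x)"
      proof
        fix r assume r: "r \<in> colon N x"
        then have "b \<odot>\<^bsub>M\<^esub> (r \<odot>\<^bsub>M\<^esub> x) \<in> N" "r \<in> carrier R"
          using submodule_smult[OF N(1) c(2)] by (auto simp: colon_def)
        moreover have "b \<odot>\<^bsub>M\<^esub> (r \<odot>\<^bsub>M\<^esub> x) = r \<odot>\<^bsub>M\<^esub> (b \<odot>\<^bsub>M\<^esub> x)"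
          using c(2) xc \<open>r \<in> carrier R\<close> by (simp add: m_comm flip: smult_assoc1)
        ultimately show "r \<in> colon N (b \<odot>\<^bsub>M\<^esub> x)" by (simp add: colon_def)
      qed
      moreover have "b \<odot>\<^bsub>M\<^esub> x \<notin> N" using nb c by (simp add: colon_def)
      ultimately have "colon N (b \<odot>\<^bsub>M\<^esub> x) = colon N x" using max graded_smult[OF b x(1)] by blast
      moreover have "a \<in> colon N (b \<odot>\<^bsub>M\<^esub> x)" using ab c xc by (simp add: colon_def smult_assoc1)
      ultimately show "a \<in> colon N x" by simp
    qed
  qed
  let ?Z = "{a \<odot>\<^bsub>M\<^esub> x | a. a \<in> carrier R}"
  let ?H = "{h \<oplus>\<^bsub>M\<^esub> k | h k. h \<in> N \<and> k \<in> ?Z}"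
  note H = submodule_sum[OF N(1) cyclic_submodule(1)[OF xc]]
  have "graded_submodule R \<A> M \<M> ?H"
    unfolding graded_submodule_iff
  proof (intro conjI ballI allI H(1))
    fix w i assume "w \<in> ?H"
    then obtain h a where w: "w = h \<oplus>\<^bsub>M\<^esub> a \<odot>\<^bsub>M\<^esub> x" "h \<in> N" "a \<in> carrier R" by blast
    have "hcomp M \<M> i w = hcomp M \<M> i h \<oplus>\<^bsub>M\<^esub> hcomp R \<A> (i - d) a \<odot>\<^bsub>M\<^esub> x"
      using w submodule_subset[OF N(1)] xc hcomp_smult_homogeneous[OF w(3) x(1), of "i - d"]
      by (simp add: GM.hcomp_add)
    moreover have "hcomp R \<A> (i - d) a \<in> carrier R" using w(3) by simp
    ultimately show "hcomp M \<M> i w \<in> ?H" using N(2)[OF w(2)] by blast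
  qed
  then have gK: "T.loc_graded_submodule (frac_set T M ?H)" by (rule T.frac_set_graded_submodule)
  \<comment> \<open>The \<open>T\<close>-saturation of the sum of \<open>N\<close> and the span of
    \<open>x\<close>. As a contraction it is graded and saturated, and generation by
    \<open>x\<close> is preserved because it is only demanded up to denominators.\<close>
  define N' where "N' = numerators R T M (frac_set T M ?H)"
  have gN': "graded_submodule R \<A> M \<M> N'"
    unfolding N'_def by (rule T.numerators_graded_submodule[OF gK])
  have satN': "saturated N'"
    unfolding saturated_def N'_def
    using T.numerators_saturated[of "frac_set T M ?H"] gK T.loc_graded_submodule_iff by blast
  have memN': "y \<in> N' \<longleftrightarrow> y \<in> carrier M \<and> (\<exists>u\<in>T. u \<odot>\<^bsub>M\<^esub> y \<in> ?H)" for y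
    unfolding N'_def numerators_def using T.mem_frac_set_iff[OF H(1) _ T.denominators_one] by blast
  have HN': "?H \<subseteq> N'"
  proof
    fix y assume y: "y \<in> ?H"
    then have yc: "y \<in> carrier M" by (rule submodule_subset[OF H(1)])
    then have "\<one> \<odot>\<^bsub>M\<^esub> y \<in> ?H" using y by (simp only: smult_one)
    then show "y \<in> N'" using memN' yc T.denominators_one by blast
  qed
  have NN': "N \<subseteq> N'" using H(2) HN' by blast
  have xN': "x \<in> N'" using H(3) cyclic_submodule(2)[OF xc] HN' by blast
  have "\<exists>t\<in>T. \<exists>a\<in>carrier R. t \<odot>\<^bsub>M\<^esub> y \<ominus>\<^bsub>M\<^esub> a \<odot>\<^bsub>M\<^esub> x \<in> N" if y: "y \<in> N'" for y
  proof -
    obtain u where u: "u \<in> T" "u \<odot>\<^bsub>M\<^esub> y \<in> ?H" using y memN' by blast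
    then obtain h a where h: "u \<odot>\<^bsub>M\<^esub> y = h \<oplus>\<^bsub>M\<^esub> a \<odot>\<^bsub>M\<^esub> x" "h \<in> N" "a \<in> carrier R" by blast
    then have "u \<odot>\<^bsub>M\<^esub> y \<ominus>\<^bsub>M\<^esub> a \<odot>\<^bsub>M\<^esub> x = h"
      using xc submodule_subset[OF N(1)] by (simp add: a_minus_def M.a_assoc M.r_neg)
    then show ?thesis using u(1) h by blast
  qed
  then have "prime_step N N'"
    unfolding prime_step_def
    by (intro conjI exI bexI[of _ x] ballI gN gN' sat satN' NN' colon) (use x(1) xN' in auto)
  then show ?thesis using NN' xN' x(2) by blast
qed

text \<open>The lower end is a parameter because chains are built downwards from
  \<open>carrier M\<close>.\<close>

definition prime_chain :: "'b set \<Rightarrow> nat \<Rightarrow> (nat \<Rightarrow> 'b set) \<Rightarrow> bool" where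
  "prime_chain N n G \<longleftrightarrow> G 0 = N \<and> G n = carrier M \<and> (\<forall>k<n. prime_step (G k) (G (Suc k)))"

text \<open>Noetherian induction: a maximal counterexample \<open>K\<close> is not
  \<open>carrier M\<close>, so a prime step leads to a larger \<open>L\<close>, which has a chain,
  and putting \<open>K\<close> below it contradicts the choice of \<open>K\<close>.\<close>

lemma exists_prime_chain:
  assumes "graded_submodule R \<A> M \<M> N" "saturated N"
  shows "\<exists>n G. prime_chain N n G"
proof (rule ccontr)
  let ?\<C> = "{N. graded_submodule R \<A> M \<M> N \<and> saturated N \<and> \<not> (\<exists>n G. prime_chain N n G)}"
  assume "\<not> (\<exists>n G. prime_chain N n G)"
  then have "?\<C> \<noteq> {}" using assms by blast
  moreover have "submodule K R M" if "K \<in> ?\<C>" for K using that graded_submodule_iff by blast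
  ultimately obtain K where K: "K \<in> ?\<C>" "\<And>L. L \<in> ?\<C> \<Longrightarrow> K \<subseteq> L \<Longrightarrow> L = K"
    using maximal_submodule_of_family[OF noetherian fg, of ?\<C>] by meson

  have "K \<noteq> carrier M"
  proof
    assume "K = carrier M"
    then have "prime_chain K 0 (\<lambda>_. K)" by (simp add: prime_chain_def)
    then show False using K(1) by blast
  qed
  then obtain L where L: "prime_step K L" "K \<subset> L" using exists_prime_step K(1) by blast
  then have "L \<notin> ?\<C>" using K(2) by blast
  moreover have "graded_submodule R \<A> M \<M> L" "saturated L" using L(1) by (auto simp: prime_step_def)
  ultimately obtain n G where G: "prime_chain L n G" by blast
  have "prime_chain K (Suc n) (\<lambda>k. case k of 0 \<Rightarrow> K | Suc k \<Rightarrow> G k)"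
    using G L(1) unfolding prime_chain_def by (auto split: nat.split)
  then show False using K(1) by blast
qed

section \<open>Transfer between prime steps and the two kinds of composition series\<close>

lemmas T_star_composition_series_iff =
  graded_module.star_composition_series_iff[OF T.loc_graded_module]

lemma exists_star_composition_series:
  "\<exists>n F. star_composition_series (homog_loc_ring R \<A> P) (homog_loc_ring_grading R \<A> P)
     (homog_loc_module R \<A> P M) (homog_loc_module_grading \<A> P M \<M>) n F"
proof -
  interpret L: graded_module "loc_ring R T" "loc_grading \<A> T (self_module R) \<A>" "loc_module R T M" T.grading
    by (rule T.loc_graded_module)
  \<comment> \<open>The chain starts at the contraction of zero, which is the
    \<open>T\<close>-torsion of \<open>M\<close>; the zero submodule of \<open>M\<close> itself need
    not be saturated.\<close>
  let ?zero = "{\<zero>\<^bsub>loc_module R T M\<^esub>}"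
  have zero: "T.loc_graded_submodule ?zero"
    unfolding T.loc_graded_submodule_iff by (auto simp: L.submodule_iff)
  then have zs: "submodule ?zero (loc_ring R T) (loc_module R T M)"
    using T.loc_graded_submodule_iff by blast
  have "saturated (numerators R T M ?zero)"
    unfolding saturated_def using T.numerators_saturated[OF zs] by blast
  from exists_prime_chain[OF T.numerators_graded_submodule[OF zero] this]
  obtain n G where G: "G 0 = numerators R T M ?zero" "G n = carrier M"
    "\<And>k. k < n \<Longrightarrow> prime_step (G k) (G (Suc k))"
    unfolding prime_chain_def by blast
  have gG: "graded_submodule R \<A> M \<M> (G k)" if "k \<le> n" for k
  proof (cases k)
    case 0
    then show ?thesis using G(1) T.numerators_graded_submodule[OF zero] by simp
  next
    case (Suc j)
    then show ?thesis using G(3)[of j] that by (simp add: prime_step_def)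
  qed
  have "star_composition_series (loc_ring R T) (loc_grading \<A> T (self_module R) \<A>) (loc_module R T M)
      T.grading n (\<lambda>k. frac_set T M (G k))"
    unfolding T_star_composition_series_iff
  proof (intro conjI allI impI)
    show "frac_set T M (G 0) = ?zero" using G(1) T.frac_set_numerators[OF zs] by simp
    show "frac_set T M (G n) = carrier (loc_module R T M)" using G(2) T.frac_set_carrier by simp
    show "T.loc_graded_submodule (frac_set T M (G k))" if "k \<le> n" for k
      by (rule T.frac_set_graded_submodule[OF gG[OF that]])
    show "frac_set T M (G k) \<subset> frac_set T M (G (Suc k))" if "k < n" for k
      using frac_set_strict[OF G(3)[OF that] T.localization_axioms] by (auto simp: homog_compl_def)
    show "H = frac_set T M (G k) \<or> H = frac_set T M (G (Suc k))"
      if "k < n" "T.loc_graded_submodule H \<and> frac_set T M (G k) \<subseteq> H \<and> H \<subseteq> frac_set T M (G (Suc k))"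
      for k H
      using prime_step_star_simple[OF G(3)[OF that(1)]] that(2) by blast
  qed
  then show ?thesis by blast
qed

text \<open>Each term is contracted to \<open>M\<close> and extended again with the larger set of
  denominators. Consecutive contractions form prime steps, whose extensions remain distinct with
  nothing strictly between them, so no term is lost or inserted.\<close>

lemma composition_series_of_star_composition_series:
  assumes "star_composition_series (homog_loc_ring R \<A> P) (homog_loc_ring_grading R \<A> P)
     (homog_loc_module R \<A> P M) (homog_loc_module_grading \<A> P M \<M>) n F"
  shows "composition_series (prime_loc_ring R P) (prime_loc_module R P M) n
     (\<lambda>k. frac_set (carrier R - P) M (numerators R T M (F k)))"
proof -
  note F = assms[unfolded T_star_composition_series_iff]
  let ?G = "\<lambda>k. numerators R T M (F k)" and ?S = "carrier R - P"
  have step: "prime_step (?G k) (?G (Suc k))" if "k < n" for k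
    using F that by (intro prime_step_of_star_simple) auto
  have Fs: "submodule (F k) (loc_ring R T) (loc_module R T M)" if "k \<le> n" for k
    using F that T.loc_graded_submodule_iff by blast
  \<comment> \<open>The contraction of the zero submodule is the \<open>T\<close>-torsion of
    \<open>M\<close>. It dies on inverting \<open>carrier R - P\<close>, which contains
    \<open>T\<close>.\<close>
  have zero: "frac_set ?S M (?G 0) = {\<zero>\<^bsub>loc_module R ?S M\<^esub>}"
  proof -
    have G0: "m \<in> ?G 0 \<longleftrightarrow> m \<in> carrier M \<and> (\<exists>u\<in>T. u \<odot>\<^bsub>M\<^esub> m = \<zero>\<^bsub>M\<^esub>)" for m
      using F T.mfrac_eq_zero_iff[OF _ T.denominators_one] by (auto simp: numerators_def)
    have "X = \<zero>\<^bsub>loc_module R ?S M\<^esub>" if X: "X \<in> frac_set ?S M (?G 0)" for X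
    proof -
      obtain m s where m: "m \<in> ?G 0" "s \<in> ?S" "X = mfrac ?S M m s"
        using X unfolding frac_set_def by blast
      then show ?thesis using S.mfrac_eq_zero_iff[of m s] G0[of m] homog_compl_subset by blast
    qed
    moreover have "\<zero>\<^bsub>loc_module R ?S M\<^esub> \<in> frac_set ?S M (?G 0)"
      using module.submodule_zero[OF S.loc_module_module S.frac_set_submodule] T.numerators_submodule[OF Fs] by blast
    ultimately show ?thesis by blast
  qed
  show ?thesis
    unfolding module.composition_series_iff[OF S.loc_module_module]
  proof (intro conjI allI impI zero)
    have "?G n = carrier M" using F by (auto simp: numerators_def)
    then show "frac_set ?S M (?G n) = carrier (loc_module R ?S M)" using S.frac_set_carrier by simp
    show "submodule (frac_set ?S M (?G k)) (loc_ring R ?S) (loc_module R ?S M)" if "k \<le> n" for k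
      by (rule S.frac_set_submodule[OF T.numerators_submodule[OF Fs[OF that]]])
    show "frac_set ?S M (?G k) \<subset> frac_set ?S M (?G (Suc k))" if "k < n" for k
      using frac_set_strict[OF step[OF that] S.localization_axioms] by blast
    show "H = frac_set ?S M (?G k) \<or> H = frac_set ?S M (?G (Suc k))"
      if "k < n" "submodule H (loc_ring R ?S) (loc_module R ?S M) \<and>
        frac_set ?S M (?G k) \<subseteq> H \<and> H \<subseteq> frac_set ?S M (?G (Suc k))" for k H
      using prime_step_localized_simple[OF step[OF that(1)]] that(2) by blast
  qed
qed

end

theorem theorem4p10:
  fixes A :: "('a, 'r) ring_scheme" and \<A> :: "int \<Rightarrow> 'a set"
    and M :: "('a, 'b, 'm) module_scheme" and \<M> :: "int \<Rightarrow> 'b set"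
    and P :: "'a set"
  assumes "graded_ring A \<A>" and "noetherian_ring A"
    and "graded_module A \<A> M \<M>" and "finitely_generated A M"
    and "minimal_prime_over A (annihilator A M) P"
  shows "(\<exists>n F. star_composition_series
            (homog_loc_ring A \<A> P) (homog_loc_ring_grading A \<A> P)
            (homog_loc_module A \<A> P M) (homog_loc_module_grading \<A> P M \<M>) n F) \<and>
         star_length (homog_loc_ring A \<A> P) (homog_loc_ring_grading A \<A> P)
            (homog_loc_module A \<A> P M) (homog_loc_module_grading \<A> P M \<M>)
         = module_length (prime_loc_ring A P) (prime_loc_module A P M)"
proof -
  interpret minimal_prime_of_graded_module A \<A> M \<M> P
    by (intro minimal_prime_of_graded_module.intro minimal_prime_of_graded_module_axioms.intro assms)
  let ?series = "star_composition_series (homog_loc_ring A \<A> P) (homog_loc_ring_grading A \<A> P)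
            (homog_loc_module A \<A> P M) (homog_loc_module_grading \<A> P M \<M>)"
  have length: "module_length (prime_loc_ring A P) (prime_loc_module A P M) = enat n" if "?series n F" for n F
    by (rule module.module_length_eq[OF S.loc_module_module composition_series_of_star_composition_series[OF that]])
  obtain n F where F: "?series n F" using exists_star_composition_series by blast
  \<comment> \<open>The length of \<open>M\<^sub>P\<close> does not depend on the chosen series, so
    all *composition series have the same length and the description in \<open>star_length\<close>
    is proper.\<close>
  have "m = n" if "?series m G" for m G using length[OF that] length[OF F] by simp
  then have "(THE n. \<exists>F. ?series n F) = n" using F by blast
  then have "star_length (homog_loc_ring A \<A> P) (homog_loc_ring_grading A \<A> P)
      (homog_loc_module A \<A> P M) (homog_loc_module_grading \<A> P M \<M>) = enat n"
    unfolding star_length_def using F by auto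
  then show ?thesis using F length[OF F] by auto
qed

end
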